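(* Let $\mathcal K=(K,\Gamma,\mathbf k;v,\pi)$ be a valued difference field satisfying Axiom 2 that is a Witt case (for some prime $p$) with $\mathbf k$ infinite. (1) If $\{a_\rho\}$ is a pc-sequence in $K$, $a$ lies in an extension of $\mathcal K$ that is also a Witt case, $a_\rho\leadsto a$, and $\Sigma$ is a finite set of $\sigma$-polynomials over $K$, then there is a pc-sequence $\{b_\rho\}$ in $K$ equivalent to $\{a_\rho\}$ with $G(b_\rho)\leadsto G(a)$ for every nonconstant $G\in\Sigma$. (2) If $\{a_\rho\}$ is any pc-sequence in $K$ and $\Sigma$ a finite set of $\sigma$-polynomials over $K$, then there is a pc-sequence $\{b_\rho\}$ in $K$ equivalent to $\{a_\rho\}$ such that $\{G(b_\rho)\}$ is a pc-sequence for every nonconstant $G\in\Sigma$.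
   Context: A valued difference field is $(K,\Gamma,\mathbf k;v,\pi)$ with $K$ a field with automorphism $\sigma$, $v:K^\times\to\Gamma$ a surjective valuation onto an ordered abelian group, valuation ring $\mathcal O$, $\pi:\mathcal O\to\mathbf k$ the residue map; $\sigma(\mathcal O)=\mathcal O$, inducing $\bar\sigma$ on $\mathbf k$, and $v(\sigma(a))=v(a)$ for all $a\in K^\times$ (Axiom 1, standing, also for extensions; an extension extends as valued field with automorphism extending $\sigma$). Axiom 2: every $\gamma\in\Gamma$ is $v(a)$ for some $a$ with $\sigma(a)=a$. Witt case (for $p$): $\operatorname{char}K=0$, $\operatorname{char}\mathbf k=p>0$, $\mathbf k$ perfect, $\Gamma$ has a least positive element equal to $v(p)$, and $\bar\sigma(y)=y^p$ for all $y\in\mathbf k$. A $\sigma$-polynomial over $K$ is $G(x)=g(x,\sigma(x),\dots,\sigma^n(x))$ with $g\in K[x_0,\dots,x_n]$; nonconstant means $G\notin K$. pc-sequence: well-indexed sequence with $v(a_{\rho''}-a_{\rho'})>v(a_{\rho'}-a_\rho)$ for $\rho''>\rho'>\rho\ge\rho_0$; $a_\rho\leadsto a$ means $v(a-a_\rho)$ eventually strictly increasing; two pc-sequences (same index set) are equivalent if they have the same pseudolimits in every valued field extension. *)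

theory Defs
  imports "HOL-Algebra.Algebra" "HOL-Computational_Algebra.Primes"
begin

section \<open>Ordered abelian groups\<close>

text \<open>The group operation is written multiplicatively, as everywhere in HOL-Algebra: the
  neutral element \<open>\<one>\<close> of a value group is the element that is usually written 0.\<close>

record 'g ogroup = "'g monoid" +
  ole :: "'g \<Rightarrow> 'g \<Rightarrow> bool"  (infix \<open>\<preceq>\<index>\<close> 50)

definition olt :: "('g, 'z) ogroup_scheme \<Rightarrow> 'g \<Rightarrow> 'g \<Rightarrow> bool"  (infix \<open>\<prec>\<index>\<close> 50)
  where "x \<prec>\<^bsub>G\<^esub> y \<longleftrightarrow> x \<preceq>\<^bsub>G\<^esub> y \<and> x \<noteq> y"

locale ordered_abelian_group = comm_group G
  for G :: "('g, 'z) ogroup_scheme" (structure) +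
  assumes ole_refl: "x \<in> carrier G \<Longrightarrow> x \<preceq> x"
    and ole_antisym: "\<lbrakk>x \<in> carrier G; y \<in> carrier G; x \<preceq> y; y \<preceq> x\<rbrakk> \<Longrightarrow> x = y"
    and ole_trans: "\<lbrakk>x \<in> carrier G; y \<in> carrier G; z \<in> carrier G; x \<preceq> y; y \<preceq> z\<rbrakk> \<Longrightarrow> x \<preceq> z"
    and ole_total: "\<lbrakk>x \<in> carrier G; y \<in> carrier G\<rbrakk> \<Longrightarrow> x \<preceq> y \<or> y \<preceq> x"
    and ole_mult_mono: "\<lbrakk>x \<in> carrier G; y \<in> carrier G; z \<in> carrier G; x \<preceq> y\<rbrakk> \<Longrightarrow> z \<otimes> x \<preceq> z \<otimes> y"


section \<open>Valued fields and valued difference fields\<close>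

text \<open>Only the values of \<open>vmap\<close> at nonzero field elements and of \<open>rmap\<close> on the valuation ring
  are meaningful.\<close>

record ('a, 'g, 'k) vfield =
  Fld :: "'a ring"
  VGrp :: "'g ogroup"
  RFld :: "'k ring"
  vmap :: "'a \<Rightarrow> 'g"
  rmap :: "'a \<Rightarrow> 'k"

definition nonzeros :: "('a, 'g, 'k, 'z) vfield_scheme \<Rightarrow> 'a set"
  where "nonzeros K = carrier (Fld K) - {\<zero>\<^bsub>Fld K\<^esub>}"

definition valring :: "('a, 'g, 'k, 'z) vfield_scheme \<Rightarrow> 'a set"
  where "valring K = {a \<in> carrier (Fld K). a = \<zero>\<^bsub>Fld K\<^esub> \<or> \<one>\<^bsub>VGrp K\<^esub> \<preceq>\<^bsub>VGrp K\<^esub> vmap K a}"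

definition maxideal :: "('a, 'g, 'k, 'z) vfield_scheme \<Rightarrow> 'a set"
  where "maxideal K = {a \<in> carrier (Fld K). a = \<zero>\<^bsub>Fld K\<^esub> \<or> \<one>\<^bsub>VGrp K\<^esub> \<prec>\<^bsub>VGrp K\<^esub> vmap K a}"

locale valued_field =
  fixes K :: "('a, 'g, 'k, 'z) vfield_scheme"
  assumes Fld_field: "field (Fld K)"
    and VGrp_ordered: "ordered_abelian_group (VGrp K)"
    and RFld_field: "field (RFld K)"
    and vmap_surj: "vmap K ` nonzeros K = carrier (VGrp K)"
    and vmap_mult: "\<lbrakk>a \<in> nonzeros K; b \<in> nonzeros K\<rbrakk> \<Longrightarrow>
          vmap K (a \<otimes>\<^bsub>Fld K\<^esub> b) = vmap K a \<otimes>\<^bsub>VGrp K\<^esub> vmap K b"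
    and vmap_add: "\<lbrakk>a \<in> nonzeros K; b \<in> nonzeros K; a \<oplus>\<^bsub>Fld K\<^esub> b \<in> nonzeros K; \<gamma> \<in> carrier (VGrp K);
          \<gamma> \<preceq>\<^bsub>VGrp K\<^esub> vmap K a; \<gamma> \<preceq>\<^bsub>VGrp K\<^esub> vmap K b\<rbrakk> \<Longrightarrow> \<gamma> \<preceq>\<^bsub>VGrp K\<^esub> vmap K (a \<oplus>\<^bsub>Fld K\<^esub> b)"
    and rmap_hom: "rmap K \<in> ring_hom (Fld K\<lparr>carrier := valring K\<rparr>) (RFld K)"
    and rmap_surj: "rmap K ` valring K = carrier (RFld K)"
    and rmap_kernel: "{a \<in> valring K. rmap K a = \<zero>\<^bsub>RFld K\<^esub>} = maxideal K"

record ('a, 'g, 'k) vdfield = "('a, 'g, 'k) vfield" +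
  aut :: "'a \<Rightarrow> 'a"

locale valued_difference_field = valued_field K
  for K :: "('a, 'g, 'k, 'z) vdfield_scheme" +
  assumes aut_iso: "aut K \<in> ring_iso (Fld K) (Fld K)"
    and aut_valring: "aut K ` valring K = valring K"
    and aut_vmap: "a \<in> nonzeros K \<Longrightarrow> vmap K (aut K a) = vmap K a"

definition res_aut :: "('a, 'g, 'k, 'z) vdfield_scheme \<Rightarrow> 'k \<Rightarrow> 'k"
  where "res_aut K y = (THE z. \<forall>a \<in> valring K. rmap K a = y \<longrightarrow> rmap K (aut K a) = z)"

definition axiom2 :: "('a, 'g, 'k, 'z) vdfield_scheme \<Rightarrow> bool"
  where "axiom2 K \<longleftrightarrow> (\<forall>\<gamma> \<in> carrier (VGrp K). \<exists>a \<in> nonzeros K. aut K a = a \<and> vmap K a = \<gamma>)"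

definition ring_char :: "('a, 'z) ring_scheme \<Rightarrow> nat"
  where "ring_char R = (if \<exists>n::nat. n > 0 \<and> add_pow R n \<one>\<^bsub>R\<^esub> = \<zero>\<^bsub>R\<^esub>
           then LEAST n. n > 0 \<and> add_pow R n \<one>\<^bsub>R\<^esub> = \<zero>\<^bsub>R\<^esub> else 0)"

definition perfect_field :: "('a, 'z) ring_scheme \<Rightarrow> bool"
  where "perfect_field R \<longleftrightarrow> field R \<and>
    (ring_char R = 0 \<or> (\<forall>y \<in> carrier R. \<exists>z \<in> carrier R. y = z [^]\<^bsub>R\<^esub> ring_char R))"

definition witt_case :: "nat \<Rightarrow> ('a, 'g, 'k, 'z) vdfield_scheme \<Rightarrow> bool"
  where "witt_case p K \<longleftrightarrow>
    Factorial_Ring.prime p \<and> ring_char (Fld K) = 0 \<and> ring_char (RFld K) = p \<and> perfect_field (RFld K) \<and>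
    \<one>\<^bsub>VGrp K\<^esub> \<prec>\<^bsub>VGrp K\<^esub> vmap K (add_pow (Fld K) p \<one>\<^bsub>Fld K\<^esub>) \<and>
    (\<forall>\<gamma> \<in> carrier (VGrp K). \<one>\<^bsub>VGrp K\<^esub> \<prec>\<^bsub>VGrp K\<^esub> \<gamma> \<longrightarrow>
       vmap K (add_pow (Fld K) p \<one>\<^bsub>Fld K\<^esub>) \<preceq>\<^bsub>VGrp K\<^esub> \<gamma>) \<and>
    (\<forall>y \<in> carrier (RFld K). res_aut K y = y [^]\<^bsub>RFld K\<^esub> p)"


section \<open>Extensions\<close>

text \<open>An extension of \<open>K\<close> is a structure \<open>L\<close> together with an embedding \<open>f\<close> of \<open>K\<close> into \<open>L\<close>, so
  that \<open>L\<close> may have a different type. The embedding consists of three compatible maps on field,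
  value group and residue field; the last two are determined by \<open>f\<close>.\<close>

definition vf_embedding ::
  "('a, 'g, 'k, 'z) vfield_scheme \<Rightarrow> ('b, 'h, 'l, 'y) vfield_scheme \<Rightarrow> ('a \<Rightarrow> 'b) \<Rightarrow> bool"
  where "vf_embedding K L f \<longleftrightarrow>
    f \<in> ring_hom (Fld K) (Fld L) \<and>
    (\<exists>e \<in> hom (VGrp K) (VGrp L).
       (\<forall>\<gamma> \<in> carrier (VGrp K). \<forall>\<delta> \<in> carrier (VGrp K). e \<gamma> \<preceq>\<^bsub>VGrp L\<^esub> e \<delta> \<longleftrightarrow> \<gamma> \<preceq>\<^bsub>VGrp K\<^esub> \<delta>) \<and>
       (\<forall>a \<in> nonzeros K. vmap L (f a) = e (vmap K a))) \<and>
    (\<exists>r \<in> ring_hom (RFld K) (RFld L). \<forall>a \<in> valring K. rmap L (f a) = r (rmap K a))"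

definition vdf_embedding ::
  "('a, 'g, 'k, 'z) vdfield_scheme \<Rightarrow> ('b, 'h, 'l, 'y) vdfield_scheme \<Rightarrow> ('a \<Rightarrow> 'b) \<Rightarrow> bool"
  where "vdf_embedding K L f \<longleftrightarrow>
    vf_embedding K L f \<and> (\<forall>a \<in> carrier (Fld K). f (aut K a) = aut L (f a))"


section \<open>Pseudoconvergence\<close>

text \<open>Well-indexed sequences are indexed by a nonempty well-ordered set without last element,
  that is, by a type of class \<open>{wellorder, no_top}\<close>.\<close>

definition vless :: "('a, 'g, 'k, 'z) vfield_scheme \<Rightarrow> 'a \<Rightarrow> 'a \<Rightarrow> bool"
  \<comment> \<open>\<open>v(a) < v(b)\<close> with the convention \<open>v(0) = \<infinity>\<close>\<close>
  where "vless K a b \<longleftrightarrow>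
    a \<noteq> \<zero>\<^bsub>Fld K\<^esub> \<and> (b = \<zero>\<^bsub>Fld K\<^esub> \<or> vmap K a \<prec>\<^bsub>VGrp K\<^esub> vmap K b)"

definition pc_sequence ::
  "('a, 'g, 'k, 'z) vfield_scheme \<Rightarrow> ('i::{wellorder,no_top} \<Rightarrow> 'a) \<Rightarrow> bool"
  where "pc_sequence K a \<longleftrightarrow>
    (\<forall>\<rho>. a \<rho> \<in> carrier (Fld K)) \<and>
    (\<exists>\<rho>\<^sub>0. \<forall>\<rho> \<rho>' \<rho>''. \<rho>\<^sub>0 \<le> \<rho> \<and> \<rho> < \<rho>' \<and> \<rho>' < \<rho>'' \<longrightarrow>
       vless K (a \<rho>' \<ominus>\<^bsub>Fld K\<^esub> a \<rho>) (a \<rho>'' \<ominus>\<^bsub>Fld K\<^esub> a \<rho>'))"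

definition pseudolimit ::
  "('a, 'g, 'k, 'z) vfield_scheme \<Rightarrow> ('i::{wellorder,no_top} \<Rightarrow> 'a) \<Rightarrow> 'a \<Rightarrow> bool"
  where "pseudolimit K a x \<longleftrightarrow>
    (\<exists>\<rho>\<^sub>0. \<forall>\<rho> \<rho>'. \<rho>\<^sub>0 \<le> \<rho> \<and> \<rho> < \<rho>' \<longrightarrow> vless K (x \<ominus>\<^bsub>Fld K\<^esub> a \<rho>) (x \<ominus>\<^bsub>Fld K\<^esub> a \<rho>'))"

text \<open>The extensions in the definition of equivalence have to live in some fixed type.
  The type chosen here is large enough to contain a copy of every extension generated by a
  single element, so that nothing is lost: see theorem \<open>pc_equiv_extD\<close> below.\<close>

type_synonym 'a ext_univ = "'a list \<times> 'a list"

definition pc_equiv :: "('a, 'g, 'k, 'z) vfield_scheme \<Rightarrow>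
    ('i::{wellorder,no_top} \<Rightarrow> 'a) \<Rightarrow> ('i \<Rightarrow> 'a) \<Rightarrow> bool"
  where "pc_equiv K a b \<longleftrightarrow>
    (\<forall>(E :: ('a ext_univ, 'a ext_univ, 'a ext_univ) vfield) f.
       valued_field E \<and> vf_embedding K E f \<longrightarrow>
       (\<forall>x \<in> carrier (Fld E). pseudolimit E (f \<circ> a) x \<longleftrightarrow> pseudolimit E (f \<circ> b) x))"


section \<open>\<open>\<sigma>\<close>-polynomials\<close>

text \<open>The \<open>\<sigma>\<close>-polynomial \<open>g(x, \<sigma>(x), \<dots>, \<sigma>\<^sup>n(x))\<close> is represented by \<open>g\<close>, a polynomial in variables
  indexed by \<open>nat\<close> (as the \<open>\<sigma>\<^sup>i(x)\<close> are formally independent, different \<open>g\<close> give different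
  \<open>\<sigma>\<close>-polynomials). The library represents such a polynomial as the function that maps each
  monomial (a multiset of variables) to its coefficient. In an extension given by an embedding \<open>f\<close>,
  the \<open>\<sigma>\<close>-polynomial \<open>G\<close> becomes \<open>f \<circ> G\<close>.\<close>

definition sigma_polys :: "('a, 'g, 'k, 'z) vdfield_scheme \<Rightarrow> (nat multiset \<Rightarrow> 'a) set"
  where "sigma_polys K = ring.indexed_pset (Fld K) UNIV (carrier (Fld K))"

definition nonconstant :: "('a, 'g, 'k, 'z) vdfield_scheme \<Rightarrow> (nat multiset \<Rightarrow> 'a) \<Rightarrow> bool"
  where "nonconstant K G \<longleftrightarrow> G \<notin> ring.indexed_const (Fld K) ` carrier (Fld K)"

definition sigma_eval :: "('a, 'g, 'k, 'z) vdfield_scheme \<Rightarrow> (nat multiset \<Rightarrow> 'a) \<Rightarrow> 'a \<Rightarrow> 'a"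
  where "sigma_eval K G x =
    (\<Oplus>\<^bsub>Fld K\<^esub> m \<in> {m. G m \<noteq> \<zero>\<^bsub>Fld K\<^esub>}.
       G m \<otimes>\<^bsub>Fld K\<^esub> (\<Otimes>\<^bsub>Fld K\<^esub> i \<in> set_mset m. (aut K ^^ i) x [^]\<^bsub>Fld K\<^esub> count m i))"


section \<open>The definitions are as intended\<close>

text \<open>We prove that \<open>res_aut\<close> is the map induced by \<open>\<sigma>\<close> on the residue field (lemma
  \<open>res_aut_rmap\<close>), and that equivalent pc-sequences have the same pseudolimits in all valued field
  extensions, whatever their types (theorem \<open>pc_equiv_extD\<close>). For the latter, the subextension
  generated by the pseudolimit is copied into the type \<open>ext_univ\<close>; its elements are quotients of
  values of polynomials over \<open>K\<close>, so pairs of lists suffice.\<close>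

context valued_field begin
interpretation F: field "Fld K" by (rule Fld_field)
interpretation G: ordered_abelian_group "VGrp K" by (rule VGrp_ordered)
interpretation R: field "RFld K" by (rule RFld_field)

lemma vmap_closed: "a \<in> nonzeros K \<Longrightarrow> vmap K a \<in> carrier (VGrp K)"
  using vmap_surj by blast

lemma nonzeros_one: "\<one>\<^bsub>Fld K\<^esub> \<in> nonzeros K"
  by (simp add: nonzeros_def)

lemma nonzeros_mult: "\<lbrakk>a \<in> nonzeros K; b \<in> nonzeros K\<rbrakk> \<Longrightarrow> a \<otimes>\<^bsub>Fld K\<^esub> b \<in> nonzeros K"
  by (auto simp: nonzeros_def F.integral_iff)

lemma vmap_one: "vmap K \<one>\<^bsub>Fld K\<^esub> = \<one>\<^bsub>VGrp K\<^esub>"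
  using vmap_mult[OF nonzeros_one nonzeros_one] vmap_closed[OF nonzeros_one]
  by (simp add: G.l_cancel_one')

lemma vmap_inv:
  assumes "a \<in> nonzeros K"
  shows "inv\<^bsub>Fld K\<^esub> a \<in> nonzeros K" "vmap K (inv\<^bsub>Fld K\<^esub> a) = inv\<^bsub>VGrp K\<^esub> (vmap K a)"
proof -
  have u: "a \<in> Units (Fld K)" using assms by (simp add: F.field_Units nonzeros_def)
  then have i: "inv\<^bsub>Fld K\<^esub> a \<in> Units (Fld K)" by simp
  then show n: "inv\<^bsub>Fld K\<^esub> a \<in> nonzeros K"
    by (simp only: F.field_Units nonzeros_def)
  have "vmap K (inv\<^bsub>Fld K\<^esub> a) \<otimes>\<^bsub>VGrp K\<^esub> vmap K a = \<one>\<^bsub>VGrp K\<^esub>"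
    using vmap_mult[OF n assms] vmap_one u by simp
  then show "vmap K (inv\<^bsub>Fld K\<^esub> a) = inv\<^bsub>VGrp K\<^esub> (vmap K a)"
    using G.inv_equality vmap_closed n assms by metis
qed

lemma vmap_uminus:
  assumes "a \<in> nonzeros K"
  shows "vmap K (\<ominus>\<^bsub>Fld K\<^esub> a) = vmap K a"
proof -
  let ?m = "\<ominus>\<^bsub>Fld K\<^esub> \<one>\<^bsub>Fld K\<^esub>"
  have m: "?m \<in> nonzeros K" using nonzeros_one by (simp add: nonzeros_def)
  have "vmap K ?m \<otimes>\<^bsub>VGrp K\<^esub> vmap K ?m = \<one>\<^bsub>VGrp K\<^esub>"
    using vmap_mult[OF m m] vmap_one by (simp add: F.l_minus)
  moreover have "vmap K ?m = \<one>\<^bsub>VGrp K\<^esub>" if sq: "vmap K ?m \<otimes>\<^bsub>VGrp K\<^esub> vmap K ?m = \<one>\<^bsub>VGrp K\<^esub>"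
  proof -
    let ?g = "vmap K ?m"
    have g: "?g \<in> carrier (VGrp K)" using vmap_closed[OF m] .
    have "?g \<preceq>\<^bsub>VGrp K\<^esub> \<one>\<^bsub>VGrp K\<^esub> \<or> \<one>\<^bsub>VGrp K\<^esub> \<preceq>\<^bsub>VGrp K\<^esub> ?g" using G.ole_total g by simp
    then show ?thesis
      using G.ole_mult_mono[of ?g "\<one>\<^bsub>VGrp K\<^esub>" ?g] G.ole_mult_mono[of "\<one>\<^bsub>VGrp K\<^esub>" ?g ?g] g sq
        G.ole_antisym[of ?g "\<one>\<^bsub>VGrp K\<^esub>"] by auto
  qed
  ultimately have v: "vmap K ?m = \<one>\<^bsub>VGrp K\<^esub>" by blast
  have "\<ominus>\<^bsub>Fld K\<^esub> a = ?m \<otimes>\<^bsub>Fld K\<^esub> a" using assms by (simp add: nonzeros_def F.l_minus)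
  then show ?thesis using vmap_mult[OF m assms] v vmap_closed[OF assms] by simp
qed

lemma valring_subring: "subring (valring K) (Fld K)"
proof (rule F.subringI)
  show "valring K \<subseteq> carrier (Fld K)" by (auto simp: valring_def)
  show "\<one>\<^bsub>Fld K\<^esub> \<in> valring K" by (simp add: valring_def vmap_one G.ole_refl)
  fix a assume a: "a \<in> valring K"
  then show "\<ominus>\<^bsub>Fld K\<^esub> a \<in> valring K"
    using vmap_uminus[of a] by (cases "a = \<zero>\<^bsub>Fld K\<^esub>") (auto simp: valring_def nonzeros_def)
  fix b assume b: "b \<in> valring K"
  show "a \<oplus>\<^bsub>Fld K\<^esub> b \<in> valring K"
  proof (cases "a \<in> nonzeros K \<and> b \<in> nonzeros K \<and> a \<oplus>\<^bsub>Fld K\<^esub> b \<in> nonzeros K")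
    case True
    then show ?thesis using vmap_add[of a b "\<one>\<^bsub>VGrp K\<^esub>"] a b
      by (auto simp: valring_def nonzeros_def)
  next
    case False
    then show ?thesis using a b by (auto simp: valring_def nonzeros_def)
  qed
  show "a \<otimes>\<^bsub>Fld K\<^esub> b \<in> valring K"
  proof (cases "a \<in> nonzeros K \<and> b \<in> nonzeros K")
    case True
    then have "\<one>\<^bsub>VGrp K\<^esub> \<preceq>\<^bsub>VGrp K\<^esub> vmap K a" "\<one>\<^bsub>VGrp K\<^esub> \<preceq>\<^bsub>VGrp K\<^esub> vmap K b"
      and c: "vmap K a \<in> carrier (VGrp K)" "vmap K b \<in> carrier (VGrp K)"
      using a b vmap_closed by (auto simp: valring_def nonzeros_def)
    moreover from this have "vmap K a \<preceq>\<^bsub>VGrp K\<^esub> vmap K a \<otimes>\<^bsub>VGrp K\<^esub> vmap K b"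
      using G.ole_mult_mono[of "\<one>\<^bsub>VGrp K\<^esub>" "vmap K b" "vmap K a"] by simp
    ultimately have "\<one>\<^bsub>VGrp K\<^esub> \<preceq>\<^bsub>VGrp K\<^esub> vmap K a \<otimes>\<^bsub>VGrp K\<^esub> vmap K b"
      using G.ole_trans[of "\<one>\<^bsub>VGrp K\<^esub>" "vmap K a" "vmap K a \<otimes>\<^bsub>VGrp K\<^esub> vmap K b"] by simp
    then show ?thesis using True a b vmap_mult by (auto simp: valring_def nonzeros_def)
  next
    case False
    then show ?thesis using a b by (auto simp: valring_def nonzeros_def)
  qed
qed

lemma rmap_minus:
  assumes "a \<in> valring K" "b \<in> valring K"
  shows "rmap K (a \<ominus>\<^bsub>Fld K\<^esub> b) = rmap K a \<ominus>\<^bsub>RFld K\<^esub> rmap K b"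
proof -
  interpret h: ring_hom_ring "Fld K\<lparr>carrier := valring K\<rparr>" "RFld K" "rmap K"
    using F.subring_is_ring[OF valring_subring] R.ring_axioms rmap_hom by (rule ring_hom_ringI2)
  have m: "\<ominus>\<^bsub>Fld K\<^esub> b \<in> valring K" using assms subringE(5)[OF valring_subring] by blast
  have "rmap K (\<ominus>\<^bsub>Fld K\<^esub> b) \<oplus>\<^bsub>RFld K\<^esub> rmap K b = \<zero>\<^bsub>RFld K\<^esub>"
  proof -
    have "rmap K (\<ominus>\<^bsub>Fld K\<^esub> b \<oplus>\<^bsub>Fld K\<^esub> b) = rmap K (\<ominus>\<^bsub>Fld K\<^esub> b) \<oplus>\<^bsub>RFld K\<^esub> rmap K b"
      using h.hom_add[of "\<ominus>\<^bsub>Fld K\<^esub> b" b] m assms by simp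
    moreover have "\<ominus>\<^bsub>Fld K\<^esub> b \<oplus>\<^bsub>Fld K\<^esub> b = \<zero>\<^bsub>Fld K\<^esub>"
      using assms by (simp add: valring_def F.l_neg)
    ultimately show ?thesis using h.hom_zero by simp
  qed
  then have "rmap K (\<ominus>\<^bsub>Fld K\<^esub> b) = \<ominus>\<^bsub>RFld K\<^esub> rmap K b"
    using R.minus_equality[of "rmap K (\<ominus>\<^bsub>Fld K\<^esub> b)" "rmap K b"]
      h.hom_closed[of b] h.hom_closed[of "\<ominus>\<^bsub>Fld K\<^esub> b"] m assms by simp
  then show ?thesis
    using h.hom_add[of a "\<ominus>\<^bsub>Fld K\<^esub> b"] m assms by (simp add: a_minus_def)
qed

end

lemma (in valued_difference_field) res_aut_rmap:
  assumes "a \<in> valring K"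
  shows "res_aut K (rmap K a) = rmap K (aut K a)"
  unfolding res_aut_def
proof (rule the_equality)
  interpret F: field "Fld K" by (rule Fld_field)
  interpret R: field "RFld K" by (rule RFld_field)
  interpret s: ring_hom_ring "Fld K" "Fld K" "aut K"
    using aut_iso F.ring_axioms by (auto simp: ring_iso_def intro: ring_hom_ringI2)
  have inj: "inj_on (aut K) (carrier (Fld K))"
    using aut_iso by (auto simp: ring_iso_def bij_betw_def)
  have cl: "rmap K b \<in> carrier (RFld K)" if "b \<in> valring K" for b
    using rmap_surj that by blast
  have rc: "b \<in> carrier (Fld K)" if "b \<in> valring K" for b
    using that by (simp add: valring_def)
  show "\<forall>b\<in>valring K. rmap K b = rmap K a \<longrightarrow> rmap K (aut K b) = rmap K (aut K a)"
  proof (intro ballI impI)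
    fix b assume b: "b \<in> valring K" and eq: "rmap K b = rmap K a"
    let ?d = "b \<ominus>\<^bsub>Fld K\<^esub> a"
    have d: "?d \<in> valring K"
      using b assms subringE(5,7)[OF valring_subring] unfolding a_minus_def by blast
    have "rmap K ?d = \<zero>\<^bsub>RFld K\<^esub>"
      using rmap_minus[OF b assms] eq cl[OF assms] by (simp add: R.r_right_minus_eq)
    then have dm: "?d \<in> maxideal K" using rmap_kernel d by blast
    have "aut K ?d \<in> maxideal K"
    proof (cases "?d = \<zero>\<^bsub>Fld K\<^esub>")
      case True
      then show ?thesis by (simp add: maxideal_def)
    next
      case False
      then have "?d \<in> nonzeros K" using d rc by (simp add: nonzeros_def)
      then show ?thesis using False dm aut_vmap by (auto simp: maxideal_def)
    qed
    then have "rmap K (aut K ?d) = \<zero>\<^bsub>RFld K\<^esub>" using rmap_kernel by blast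
    moreover have "aut K ?d = aut K b \<ominus>\<^bsub>Fld K\<^esub> aut K a"
      using rc[OF b] rc[OF assms] by (simp add: a_minus_def)
    moreover have "aut K b \<in> valring K" "aut K a \<in> valring K"
      using aut_valring b assms by blast+
    ultimately show "rmap K (aut K b) = rmap K (aut K a)"
      using rmap_minus cl by (simp add: R.r_right_minus_eq)
  qed
  then show "z = rmap K (aut K a)"
    if "\<forall>b\<in>valring K. rmap K b = rmap K a \<longrightarrow> rmap K (aut K b) = z" for z
    using that assms by metis
qed

definition vf_restrict :: "('a, 'g, 'k, 'z) vfield_scheme \<Rightarrow> 'a set \<Rightarrow> ('a, 'g, 'k, 'z) vfield_scheme"
  where "vf_restrict K A = K\<lparr>
    Fld := (Fld K)\<lparr>carrier := A\<rparr>,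
    VGrp := (VGrp K)\<lparr>carrier := vmap K ` (nonzeros K \<inter> A)\<rparr>,
    RFld := (RFld K)\<lparr>carrier := rmap K ` (valring K \<inter> A)\<rparr>\<rparr>"

lemma (in valued_field) valued_field_restrict:
  assumes A: "subfield A (Fld K)"
  shows "valued_field (vf_restrict K A)"
proof -
  interpret F: field "Fld K" by (rule Fld_field)
  interpret G: ordered_abelian_group "VGrp K" by (rule VGrp_ordered)
  interpret R: field "RFld K" by (rule RFld_field)
  interpret h: ring_hom_ring "Fld K\<lparr>carrier := valring K\<rparr>" "RFld K" "rmap K"
    using F.subring_is_ring[OF valring_subring] R.ring_axioms rmap_hom by (rule ring_hom_ringI2)
  note sr = subfieldE(1)[OF A]
  let ?L = "vf_restrict K A"
  have A_sub: "A \<subseteq> carrier (Fld K)" using subfieldE(3)[OF A] .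
  have nz: "nonzeros ?L = nonzeros K \<inter> A"
    using A_sub by (auto simp: nonzeros_def vf_restrict_def)
  have vr: "valring ?L = valring K \<inter> A"
    using A_sub by (auto simp: valring_def vf_restrict_def)
  have mx: "maxideal ?L = maxideal K \<inter> A"
    using A_sub by (auto simp: maxideal_def vf_restrict_def olt_def)
  have inv_in: "inv\<^bsub>Fld K\<^esub> a \<in> A" if "a \<in> nonzeros K \<inter> A" for a
    using F.subfield_m_inv(1)[OF A, of a] that by (auto simp: nonzeros_def)
  have sg: "subgroup (vmap K ` (nonzeros K \<inter> A)) (VGrp K)"
  proof (rule G.subgroupI)
    show "vmap K ` (nonzeros K \<inter> A) \<subseteq> carrier (VGrp K)" using vmap_closed by blast
    show "vmap K ` (nonzeros K \<inter> A) \<noteq> {}" using nonzeros_one subringE(3)[OF sr] by blast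
    fix x assume "x \<in> vmap K ` (nonzeros K \<inter> A)"
    then obtain a where a: "a \<in> nonzeros K \<inter> A" "x = vmap K a" by blast
    then show "inv\<^bsub>VGrp K\<^esub> x \<in> vmap K ` (nonzeros K \<inter> A)"
      using vmap_inv[of a] inv_in[of a] by (metis IntD1 IntI imageI)
    fix y assume "y \<in> vmap K ` (nonzeros K \<inter> A)"
    then obtain b where "b \<in> nonzeros K \<inter> A" "y = vmap K b" by blast
    then show "x \<otimes>\<^bsub>VGrp K\<^esub> y \<in> vmap K ` (nonzeros K \<inter> A)"
      using a vmap_mult[of a b] nonzeros_mult[of a b] subringE(6)[OF sr, of a b]
      by (metis IntD1 IntD2 IntI imageI)
  qed
  have srv: "subring (valring K \<inter> A) (Fld K)"
    using F.subring_inter[OF valring_subring sr] .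
  have sfr: "subfield (rmap K ` (valring K \<inter> A)) (RFld K)"
  proof (rule R.subfieldI')
    note c = h.hom_closed[simplified]
    show "subring (rmap K ` (valring K \<inter> A)) (RFld K)"
    proof (rule R.subringI)
      show "rmap K ` (valring K \<inter> A) \<subseteq> carrier (RFld K)" using rmap_surj by blast
      show "\<one>\<^bsub>RFld K\<^esub> \<in> rmap K ` (valring K \<inter> A)"
        using h.hom_one subringE(3)[OF srv] by (metis imageI monoid.select_convs(2) monoid.surjective monoid.update_convs(1) partial_object.update_convs(1))
    next
      fix x assume "x \<in> rmap K ` (valring K \<inter> A)"
      then obtain a where a: "a \<in> valring K \<inter> A" "x = rmap K a" by blast
      have z: "\<zero>\<^bsub>Fld K\<^esub> \<in> valring K" using subringE(2)[OF valring_subring] .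
      have "rmap K (\<ominus>\<^bsub>Fld K\<^esub> a) = \<ominus>\<^bsub>RFld K\<^esub> x"
        using rmap_minus[of "\<zero>\<^bsub>Fld K\<^esub>" a] a z c[of a] h.hom_zero A_sub
        by (auto simp: a_minus_def)
      then show "\<ominus>\<^bsub>RFld K\<^esub> x \<in> rmap K ` (valring K \<inter> A)"
        using subringE(5)[OF srv, of a] a by (metis imageI)
      fix y assume "y \<in> rmap K ` (valring K \<inter> A)"
      then obtain b where b: "b \<in> valring K \<inter> A" "y = rmap K b" by blast
      show "x \<otimes>\<^bsub>RFld K\<^esub> y \<in> rmap K ` (valring K \<inter> A)"
        using a b h.hom_mult[of a b] subringE(6)[OF srv, of a b]
        by (auto intro!: image_eqI[of _ _ "a \<otimes>\<^bsub>Fld K\<^esub> b"])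
      show "x \<oplus>\<^bsub>RFld K\<^esub> y \<in> rmap K ` (valring K \<inter> A)"
        using a b h.hom_add[of a b] subringE(7)[OF srv, of a b]
        by (auto intro!: image_eqI[of _ _ "a \<oplus>\<^bsub>Fld K\<^esub> b"])
    qed
    fix k assume "k \<in> rmap K ` (valring K \<inter> A) - {\<zero>\<^bsub>RFld K\<^esub>}"
    then obtain a where a: "a \<in> valring K" "a \<in> A" "k = rmap K a" and k0: "k \<noteq> \<zero>\<^bsub>RFld K\<^esub>" by blast
    then have "a \<notin> maxideal K" using rmap_kernel by blast
    with a have an: "a \<in> nonzeros K" and v: "vmap K a = \<one>\<^bsub>VGrp K\<^esub>"
      by (auto simp: maxideal_def valring_def nonzeros_def olt_def)
    then have iv: "inv\<^bsub>Fld K\<^esub> a \<in> valring K \<inter> A"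
      using vmap_inv[OF an] inv_in[of a] a G.ole_refl by (auto simp: valring_def nonzeros_def)
    have "inv\<^bsub>Fld K\<^esub> a \<otimes>\<^bsub>Fld K\<^esub> a = \<one>\<^bsub>Fld K\<^esub>"
      using an by (auto simp: nonzeros_def F.field_Units)
    then have "rmap K (inv\<^bsub>Fld K\<^esub> a) \<otimes>\<^bsub>RFld K\<^esub> k = \<one>\<^bsub>RFld K\<^esub>"
      using h.hom_mult[of "inv\<^bsub>Fld K\<^esub> a" a] h.hom_one iv a by simp
    then have "inv\<^bsub>RFld K\<^esub> k = rmap K (inv\<^bsub>Fld K\<^esub> a)"
      using R.inv_char[of k "rmap K (inv\<^bsub>Fld K\<^esub> a)"] R.comm_inv_char iv a c
      by (metis IntD1 R.m_comm)
    then show "inv\<^bsub>RFld K\<^esub> k \<in> rmap K ` (valring K \<inter> A)" using iv by simp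
  qed
  have sel [simp]: "Fld ?L = (Fld K)\<lparr>carrier := A\<rparr>"
    "VGrp ?L = (VGrp K)\<lparr>carrier := vmap K ` (nonzeros K \<inter> A)\<rparr>"
    "RFld ?L = (RFld K)\<lparr>carrier := rmap K ` (valring K \<inter> A)\<rparr>"
    "vmap ?L = vmap K" "rmap ?L = rmap K"
    by (simp_all add: vf_restrict_def)
  show ?thesis
  proof (rule valued_field.intro)
    show "field (Fld ?L)" using F.subfield_iff(2)[OF A] by simp
    show "field (RFld ?L)" using R.subfield_iff(2)[OF sfr] by simp
    interpret S: group "VGrp ?L" using G.subgroup_imp_group[OF sg] by simp
    show "ordered_abelian_group (VGrp ?L)"
    proof (intro ordered_abelian_group.intro ordered_abelian_group_axioms.intro)
      have "comm_monoid (VGrp ?L)"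
        by unfold_locales (use vmap_closed in \<open>auto intro: G.m_comm\<close>)
      then show "comm_group (VGrp ?L)" by (intro comm_group.intro S.group_axioms)
    next
      have c: "x \<in> carrier (VGrp K)" if "x \<in> carrier (VGrp ?L)" for x
        using that vmap_closed by auto
      fix x assume x: "x \<in> carrier (VGrp ?L)"
      show "x \<preceq>\<^bsub>VGrp ?L\<^esub> x" using G.ole_refl[OF c[OF x]] by simp
      fix y assume y: "y \<in> carrier (VGrp ?L)"
      show "x \<preceq>\<^bsub>VGrp ?L\<^esub> y \<or> y \<preceq>\<^bsub>VGrp ?L\<^esub> x" using G.ole_total[OF c[OF x] c[OF y]] by simp
      show "x = y" if "x \<preceq>\<^bsub>VGrp ?L\<^esub> y" "y \<preceq>\<^bsub>VGrp ?L\<^esub> x"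
        using G.ole_antisym[OF c[OF x] c[OF y]] that by simp
      fix z assume z: "z \<in> carrier (VGrp ?L)"
      show "x \<preceq>\<^bsub>VGrp ?L\<^esub> z" if "x \<preceq>\<^bsub>VGrp ?L\<^esub> y" "y \<preceq>\<^bsub>VGrp ?L\<^esub> z"
        using G.ole_trans[OF c[OF x] c[OF y] c[OF z]] that by simp
      show "z \<otimes>\<^bsub>VGrp ?L\<^esub> x \<preceq>\<^bsub>VGrp ?L\<^esub> z \<otimes>\<^bsub>VGrp ?L\<^esub> y" if "x \<preceq>\<^bsub>VGrp ?L\<^esub> y"
        using G.ole_mult_mono[OF c[OF x] c[OF y] c[OF z]] that by simp
    qed
    show "vmap ?L ` nonzeros ?L = carrier (VGrp ?L)" by (simp add: nz)
    show "rmap ?L ` valring ?L = carrier (RFld ?L)" by (simp add: vr)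
    show "{a \<in> valring ?L. rmap ?L a = \<zero>\<^bsub>RFld ?L\<^esub>} = maxideal ?L"
      using rmap_kernel by (auto simp: vr mx)
    show "rmap ?L \<in> ring_hom (Fld ?L\<lparr>carrier := valring ?L\<rparr>) (RFld ?L)"
      using rmap_hom by (auto simp: ring_hom_def vr)
  next
    fix a b assume "a \<in> nonzeros ?L" "b \<in> nonzeros ?L"
    then show "vmap ?L (a \<otimes>\<^bsub>Fld ?L\<^esub> b) = vmap ?L a \<otimes>\<^bsub>VGrp ?L\<^esub> vmap ?L b"
      using vmap_mult[of a b] by (simp add: nz)
  next
    fix a b \<gamma> assume *: "a \<in> nonzeros ?L" "b \<in> nonzeros ?L" "a \<oplus>\<^bsub>Fld ?L\<^esub> b \<in> nonzeros ?L"
      "\<gamma> \<in> carrier (VGrp ?L)" "\<gamma> \<preceq>\<^bsub>VGrp ?L\<^esub> vmap ?L a" "\<gamma> \<preceq>\<^bsub>VGrp ?L\<^esub> vmap ?L b"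
    then have "\<gamma> \<in> carrier (VGrp K)" using vmap_closed by auto
    then show "\<gamma> \<preceq>\<^bsub>VGrp ?L\<^esub> vmap ?L (a \<oplus>\<^bsub>Fld ?L\<^esub> b)"
      using * vmap_add[of a b \<gamma>] by (simp add: nz)
  qed
qed

definition vf_image :: "('a \<Rightarrow> 'b) \<Rightarrow> ('g \<Rightarrow> 'h) \<Rightarrow> ('k \<Rightarrow> 'l) \<Rightarrow> ('a, 'g, 'k, 'z) vfield_scheme \<Rightarrow>
    ('b, 'h, 'l) vfield"
  where "vf_image f g h K = \<lparr>
    Fld = image_ring f (Fld K),
    VGrp = monoid.extend (image_group g (VGrp K))
      (ogroup.fields (\<lambda>x y. inv_into (carrier (VGrp K)) g x \<preceq>\<^bsub>VGrp K\<^esub> inv_into (carrier (VGrp K)) g y)),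
    RFld = image_ring h (RFld K),
    vmap = (\<lambda>x. g (vmap K (inv_into (carrier (Fld K)) f x))),
    rmap = (\<lambda>x. h (rmap K (inv_into (carrier (Fld K)) f x)))\<rparr>"

lemma (in valued_field) valued_field_image:
  assumes f: "inj_on f (carrier (Fld K))" and g: "inj_on g (carrier (VGrp K))"
    and h: "inj_on h (carrier (RFld K))"
  shows "valued_field (vf_image f g h K)"
    and "vf_embedding K (vf_image f g h K) f"
proof -
  interpret F: field "Fld K" by (rule Fld_field)
  interpret G: ordered_abelian_group "VGrp K" by (rule VGrp_ordered)
  interpret R: field "RFld K" by (rule RFld_field)
  interpret hh: ring_hom_ring "Fld K\<lparr>carrier := valring K\<rparr>" "RFld K" "rmap K"
    using F.subring_is_ring[OF valring_subring] R.ring_axioms rmap_hom by (rule ring_hom_ringI2)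
  let ?L = "vf_image f g h K"
  have inv_f [simp]: "inv_into (carrier (Fld K)) f (f a) = a" if "a \<in> carrier (Fld K)" for a
    using inv_into_f_f[OF f that] .
  have inv_g [simp]: "inv_into (carrier (VGrp K)) g (g a) = a" if "a \<in> carrier (VGrp K)" for a
    using inv_into_f_f[OF g that] .
  have inv_h [simp]: "inv_into (carrier (RFld K)) h (h a) = a" if "a \<in> carrier (RFld K)" for a
    using inv_into_f_f[OF h that] .
  have f_eq [simp]: "f a = f b \<longleftrightarrow> a = b" if "a \<in> carrier (Fld K)" "b \<in> carrier (Fld K)" for a b
    using f that by (auto dest: inj_onD)
  have g_eq [simp]: "g a = g b \<longleftrightarrow> a = b" if "a \<in> carrier (VGrp K)" "b \<in> carrier (VGrp K)" for a b
    using g that by (auto dest: inj_onD)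
  have h_eq [simp]: "h a = h b \<longleftrightarrow> a = b" if "a \<in> carrier (RFld K)" "b \<in> carrier (RFld K)" for a b
    using h that by (auto dest: inj_onD)
  have [simp]: "Fld ?L = image_ring f (Fld K)" "RFld ?L = image_ring h (RFld K)"
    "vmap ?L x = g (vmap K (inv_into (carrier (Fld K)) f x))"
    "rmap ?L x = h (rmap K (inv_into (carrier (Fld K)) f x))" for x
    by (simp_all add: vf_image_def)
  have G' [simp]: "carrier (VGrp ?L) = g ` carrier (VGrp K)" "\<one>\<^bsub>VGrp ?L\<^esub> = g \<one>\<^bsub>VGrp K\<^esub>"
    "\<alpha> \<in> carrier (VGrp K) \<Longrightarrow> \<beta> \<in> carrier (VGrp K) \<Longrightarrow> g \<alpha> \<otimes>\<^bsub>VGrp ?L\<^esub> g \<beta> = g (\<alpha> \<otimes>\<^bsub>VGrp K\<^esub> \<beta>)"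
    "\<alpha> \<in> carrier (VGrp K) \<Longrightarrow> \<beta> \<in> carrier (VGrp K) \<Longrightarrow> g \<alpha> \<preceq>\<^bsub>VGrp ?L\<^esub> g \<beta> \<longleftrightarrow> \<alpha> \<preceq>\<^bsub>VGrp K\<^esub> \<beta>" for \<alpha> \<beta>
    by (simp_all add: vf_image_def image_group_def ogroup.defs monoid.defs)
  have F' [simp]: "carrier (image_ring f (Fld K)) = f ` carrier (Fld K)"
    "\<one>\<^bsub>image_ring f (Fld K)\<^esub> = f \<one>\<^bsub>Fld K\<^esub>" "\<zero>\<^bsub>image_ring f (Fld K)\<^esub> = f \<zero>\<^bsub>Fld K\<^esub>"
    "a \<in> carrier (Fld K) \<Longrightarrow> b \<in> carrier (Fld K) \<Longrightarrow> f a \<otimes>\<^bsub>image_ring f (Fld K)\<^esub> f b = f (a \<otimes>\<^bsub>Fld K\<^esub> b)"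
    "a \<in> carrier (Fld K) \<Longrightarrow> b \<in> carrier (Fld K) \<Longrightarrow> f a \<oplus>\<^bsub>image_ring f (Fld K)\<^esub> f b = f (a \<oplus>\<^bsub>Fld K\<^esub> b)" for a b
    by (simp_all add: image_ring_def image_group_def monoid.defs)
  have R' [simp]: "carrier (image_ring h (RFld K)) = h ` carrier (RFld K)"
    "\<one>\<^bsub>image_ring h (RFld K)\<^esub> = h \<one>\<^bsub>RFld K\<^esub>" "\<zero>\<^bsub>image_ring h (RFld K)\<^esub> = h \<zero>\<^bsub>RFld K\<^esub>"
    "a \<in> carrier (RFld K) \<Longrightarrow> b \<in> carrier (RFld K) \<Longrightarrow> h a \<otimes>\<^bsub>image_ring h (RFld K)\<^esub> h b = h (a \<otimes>\<^bsub>RFld K\<^esub> b)"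
    "a \<in> carrier (RFld K) \<Longrightarrow> b \<in> carrier (RFld K) \<Longrightarrow> h a \<oplus>\<^bsub>image_ring h (RFld K)\<^esub> h b = h (a \<oplus>\<^bsub>RFld K\<^esub> b)" for a b
    by (simp_all add: image_ring_def image_group_def monoid.defs)
  have nz: "nonzeros ?L = f ` nonzeros K" by (auto simp: nonzeros_def)
  have vr: "valring ?L = f ` valring K"
  proof -
    have "f a \<in> valring ?L \<longleftrightarrow> a \<in> valring K" if "a \<in> carrier (Fld K)" for a
      using that vmap_closed[of a]
      by (cases "a = \<zero>\<^bsub>Fld K\<^esub>") (auto simp: valring_def nonzeros_def)
    moreover have "valring ?L \<subseteq> f ` carrier (Fld K)" "valring K \<subseteq> carrier (Fld K)" by (auto simp: valring_def)
    ultimately show ?thesis by blast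
  qed
  have mx: "maxideal ?L = f ` maxideal K"
  proof -
    have "f a \<in> maxideal ?L \<longleftrightarrow> a \<in> maxideal K" if "a \<in> carrier (Fld K)" for a
      using that vmap_closed[of a]
      by (cases "a = \<zero>\<^bsub>Fld K\<^esub>") (auto simp: maxideal_def nonzeros_def olt_def)
    moreover have "maxideal ?L \<subseteq> f ` carrier (Fld K)" "maxideal K \<subseteq> carrier (Fld K)" by (auto simp: maxideal_def)
    ultimately show ?thesis by blast
  qed
  have nc [simp]: "a \<in> carrier (Fld K)" if "a \<in> nonzeros K" for a using that by (simp add: nonzeros_def)
  have vc [simp]: "a \<in> carrier (Fld K)" if "a \<in> valring K" for a using that by (simp add: valring_def)
  have rc [simp]: "rmap K a \<in> carrier (RFld K)" if "a \<in> valring K" for a using that rmap_surj by blast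
  show "valued_field ?L"
  proof (rule valued_field.intro)
    show "field (Fld ?L)" using F.inj_imp_image_ring_is_field[OF f] by simp
    show "field (RFld ?L)" using R.inj_imp_image_ring_is_field[OF h] by simp
    show "ordered_abelian_group (VGrp ?L)"
    proof (intro ordered_abelian_group.intro ordered_abelian_group_axioms.intro)
      show "comm_group (VGrp ?L)"
      proof (rule comm_groupI)
        fix x assume "x \<in> carrier (VGrp ?L)"
        then obtain \<alpha> where "\<alpha> \<in> carrier (VGrp K)" "x = g \<alpha>" by auto
        then show "\<exists>y\<in>carrier (VGrp ?L). y \<otimes>\<^bsub>VGrp ?L\<^esub> x = \<one>\<^bsub>VGrp ?L\<^esub>"
          by (intro bexI[of _ "g (inv\<^bsub>VGrp K\<^esub> \<alpha>)"]) auto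
      qed (auto simp: G.m_ac)
    next
      fix x assume "x \<in> carrier (VGrp ?L)"
      then obtain \<alpha> where x: "x = g \<alpha>" and \<alpha>: "\<alpha> \<in> carrier (VGrp K)" by auto
      show "x \<preceq>\<^bsub>VGrp ?L\<^esub> x" using G.ole_refl[OF \<alpha>] by (simp add: x \<alpha>)
      fix y assume "y \<in> carrier (VGrp ?L)"
      then obtain \<beta> where y: "y = g \<beta>" and \<beta>: "\<beta> \<in> carrier (VGrp K)" by auto
      show "x \<preceq>\<^bsub>VGrp ?L\<^esub> y \<or> y \<preceq>\<^bsub>VGrp ?L\<^esub> x"
        using G.ole_total[OF \<alpha> \<beta>] by (simp add: x y \<alpha> \<beta>)
      show "x = y" if "x \<preceq>\<^bsub>VGrp ?L\<^esub> y" "y \<preceq>\<^bsub>VGrp ?L\<^esub> x"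
        using G.ole_antisym[OF \<alpha> \<beta>] that by (simp add: x y \<alpha> \<beta>)
      fix z assume "z \<in> carrier (VGrp ?L)"
      then obtain \<gamma> where z: "z = g \<gamma>" and \<gamma>: "\<gamma> \<in> carrier (VGrp K)" by auto
      show "x \<preceq>\<^bsub>VGrp ?L\<^esub> z" if "x \<preceq>\<^bsub>VGrp ?L\<^esub> y" "y \<preceq>\<^bsub>VGrp ?L\<^esub> z"
        using G.ole_trans[OF \<alpha> \<beta> \<gamma>] that by (simp add: x y z \<alpha> \<beta> \<gamma>)
      show "z \<otimes>\<^bsub>VGrp ?L\<^esub> x \<preceq>\<^bsub>VGrp ?L\<^esub> z \<otimes>\<^bsub>VGrp ?L\<^esub> y" if "x \<preceq>\<^bsub>VGrp ?L\<^esub> y"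
        using G.ole_mult_mono[OF \<alpha> \<beta> \<gamma>] that by (simp add: x y z \<alpha> \<beta> \<gamma>)
    qed
    show "vmap ?L ` nonzeros ?L = carrier (VGrp ?L)"
      by (simp add: nz image_image flip: vmap_surj)
    show "rmap ?L ` valring ?L = carrier (RFld ?L)"
      by (simp add: vr image_image flip: rmap_surj)
    show "{a \<in> valring ?L. rmap ?L a = \<zero>\<^bsub>RFld ?L\<^esub>} = maxideal ?L"
      unfolding vr mx rmap_kernel[symmetric] by auto
    show "rmap ?L \<in> ring_hom (Fld ?L\<lparr>carrier := valring ?L\<rparr>) (RFld ?L)"
      using hh.hom_one hh.hom_mult hh.hom_add hh.hom_closed subringE(6,7)[OF valring_subring]
      by (auto simp: ring_hom_def vr)
  next
    fix a b assume "a \<in> nonzeros ?L" "b \<in> nonzeros ?L"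
    then show "vmap ?L (a \<otimes>\<^bsub>Fld ?L\<^esub> b) = vmap ?L a \<otimes>\<^bsub>VGrp ?L\<^esub> vmap ?L b"
      using vmap_mult vmap_closed by (auto simp: nz)
  next
    fix a b \<gamma> assume "a \<in> nonzeros ?L" "b \<in> nonzeros ?L" "a \<oplus>\<^bsub>Fld ?L\<^esub> b \<in> nonzeros ?L"
      and \<gamma>: "\<gamma> \<in> carrier (VGrp ?L)" "\<gamma> \<preceq>\<^bsub>VGrp ?L\<^esub> vmap ?L a" "\<gamma> \<preceq>\<^bsub>VGrp ?L\<^esub> vmap ?L b"
    then obtain a' b' where ab: "a = f a'" "b = f b'" "a' \<in> nonzeros K" "b' \<in> nonzeros K"
        and "a' \<oplus>\<^bsub>Fld K\<^esub> b' \<in> nonzeros K"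
      by (auto simp: nz)
    then show "\<gamma> \<preceq>\<^bsub>VGrp ?L\<^esub> vmap ?L (a \<oplus>\<^bsub>Fld ?L\<^esub> b)"
      using \<gamma> vmap_add[of a' b'] vmap_closed by auto
  qed
  show "vf_embedding K ?L f"
    unfolding vf_embedding_def
  proof (intro conjI)
    show "f \<in> ring_hom (Fld K) (Fld ?L)" by (auto simp: ring_hom_def)
    show "\<exists>e\<in>hom (VGrp K) (VGrp ?L).
       (\<forall>\<gamma>\<in>carrier (VGrp K). \<forall>\<delta>\<in>carrier (VGrp K). e \<gamma> \<preceq>\<^bsub>VGrp ?L\<^esub> e \<delta> \<longleftrightarrow> \<gamma> \<preceq>\<^bsub>VGrp K\<^esub> \<delta>) \<and>
       (\<forall>a\<in>nonzeros K. vmap ?L (f a) = e (vmap K a))"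
      by (intro bexI[of _ g]) (auto simp: hom_def)
    show "\<exists>r\<in>ring_hom (RFld K) (RFld ?L). \<forall>a\<in>valring K. rmap ?L (f a) = r (rmap K a)"
      by (intro bexI[of _ h]) (auto simp: ring_hom_def)
  qed
qed

locale vf_extension = K: valued_field K + L: valued_field L
  for K :: "('a, 'g, 'k, 'z) vfield_scheme" and L :: "('b, 'h, 'l, 'y) vfield_scheme" +
  fixes f :: "'a \<Rightarrow> 'b"
  assumes embedding: "vf_embedding K L f"
begin

interpretation KF: field "Fld K" by (rule K.Fld_field)
interpretation LF: field "Fld L" by (rule L.Fld_field)
interpretation KG: ordered_abelian_group "VGrp K" by (rule K.VGrp_ordered)
interpretation LG: ordered_abelian_group "VGrp L" by (rule L.VGrp_ordered)
interpretation f: ring_hom_cring "Fld K" "Fld L" f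
  using embedding KF.cring_axioms LF.cring_axioms
  by (auto simp: vf_embedding_def ring_hom_cring_def ring_hom_cring_axioms_def)

lemma emb_hom: "f \<in> ring_hom (Fld K) (Fld L)"
  using f.homh .

lemma emb_closed: "a \<in> carrier (Fld K) \<Longrightarrow> f a \<in> carrier (Fld L)"
  by simp

lemma emb_minus:
  "\<lbrakk>a \<in> carrier (Fld K); b \<in> carrier (Fld K)\<rbrakk> \<Longrightarrow> f (a \<ominus>\<^bsub>Fld K\<^esub> b) = f a \<ominus>\<^bsub>Fld L\<^esub> f b"
  by (simp add: a_minus_def)

lemma emb_zero_iff: "a \<in> carrier (Fld K) \<Longrightarrow> f a = \<zero>\<^bsub>Fld L\<^esub> \<longleftrightarrow> a = \<zero>\<^bsub>Fld K\<^esub>"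
proof
  assume a: "a \<in> carrier (Fld K)" "f a = \<zero>\<^bsub>Fld L\<^esub>"
  show "a = \<zero>\<^bsub>Fld K\<^esub>"
  proof (rule ccontr)
    assume "a \<noteq> \<zero>\<^bsub>Fld K\<^esub>"
    then have u: "a \<in> Units (Fld K)" using a by (simp add: KF.field_Units)
    then have "f (a \<otimes>\<^bsub>Fld K\<^esub> inv\<^bsub>Fld K\<^esub> a) = \<one>\<^bsub>Fld L\<^esub>" by simp
    moreover have "f (a \<otimes>\<^bsub>Fld K\<^esub> inv\<^bsub>Fld K\<^esub> a) = \<zero>\<^bsub>Fld L\<^esub>"
      using a u by (subst f.hom_mult) auto
    ultimately show False by simp
  qed
qed simp

lemma emb_nonzeros: "a \<in> nonzeros K \<Longrightarrow> f a \<in> nonzeros L"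
  by (simp add: nonzeros_def emb_zero_iff)

lemma emb_vgrp:
  obtains e where "e \<in> hom (VGrp K) (VGrp L)"
    "\<And>\<gamma> \<delta>. \<lbrakk>\<gamma> \<in> carrier (VGrp K); \<delta> \<in> carrier (VGrp K)\<rbrakk> \<Longrightarrow> e \<gamma> \<preceq>\<^bsub>VGrp L\<^esub> e \<delta> \<longleftrightarrow> \<gamma> \<preceq>\<^bsub>VGrp K\<^esub> \<delta>"
    "\<And>a. a \<in> nonzeros K \<Longrightarrow> vmap L (f a) = e (vmap K a)"
    "e \<one>\<^bsub>VGrp K\<^esub> = \<one>\<^bsub>VGrp L\<^esub>"
proof -
  obtain e where e: "e \<in> hom (VGrp K) (VGrp L)"
    "\<And>\<gamma> \<delta>. \<lbrakk>\<gamma> \<in> carrier (VGrp K); \<delta> \<in> carrier (VGrp K)\<rbrakk> \<Longrightarrow> e \<gamma> \<preceq>\<^bsub>VGrp L\<^esub> e \<delta> \<longleftrightarrow> \<gamma> \<preceq>\<^bsub>VGrp K\<^esub> \<delta>"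
    "\<And>a. a \<in> nonzeros K \<Longrightarrow> vmap L (f a) = e (vmap K a)"
    using embedding unfolding vf_embedding_def by metis
  have "e \<one>\<^bsub>VGrp K\<^esub> = \<one>\<^bsub>VGrp L\<^esub>"
    using hom_one[OF e(1) KG.group_axioms LG.group_axioms] .
  with e that show thesis by blast
qed

lemma emb_ole_iff:
  assumes "a \<in> nonzeros K" "b \<in> nonzeros K"
  shows "vmap L (f a) \<preceq>\<^bsub>VGrp L\<^esub> vmap L (f b) \<longleftrightarrow> vmap K a \<preceq>\<^bsub>VGrp K\<^esub> vmap K b"
  using emb_vgrp assms K.vmap_closed by metis

lemma emb_valring: 
  assumes a: "a \<in> valring K"
  shows "f a \<in> valring L"
proof (cases "a \<in> nonzeros K")
  case True
  then have "vmap K \<one>\<^bsub>Fld K\<^esub> \<preceq>\<^bsub>VGrp K\<^esub> vmap K a" using a by (auto simp: valring_def nonzeros_def K.vmap_one)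
  then have "vmap L (f \<one>\<^bsub>Fld K\<^esub>) \<preceq>\<^bsub>VGrp L\<^esub> vmap L (f a)"
    using emb_ole_iff[OF K.nonzeros_one True] by simp
  then show ?thesis using True by (simp add: valring_def nonzeros_def L.vmap_one)
next
  case False
  with a have "a = \<zero>\<^bsub>Fld K\<^esub>" by (auto simp: valring_def nonzeros_def)
  then show ?thesis by (simp add: valring_def)
qed

lemma emb_vless_iff:
  assumes "a \<in> carrier (Fld K)" "b \<in> carrier (Fld K)"
  shows "vless L (f a) (f b) \<longleftrightarrow> vless K a b"
proof (cases "a \<in> nonzeros K \<and> b \<in> nonzeros K")
  case True
  then have "vmap L (f a) \<prec>\<^bsub>VGrp L\<^esub> vmap L (f b) \<longleftrightarrow> vmap K a \<prec>\<^bsub>VGrp K\<^esub> vmap K b"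
    using emb_ole_iff[of a b] emb_ole_iff[of b a] KG.ole_antisym LG.ole_antisym KG.ole_refl LG.ole_refl
      K.vmap_closed L.vmap_closed emb_nonzeros
    unfolding olt_def by metis
  then show ?thesis using assms by (simp add: vless_def emb_zero_iff)
next
  case False
  then show ?thesis using assms by (auto simp: vless_def emb_zero_iff nonzeros_def)
qed

lemma emb_pseudolimit_iff:
  assumes "\<And>\<rho>. a \<rho> \<in> carrier (Fld K)" "x \<in> carrier (Fld K)"
  shows "pseudolimit L (f \<circ> a) (f x) \<longleftrightarrow> pseudolimit K a x"
proof -
  have "vless L (f x \<ominus>\<^bsub>Fld L\<^esub> f (a \<rho>)) (f x \<ominus>\<^bsub>Fld L\<^esub> f (a \<rho>')) \<longleftrightarrow>
      vless K (x \<ominus>\<^bsub>Fld K\<^esub> a \<rho>) (x \<ominus>\<^bsub>Fld K\<^esub> a \<rho>')" for \<rho> \<rho>'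
    using emb_vless_iff[of "x \<ominus>\<^bsub>Fld K\<^esub> a \<rho>" "x \<ominus>\<^bsub>Fld K\<^esub> a \<rho>'"] assms by (simp add: emb_minus)
  then show ?thesis by (simp add: pseudolimit_def)
qed

lemma vf_embedding_comp:
  assumes "vf_embedding L M f'"
  shows "vf_embedding K M (f' \<circ> f)"
proof -
  obtain e where e: "e \<in> hom (VGrp K) (VGrp L)"
      "\<And>\<gamma> \<delta>. \<gamma> \<in> carrier (VGrp K) \<Longrightarrow> \<delta> \<in> carrier (VGrp K) \<Longrightarrow> e \<gamma> \<preceq>\<^bsub>VGrp L\<^esub> e \<delta> \<longleftrightarrow> \<gamma> \<preceq>\<^bsub>VGrp K\<^esub> \<delta>"
      "\<And>a. a \<in> nonzeros K \<Longrightarrow> vmap L (f a) = e (vmap K a)"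
    using emb_vgrp by metis
  obtain r where r: "r \<in> ring_hom (RFld K) (RFld L)" "\<And>a. a \<in> valring K \<Longrightarrow> rmap L (f a) = r (rmap K a)"
    using embedding unfolding vf_embedding_def by metis
  obtain e' where e': "e' \<in> hom (VGrp L) (VGrp M)"
      "\<And>\<gamma> \<delta>. \<gamma> \<in> carrier (VGrp L) \<Longrightarrow> \<delta> \<in> carrier (VGrp L) \<Longrightarrow> e' \<gamma> \<preceq>\<^bsub>VGrp M\<^esub> e' \<delta> \<longleftrightarrow> \<gamma> \<preceq>\<^bsub>VGrp L\<^esub> \<delta>"
      "\<And>a. a \<in> nonzeros L \<Longrightarrow> vmap M (f' a) = e' (vmap L a)"
    using assms unfolding vf_embedding_def by metis
  obtain r' where r': "r' \<in> ring_hom (RFld L) (RFld M)" "\<And>a. a \<in> valring L \<Longrightarrow> rmap M (f' a) = r' (rmap L a)"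
    using assms unfolding vf_embedding_def by metis
  show ?thesis
    unfolding vf_embedding_def
  proof (intro conjI bexI[of _ "e' \<circ> e"] bexI[of _ "r' \<circ> r"] ballI)
    show "f' \<circ> f \<in> ring_hom (Fld K) (Fld M)"
      using ring_hom_trans[OF emb_hom] assms unfolding vf_embedding_def by blast
    show "e' \<circ> e \<in> hom (VGrp K) (VGrp M)" using hom_compose[OF e(1) e'(1)] .
    show "r' \<circ> r \<in> ring_hom (RFld K) (RFld M)" using ring_hom_trans[OF r(1) r'(1)] .
  next
    fix \<gamma> \<delta> assume "\<gamma> \<in> carrier (VGrp K)" "\<delta> \<in> carrier (VGrp K)"
    then show "(e' \<circ> e) \<gamma> \<preceq>\<^bsub>VGrp M\<^esub> (e' \<circ> e) \<delta> \<longleftrightarrow> \<gamma> \<preceq>\<^bsub>VGrp K\<^esub> \<delta>"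
      using e e' hom_in_carrier[OF e(1)] by simp
  next
    fix a assume "a \<in> nonzeros K"
    then show "vmap M ((f' \<circ> f) a) = (e' \<circ> e) (vmap K a)"
      using e(3) e'(3) emb_nonzeros by simp
  next
    fix a assume "a \<in> valring K"
    then show "rmap M ((f' \<circ> f) a) = (r' \<circ> r) (rmap K a)"
      using r(2) r'(2) emb_valring by simp
  qed
qed

lemma vf_embedding_restrict:
  assumes A: "subfield A (Fld L)" and fA: "f ` carrier (Fld K) \<subseteq> A"
  shows "vf_embedding K (vf_restrict L A) f"
proof -
  obtain e where e: "e \<in> hom (VGrp K) (VGrp L)"
      "\<And>\<gamma> \<delta>. \<gamma> \<in> carrier (VGrp K) \<Longrightarrow> \<delta> \<in> carrier (VGrp K) \<Longrightarrow> e \<gamma> \<preceq>\<^bsub>VGrp L\<^esub> e \<delta> \<longleftrightarrow> \<gamma> \<preceq>\<^bsub>VGrp K\<^esub> \<delta>"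
      "\<And>a. a \<in> nonzeros K \<Longrightarrow> vmap L (f a) = e (vmap K a)"
    using emb_vgrp by metis
  obtain r where r: "r \<in> ring_hom (RFld K) (RFld L)" "\<And>a. a \<in> valring K \<Longrightarrow> rmap L (f a) = r (rmap K a)"
    using embedding unfolding vf_embedding_def by metis
  have ec: "e \<gamma> \<in> vmap L ` (nonzeros L \<inter> A)" if g: "\<gamma> \<in> carrier (VGrp K)" for \<gamma>
  proof -
    obtain a where "a \<in> nonzeros K" "\<gamma> = vmap K a" using g K.vmap_surj by blast
    then show ?thesis using e(3)[of a] emb_nonzeros[of a] fA by (auto simp: nonzeros_def intro!: image_eqI[of _ _ "f a"])
  qed
  have rc: "r y \<in> rmap L ` (valring L \<inter> A)" if y: "y \<in> carrier (RFld K)" for y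
  proof -
    obtain a where "a \<in> valring K" "y = rmap K a" using y K.rmap_surj by blast
    then show ?thesis using r(2)[of a] emb_valring[of a] fA by (auto simp: valring_def intro!: image_eqI[of _ _ "f a"])
  qed
  show ?thesis
    unfolding vf_embedding_def
  proof (intro conjI bexI[of _ e] bexI[of _ r] ballI)
    show "f \<in> ring_hom (Fld K) (Fld (vf_restrict L A))"
      using emb_hom fA by (auto simp: ring_hom_def vf_restrict_def)
    show "e \<in> hom (VGrp K) (VGrp (vf_restrict L A))"
      using e(1) ec by (auto simp: hom_def vf_restrict_def)
    show "r \<in> ring_hom (RFld K) (RFld (vf_restrict L A))"
      using r(1) rc by (auto simp: ring_hom_def vf_restrict_def)
  qed (use e r in \<open>simp_all add: vf_restrict_def\<close>)
qed

end

lemma (in valued_field) vf_extension_restrict: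
  assumes A: "subfield A (Fld K)"
  shows "vf_extension (vf_restrict K A) K id"
proof -
  interpret A: valued_field "vf_restrict K A" using valued_field_restrict[OF A] .
  have A_sub: "A \<subseteq> carrier (Fld K)" using subfieldE(3)[OF A] .
  have "vf_embedding (vf_restrict K A) K id"
    unfolding vf_embedding_def
  proof (intro conjI bexI[of _ id] ballI)
    show "id \<in> ring_hom (Fld (vf_restrict K A)) (Fld K)"
      using A_sub by (auto simp: ring_hom_def vf_restrict_def)
    show "id \<in> hom (VGrp (vf_restrict K A)) (VGrp K)"
      using vmap_closed by (auto simp: hom_def vf_restrict_def)
    show "id \<in> ring_hom (RFld (vf_restrict K A)) (RFld K)"
      using rmap_surj by (auto simp: ring_hom_def vf_restrict_def)
  qed (simp_all add: vf_restrict_def)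
  then show ?thesis
    by (intro vf_extension.intro vf_extension_axioms.intro A.valued_field_axioms valued_field_axioms)
qed

lemma (in field) fractions_subfield:
  assumes S: "subring S R"
  shows "subfield {u \<otimes> inv w | u w. u \<in> S \<and> w \<in> S \<and> w \<noteq> \<zero>} R" (is "subfield ?Q R")
proof -
  note c = subsetD[OF subringE(1)[OF S]]
  have unit: "w \<in> Units R" if "w \<in> S" "w \<noteq> \<zero>" for w
    using that c by (simp add: field_Units)
  have cl: "inv w \<in> carrier R" if "w \<in> S" "w \<noteq> \<zero>" for w
    using unit[OF that] by simp
  have inv_mult: "inv w \<otimes> inv w' = inv (w \<otimes> w')" if "w \<in> S" "w \<noteq> \<zero>" "w' \<in> S" "w' \<noteq> \<zero>" for w w'
  proof -
    have u: "w \<in> Units R" "w' \<in> Units R" using unit that by auto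
    then have "(w \<otimes> w') \<otimes> (inv w \<otimes> inv w') = (w \<otimes> inv w) \<otimes> (w' \<otimes> inv w')"
      by (simp add: m_ac Units_closed)
    then have "(w \<otimes> w') \<otimes> (inv w \<otimes> inv w') = \<one>" using u by simp
    then show ?thesis
      using comm_inv_char[of "w \<otimes> w'" "inv w \<otimes> inv w'"] u by (simp add: Units_closed)
  qed
  have QI: "x \<in> ?Q" if "x = u \<otimes> inv w" "u \<in> S" "w \<in> S" "w \<noteq> \<zero>" for x u w
    using that by blast
  show ?thesis
  proof (rule subfieldI')
    show "subring ?Q R"
    proof (rule subringI)
      show "?Q \<subseteq> carrier R"
      proof
        fix x assume "x \<in> ?Q"
        then obtain u w where "x = u \<otimes> inv w" "u \<in> S" "w \<in> S" "w \<noteq> \<zero>" by blast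
        then show "x \<in> carrier R" using c[of u] cl[of w] by simp
      qed
      have "\<one> = \<one> \<otimes> inv \<one>" by simp
      then show "\<one> \<in> ?Q" by (rule QI) (use subringE(3)[OF S] in simp_all)
    next
      fix x assume "x \<in> ?Q"
      then obtain u w where x: "x = u \<otimes> inv w" "u \<in> S" "w \<in> S" "w \<noteq> \<zero>" by blast
      then have "\<ominus> x = \<ominus> u \<otimes> inv w" using c[of u] cl[of w] by (simp add: l_minus)
      then show "\<ominus> x \<in> ?Q" by (rule QI) (use x subringE(5)[OF S] in simp_all)
      fix y assume "y \<in> ?Q"
      then obtain u' w' where y: "y = u' \<otimes> inv w'" "u' \<in> S" "w' \<in> S" "w' \<noteq> \<zero>" by blast
      have w: "w \<otimes> w' \<in> S" "w \<otimes> w' \<noteq> \<zero>"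
        using x y subringE(6)[OF S] c[of w] c[of w'] by (simp_all add: integral_iff)
      note cs = c[OF x(2)] c[OF x(3)] c[OF y(2)] c[OF y(3)] cl[OF x(3,4)] cl[OF y(3,4)]
      have "x \<otimes> y = (u \<otimes> u') \<otimes> (inv w \<otimes> inv w')"
        using cs by (simp add: x(1) y(1) m_ac)
      also have "\<dots> = (u \<otimes> u') \<otimes> inv (w \<otimes> w')" using inv_mult x y by simp
      finally show "x \<otimes> y \<in> ?Q" by (rule QI) (use x y w subringE(6)[OF S] in simp_all)
      have "(u \<otimes> w') \<otimes> (inv w \<otimes> inv w') = (u \<otimes> inv w) \<otimes> (w' \<otimes> inv w')"
        using cs by (simp add: m_ac)
      then have 1: "(u \<otimes> w') \<otimes> (inv w \<otimes> inv w') = x" using unit[OF y(3,4)] cs x(1) by simp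
      have "(u' \<otimes> w) \<otimes> (inv w \<otimes> inv w') = (u' \<otimes> inv w') \<otimes> (w \<otimes> inv w)"
        using cs by (simp add: m_ac)
      then have 2: "(u' \<otimes> w) \<otimes> (inv w \<otimes> inv w') = y" using unit[OF x(3,4)] cs y(1) by simp
      have "x \<oplus> y = (u \<otimes> w' \<oplus> u' \<otimes> w) \<otimes> (inv w \<otimes> inv w')"
        using cs 1 2 by (simp add: l_distr)
      also have "\<dots> = (u \<otimes> w' \<oplus> u' \<otimes> w) \<otimes> inv (w \<otimes> w')" using inv_mult x y by simp
      finally show "x \<oplus> y \<in> ?Q" by (rule QI) (use x y w subringE(6,7)[OF S] in simp_all)
    qed
    fix k assume "k \<in> ?Q - {\<zero>}"
    then obtain u w where k: "k = u \<otimes> inv w" "u \<in> S" "w \<in> S" "w \<noteq> \<zero>" "k \<noteq> \<zero>" by blast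
    note cs = c[OF k(2)] c[OF k(3)] cl[OF k(3,4)]
    have u0: "u \<noteq> \<zero>" using k(1,5) cs(3) by auto
    have "k \<otimes> (w \<otimes> inv u) = (u \<otimes> inv u) \<otimes> (w \<otimes> inv w)"
      using cs cl[OF k(2) u0] by (simp add: k(1) m_ac)
    then have "k \<otimes> (w \<otimes> inv u) = \<one>" using unit[OF k(2) u0] unit[OF k(3,4)] by simp
    then have "inv k = w \<otimes> inv u"
      using comm_inv_char[of k "w \<otimes> inv u"] cs cl[OF k(2) u0] k(1) by simp
    then show "inv k \<in> ?Q" by (rule QI) (use k u0 in simp_all)
  qed
qed

lemma (in vf_extension) generated_inj:
  assumes x: "x \<in> carrier (Fld L)"
  shows "\<exists>t :: 'b \<Rightarrow> 'a ext_univ. inj_on t (generate_field (Fld L) (f ` carrier (Fld K) \<union> {x}))"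
proof -
  interpret KF: field "Fld K" by (rule K.Fld_field)
  interpret LF: field "Fld L" by (rule L.Fld_field)
  interpret f: ring_hom_ring "Fld K" "Fld L" f
    using emb_hom KF.ring_axioms LF.ring_axioms by (auto intro: ring_hom_ringI2)
  let ?k = "\<lambda>(p, q). LF.eval (map f p) x \<otimes>\<^bsub>Fld L\<^esub> inv\<^bsub>Fld L\<^esub> (LF.eval (map f q) x)"
  have sr: "subring (f ` carrier (Fld K)) (Fld L)"
    using f.img_is_subring[OF KF.carrier_is_subring] .
  define S where "S = LF.simple_extension (f ` carrier (Fld K)) x"
  have S: "subring S (Fld L)" unfolding S_def using LF.simple_extension_is_subring[OF sr x] .
  have S_ev: "\<exists>p. u = LF.eval (map f p) x" if "u \<in> S" for u
  proof -
    from that[unfolded S_def LF.simple_extension_as_eval_img[OF subringE(1)[OF sr] x]]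
    obtain p where p: "u = LF.eval p x" "p \<in> carrier (univ_poly (Fld L) (f ` carrier (Fld K)))"
      by (rule imageE)
    then have "set p \<subseteq> f ` carrier (Fld K)" by (auto simp: univ_poly_def polynomial_def)
    then have "p \<in> lists (f ` carrier (Fld K))" by auto
    then obtain p' where "p = map f p'" by (auto simp: lists_image)
    with p show ?thesis by blast
  qed
  let ?Q = "{u \<otimes>\<^bsub>Fld L\<^esub> inv\<^bsub>Fld L\<^esub> w | u w. u \<in> S \<and> w \<in> S \<and> w \<noteq> \<zero>\<^bsub>Fld L\<^esub>}"
  have fxS: "f ` carrier (Fld K) \<union> {x} \<subseteq> S"
    unfolding S_def using LF.simple_extension_incl[OF subringE(1)[OF sr] x] LF.simple_extension_mem[OF sr x] by blast
  have SQ: "S \<subseteq> ?Q"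
  proof
    fix u assume "u \<in> S"
    moreover from this have "u = u \<otimes>\<^bsub>Fld L\<^esub> inv\<^bsub>Fld L\<^esub> \<one>\<^bsub>Fld L\<^esub>" using subringE(1)[OF S] by auto
    ultimately show "u \<in> ?Q" using subringE(3)[OF S] LF.one_not_zero by blast
  qed
  have "generate_field (Fld L) (f ` carrier (Fld K) \<union> {x}) \<subseteq> ?Q"
    using LF.generate_field_min_subfield1[OF order_trans[OF fxS subringE(1)[OF S]]
        LF.fractions_subfield[OF S] order_trans[OF fxS SQ]] .
  also have "?Q \<subseteq> range ?k"
  proof
    fix y assume "y \<in> ?Q"
    then obtain u w where "y = u \<otimes>\<^bsub>Fld L\<^esub> inv\<^bsub>Fld L\<^esub> w" "u \<in> S" "w \<in> S" by blast
    moreover obtain p q where "u = LF.eval (map f p) x" "w = LF.eval (map f q) x"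
      using S_ev calculation by meson
    ultimately show "y \<in> range ?k" by (auto intro!: image_eqI[of _ _ "(p, q)"])
  qed
  finally have sub: "generate_field (Fld L) (f ` carrier (Fld K) \<union> {x}) \<subseteq> range ?k" .
  show ?thesis using inj_on_inv_into[OF sub] by (rule exI[where x = "inv_into UNIV ?k"])
qed

theorem pc_equiv_extD:
  fixes K :: "('a, 'g, 'k, 'z) vfield_scheme" and E :: "('e, 'h, 'l, 'y) vfield_scheme"
  assumes K: "valued_field K" and E: "valued_field E" and f: "vf_embedding K E f"
    and ab: "pc_sequence K a" "pc_sequence K b" "pc_equiv K a b"
    and x: "x \<in> carrier (Fld E)"
  shows "pseudolimit E (f \<circ> a) x \<longleftrightarrow> pseudolimit E (f \<circ> b) x"
proof -
  interpret vf_extension K E f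
    using K E f by (intro vf_extension.intro vf_extension_axioms.intro)
  interpret EF: field "Fld E" by (rule L.Fld_field)
  define A where "A = generate_field (Fld E) (f ` carrier (Fld K) \<union> {x})"
  have gen: "f ` carrier (Fld K) \<union> {x} \<subseteq> carrier (Fld E)" using emb_closed x by blast
  have A: "subfield A (Fld E)" unfolding A_def using EF.generate_field_is_subfield[OF gen] .
  have fxA: "f ` carrier (Fld K) \<subseteq> A" "x \<in> A" unfolding A_def by (auto intro: generate_field.incl)
  obtain t :: "'e \<Rightarrow> 'a ext_univ" where t: "inj_on t A" using generated_inj[OF x] unfolding A_def by blast
  let ?R = "vf_restrict E A"
  interpret R: vf_extension ?R E id using L.vf_extension_restrict[OF A] .
  interpret KR: vf_extension K ?R f
    using vf_embedding_restrict[OF A fxA(1)] K R.K.valued_field_axioms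
    by (intro vf_extension.intro vf_extension_axioms.intro)
  have [simp]: "carrier (Fld ?R) = A" by (simp add: vf_restrict_def)
  define g where "g = t \<circ> inv_into (nonzeros E \<inter> A) (vmap E)"
  define h where "h = t \<circ> inv_into (valring E \<inter> A) (rmap E)"
  have "inv_into (nonzeros E \<inter> A) (vmap E) ` vmap E ` (nonzeros E \<inter> A) \<subseteq> A"
    by (rule image_subsetI) (rule inv_into_into[THEN IntD2])
  then have "inj_on g (vmap E ` (nonzeros E \<inter> A))"
    unfolding g_def by (intro comp_inj_on inj_on_inv_into inj_on_subset[OF t]) simp_all
  then have g: "inj_on g (carrier (VGrp ?R))" by (simp add: vf_restrict_def)
  have "inv_into (valring E \<inter> A) (rmap E) ` rmap E ` (valring E \<inter> A) \<subseteq> A"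
    by (rule image_subsetI) (rule inv_into_into[THEN IntD2])
  then have "inj_on h (rmap E ` (valring E \<inter> A))"
    unfolding h_def by (intro comp_inj_on inj_on_inv_into inj_on_subset[OF t]) simp_all
  then have h: "inj_on h (carrier (RFld ?R))" by (simp add: vf_restrict_def)
  have t': "inj_on t (carrier (Fld ?R))" using t by simp
  let ?U = "vf_image t g h ?R"
  note U = R.K.valued_field_image[OF t' g h]
  interpret RU: vf_extension ?R ?U t
    using U R.K.valued_field_axioms by (intro vf_extension.intro vf_extension_axioms.intro)
  have in_A: "f (c \<rho>) \<in> A" if "pc_sequence K c" for c :: "'i::{wellorder,no_top} \<Rightarrow> 'a" and \<rho>
    using that fxA by (auto simp: pc_sequence_def)
  have eq: "pseudolimit E (f \<circ> c) x \<longleftrightarrow> pseudolimit ?U ((t \<circ> f) \<circ> c) (t x)"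
    if c: "pc_sequence K c" for c :: "'i::{wellorder,no_top} \<Rightarrow> 'a"
    using R.emb_pseudolimit_iff[of "f \<circ> c" x] RU.emb_pseudolimit_iff[of "f \<circ> c" x] in_A[OF c] fxA
    by (simp add: comp_assoc)
  have "vf_embedding K ?U (t \<circ> f)" using KR.vf_embedding_comp[OF U(2)] .
  moreover have "t x \<in> carrier (Fld ?U)" using RU.emb_closed fxA by simp
  ultimately have "pseudolimit ?U ((t \<circ> f) \<circ> a) (t x) \<longleftrightarrow> pseudolimit ?U ((t \<circ> f) \<circ> b) (t x)"
    using ab(3) U(1) unfolding pc_equiv_def by blast
  then show ?thesis using eq[OF ab(1)] eq[OF ab(2)] by simp
qed

end

theory Submission
  imports Defs
begin

text \<open>Write \<open>\<gamma>\<^sub>\<rho> = v(a - a\<^sub>\<rho>)\<close> and choose \<open>\<theta>\<^sub>\<rho>\<close> fixed by \<open>\<sigma>\<close> with \<open>v(\<theta>\<^sub>\<rho>) = \<gamma>\<^sub>\<rho>\<close>. The sequence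
  sought is \<open>b\<^sub>\<rho> = a\<^sub>\<rho> + \<theta>\<^sub>\<rho> \<mu>\<^sub>\<rho>\<close> with suitable \<open>\<mu>\<^sub>\<rho>\<close> in the valuation ring of \<open>K\<close>: as \<open>\<sigma>(\<theta>\<^sub>\<rho>) = \<theta>\<^sub>\<rho>\<close>,
  one has \<open>G(a + \<theta> y) - G(a) = \<Sum>\<^bsub>m\<ge>1\<^esub> \<theta>\<^sup>m H\<^sub>m(y)\<close>, where \<open>H\<^sub>m\<close> is a \<open>\<sigma>\<close>-polynomial, and if the values
  \<open>v(H\<^sub>m(y\<^sub>\<rho>))\<close> do not depend on \<open>\<rho>\<close>, then eventually a single term dominates, because the \<open>\<gamma>\<^sub>\<rho>\<close>
  increase strictly.

  The residue of \<open>\<sigma>(y)\<close> is a power of that of \<open>y\<close>, so that a \<open>\<sigma>\<close>-polynomial with coefficients of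
  minimal value 0 may vanish identically modulo the maximal ideal. The remedy is to replace \<open>\<sigma>\<close> by the
  \<open>p\<close>-derivation \<open>\<delta>(y) = (\<sigma>(y) - y\<^sup>p)/p\<close>. Adding \<open>p\<^sup>i z\<close> to \<open>y\<close> does not change the residues of
  \<open>y, \<delta>(y), \<dots>, \<delta>\<^bsup>i-1\<^esup>(y)\<close>, but changes that of \<open>\<delta>\<^sup>i(y)\<close> by the residue of \<open>\<sigma>\<^sup>i(z)\<close>. Hence these residues
  can be chosen one after the other, each outside a finite set depending on the preceding ones, and
  at such points a nonzero polynomial in \<open>y, \<delta>(y), \<delta>\<^sup>2(y), \<dots>\<close> attains its minimal value.\<close>

section \<open>Valuations as preorders, and the \<open>p\<close>-derivation\<close>

text \<open>The same argument is needed in two extensions of K: in L for (1), and for (2) in an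
  ultrapower of K, since no pseudolimit is given there. Hence a valuation is recorded as a relation
  on the field alone, \<open>x \<unlhd> y\<close> standing for v(x) \<le> v(y) with v(0) infinite,
  and the Witt condition as a congruence between \<sigma>(x) and x^p modulo p. Both pass to
  ultrapowers coordinatewise, and no value group or residue field has to be built there. If a is the
  pseudolimit and d = (a_\<rho> - a)/\<theta>_\<rho>, then b_\<rho> - a = \<theta>_\<rho> (d +
  \<mu>_\<rho>). Here d lives in the extension while \<mu>_\<rho> must come from K; so generic
  points are sought among the translates of d by the valuation ring of K. Dominance of one term
  requires that some H_m is not the zero function. The substitution \<sigma>^n(y) = p^n
  \<delta>^n(y) + Q(y), with Q of lower order, is linear in \<delta>^n(y) with nonzero slope. So the
  leading coefficient of a formally nonzero polynomial survives it, and by induction the polynomial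
  is nonzero as a function.\<close>

locale valuation_preorder = field R for R :: "('a, 'm) ring_scheme" (structure) +
  fixes le :: "'a \<Rightarrow> 'a \<Rightarrow> bool"  (infix \<open>\<unlhd>\<close> 50)
  assumes le_total: "\<lbrakk>x \<in> carrier R; y \<in> carrier R\<rbrakk> \<Longrightarrow> x \<unlhd> y \<or> y \<unlhd> x"
    and le_trans: "\<lbrakk>x \<in> carrier R; y \<in> carrier R; z \<in> carrier R; x \<unlhd> y; y \<unlhd> z\<rbrakk> \<Longrightarrow> x \<unlhd> z"
    and le_add: "\<lbrakk>x \<in> carrier R; y \<in> carrier R; z \<in> carrier R; x \<unlhd> y; x \<unlhd> z\<rbrakk> \<Longrightarrow> x \<unlhd> y \<oplus> z"
    and le_mult_mono: "\<lbrakk>x \<in> carrier R; y \<in> carrier R; z \<in> carrier R; x \<unlhd> y\<rbrakk> \<Longrightarrow> z \<otimes> x \<unlhd> z \<otimes> y"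
    and not_zero_le_one: "\<not> \<zero> \<unlhd> \<one>"
begin

lemma le_refl: "x \<in> carrier R \<Longrightarrow> x \<unlhd> x"
  using le_total by blast

lemma le_cancel:
  assumes "x \<in> carrier R" "y \<in> carrier R" "z \<in> carrier R" "z \<noteq> \<zero>" "z \<otimes> x \<unlhd> z \<otimes> y"
  shows "x \<unlhd> y"
proof -
  have u: "z \<in> Units R" using assms field_Units by blast
  have "inv z \<otimes> (z \<otimes> x) \<unlhd> inv z \<otimes> (z \<otimes> y)" by (rule le_mult_mono) (use assms u in auto)
  moreover have "inv z \<otimes> (z \<otimes> w) = w" if "w \<in> carrier R" for w
    using that assms u by (simp flip: m_assoc)
  ultimately show ?thesis using assms by simp
qed

lemma zero_le:
  assumes "x \<in> carrier R" "\<zero> \<unlhd> x" shows "x = \<zero>"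
proof (rule ccontr)
  assume "x \<noteq> \<zero>"
  moreover have "x \<otimes> \<zero> \<unlhd> x \<otimes> \<one>" using assms by simp
  ultimately show False using le_cancel[of \<zero> \<one> x] assms not_zero_le_one by simp
qed

lemma le_zero: "x \<in> carrier R \<Longrightarrow> x \<unlhd> \<zero>"
  using le_total[of x \<zero>] zero_le[of x] le_refl by auto

lemma le_mult_mono2:
  assumes "x \<in> carrier R" "y \<in> carrier R" "z \<in> carrier R" "w \<in> carrier R" "x \<unlhd> y" "z \<unlhd> w"
  shows "x \<otimes> z \<unlhd> y \<otimes> w"
proof -
  have "x \<otimes> z \<unlhd> x \<otimes> w" "w \<otimes> x \<unlhd> w \<otimes> y" using assms le_mult_mono by auto
  then show ?thesis using le_trans[of "x \<otimes> z" "x \<otimes> w" "y \<otimes> w"] assms m_comm by auto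
qed

lemma one_le_minus: "\<one> \<unlhd> \<ominus> \<one>"
  using le_total[of \<one> "\<ominus> \<one>"] le_mult_mono[of "\<ominus> \<one>" \<one> "\<ominus> \<one>"] by (auto simp: l_minus)

lemma le_uminus:
  assumes "x \<in> carrier R" "y \<in> carrier R" "x \<unlhd> y" shows "x \<unlhd> \<ominus> y"
  using le_mult_mono2[of x y \<one> "\<ominus> \<one>"] assms one_le_minus by (simp add: r_minus)

lemma le_diff: "\<lbrakk>x \<in> carrier R; y \<in> carrier R; z \<in> carrier R; x \<unlhd> y; x \<unlhd> z\<rbrakk> \<Longrightarrow> x \<unlhd> y \<ominus> z"
  by (simp add: a_minus_def le_add le_uminus)

lemma le_minus_commute:
  assumes "x \<in> carrier R" "y \<in> carrier R" "z \<in> carrier R" "x \<unlhd> y \<ominus> z" shows "x \<unlhd> z \<ominus> y"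
proof -
  have "\<ominus> (y \<ominus> z) = z \<ominus> y" using assms by (simp add: a_minus_def minus_add a_comm)
  then show ?thesis using le_uminus[of x "y \<ominus> z"] assms by simp
qed

lemma diff_add_diff:
  "\<lbrakk>x \<in> carrier R; y \<in> carrier R; z \<in> carrier R\<rbrakk> \<Longrightarrow> (x \<ominus> y) \<oplus> (y \<ominus> z) = x \<ominus> z"
  by (simp add: a_minus_def a_assoc l_neg r_neg r_neg1 r_neg2)

lemma le_diff_trans:
  assumes "c \<in> carrier R" "x \<in> carrier R" "y \<in> carrier R" "z \<in> carrier R" "c \<unlhd> x \<ominus> y" "c \<unlhd> y \<ominus> z"
  shows "c \<unlhd> x \<ominus> z"
  using le_add[of c "x \<ominus> y" "y \<ominus> z"] assms by (simp add: diff_add_diff)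

lemma le_mult_left:
  "\<lbrakk>x \<in> carrier R; y \<in> carrier R; z \<in> carrier R; \<one> \<unlhd> z; x \<unlhd> y\<rbrakk> \<Longrightarrow> x \<unlhd> z \<otimes> y"
  using le_mult_mono2[of \<one> z x y] by simp

lemma le_mult_right:
  "\<lbrakk>x \<in> carrier R; y \<in> carrier R; z \<in> carrier R; \<one> \<unlhd> z; x \<unlhd> y\<rbrakk> \<Longrightarrow> x \<unlhd> y \<otimes> z"
  using le_mult_mono2[of x y \<one> z] by simp

lemma one_le_pow: "\<lbrakk>x \<in> carrier R; \<one> \<unlhd> x\<rbrakk> \<Longrightarrow> \<one> \<unlhd> x [^] (n::nat)"
  by (induction n) (auto simp: le_refl intro: le_mult_right)

lemma one_le_add_pow: "\<one> \<unlhd> add_pow R (n::nat) \<one>"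
  by (induction n) (auto intro: le_add le_refl le_zero)

text \<open>If x + y were strictly above x, then both x + y and y would be, hence also their
  difference, which is x.\<close>

lemma strict_le_add:
  assumes "x \<in> carrier R" "y \<in> carrier R" "\<not> y \<unlhd> x"
  shows "x \<unlhd> x \<oplus> y" "x \<oplus> y \<unlhd> x"
proof -
  show "x \<unlhd> x \<oplus> y" using assms le_total le_refl by (blast intro: le_add)
  show "x \<oplus> y \<unlhd> x"
  proof (rule ccontr)
    assume *: "\<not> x \<oplus> y \<unlhd> x"
    have e: "(x \<oplus> y) \<ominus> y = x" using assms by (simp add: a_minus_def a_assoc r_neg)
    have "x \<oplus> y \<unlhd> y \<or> y \<unlhd> x \<oplus> y" using assms le_total by simp
    then show False
      using le_diff[of "x \<oplus> y" "x \<oplus> y" y] le_diff[of y "x \<oplus> y" y] le_refl assms * by (auto simp: e)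
  qed
qed

definition veq :: "'a \<Rightarrow> 'a \<Rightarrow> bool"  (infix \<open>\<asymp>\<close> 50)
  where "x \<asymp> y \<longleftrightarrow> x \<unlhd> y \<and> y \<unlhd> x"

lemma veq_trans: "\<lbrakk>x \<in> carrier R; y \<in> carrier R; z \<in> carrier R; x \<asymp> y; y \<asymp> z\<rbrakk> \<Longrightarrow> x \<asymp> z"
  unfolding veq_def using le_trans by blast

lemma veq_sym: "x \<asymp> y \<Longrightarrow> y \<asymp> x"
  by (auto simp: veq_def)

lemma veq_mult: "\<lbrakk>x \<in> carrier R; y \<in> carrier R; z \<in> carrier R; w \<in> carrier R; x \<asymp> y; z \<asymp> w\<rbrakk> \<Longrightarrow> x \<otimes> z \<asymp> y \<otimes> w"
  unfolding veq_def using le_mult_mono2 by blast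

lemma veq_minus_commute:
  assumes "x \<in> carrier R" "y \<in> carrier R" shows "x \<ominus> y \<asymp> y \<ominus> x"
  using le_minus_commute[of "x \<ominus> y" x y] le_minus_commute[of "y \<ominus> x" y x] assms le_refl
  by (simp add: veq_def)

lemma veq_le_iff:
  assumes "x \<in> carrier R" "x' \<in> carrier R" "y \<in> carrier R" "y' \<in> carrier R" "x \<asymp> x'" "y \<asymp> y'"
  shows "x \<unlhd> y \<longleftrightarrow> x' \<unlhd> y'"
  using assms le_trans[of x y y'] le_trans[of x' x y'] le_trans[of x' y' y] le_trans[of x x' y]
  unfolding veq_def by blast

lemma veq_diff_strict:
  assumes "x \<in> carrier R" "y \<in> carrier R" "\<not> y \<unlhd> x" shows "x \<ominus> y \<asymp> x"
proof -
  have "\<not> \<ominus> y \<unlhd> x" using le_uminus[of y y] le_trans[of y "\<ominus> y" x] le_refl[of y] assms by auto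
  then show ?thesis using strict_le_add[of x "\<ominus> y"] assms by (simp add: veq_def a_minus_def)
qed

lemma inv_mult_le_iff:
  assumes "x \<in> carrier R" "y \<in> carrier R" "x \<noteq> \<zero>"
  shows "\<one> \<unlhd> inv x \<otimes> y \<longleftrightarrow> x \<unlhd> y"
proof -
  have u: "x \<in> Units R" using assms field_Units by blast
  have *: "x \<otimes> (inv x \<otimes> y) = y" using assms u by (simp flip: m_assoc)
  show ?thesis using le_mult_mono[of \<one> "inv x \<otimes> y" x] le_cancel[of \<one> "inv x \<otimes> y" x] assms u *
    by auto
qed

end

lemma (in ring) minus_eqI: "\<lbrakk>x = z \<oplus> y; y \<in> carrier R; z \<in> carrier R\<rbrakk> \<Longrightarrow> x \<ominus> y = z"
  by (simp add: a_minus_def a_assoc r_neg)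

lemma (in ring) minus_add_same: "\<lbrakk>x \<in> carrier R; y \<in> carrier R\<rbrakk> \<Longrightarrow> (x \<ominus> y) \<oplus> y = x"
  by (simp add: a_minus_def a_assoc l_neg)

text \<open>A Witt case with value group and residue field forgotten: \<sigma> reduces to the
  Frobenius map modulo p, and p has the least value above that of 1. Each axiom can be checked
  coordinatewise in an ultrapower.\<close>

locale frobenius_lift = valuation_preorder +
  fixes \<sigma> :: "'a \<Rightarrow> 'a" and p :: nat
  assumes sigma_hom: "\<sigma> \<in> ring_hom R R"
    and sigma_veq: "x \<in> carrier R \<Longrightarrow> \<sigma> x \<asymp> x"
    and p_nonzero: "add_pow R p \<one> \<noteq> \<zero>"
    and p_less: "\<not> add_pow R p \<one> \<unlhd> \<one>"
    and p_least: "\<lbrakk>x \<in> carrier R; \<not> x \<unlhd> \<one>\<rbrakk> \<Longrightarrow> add_pow R p \<one> \<unlhd> x"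
    and sigma_frobenius: "\<lbrakk>x \<in> carrier R; \<one> \<unlhd> x\<rbrakk> \<Longrightarrow> add_pow R p \<one> \<unlhd> \<sigma> x \<ominus> x [^] p"

text \<open>In the application, \<open>B\<close> is the valuation ring of the smaller field: corrections are only
  allowed there.\<close>

locale witt_difference = frobenius_lift +
  fixes B :: "'a set"
  assumes B_integral: "\<lbrakk>x \<in> B\<rbrakk> \<Longrightarrow> x \<in> carrier R \<and> \<one> \<unlhd> x"
    and B_zero: "\<zero> \<in> B"
    and B_shift: "\<lbrakk>x \<in> B; y \<in> B\<rbrakk> \<Longrightarrow> x \<oplus> add_pow R p \<one> [^] (i::nat) \<otimes> y \<in> B"
    and B_residues: "\<exists>Z \<subseteq> B. infinite Z \<and> (\<forall>x\<in>Z. \<forall>y\<in>Z. x \<noteq> y \<longrightarrow> \<not> add_pow R p \<one> \<unlhd> x \<ominus> y)"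
begin

definition \<pi> :: 'a where "\<pi> = add_pow R p \<one>"

definition \<O> :: "'a set" where O_def: "\<O> = {x \<in> carrier R. \<one> \<unlhd> x}"

definition \<delta> :: "'a \<Rightarrow> 'a" where "\<delta> y = inv \<pi> \<otimes> (\<sigma> y \<ominus> y [^] p)"

interpretation \<sigma>: ring_hom_ring R R \<sigma>
  using sigma_hom by (intro ring_hom_ringI2 ring_axioms)

lemma sigma_ring_hom: "ring_hom_ring R R \<sigma>" ..

lemma pi_closed [simp]: "\<pi> \<in> carrier R" by (simp add: \<pi>_def)
lemma pi_nonzero [simp]: "\<pi> \<noteq> \<zero>" using p_nonzero by (simp add: \<pi>_def)
lemma pi_integral: "\<one> \<unlhd> \<pi>" by (simp add: \<pi>_def one_le_add_pow)
lemma pi_unit: "\<pi> \<in> Units R" by (simp add: field_Units)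
lemma inv_pi_closed [simp]: "inv \<pi> \<in> carrier R" using pi_unit by simp

lemma sigma_pow_closed [simp]: "x \<in> carrier R \<Longrightarrow> (\<sigma> ^^ i) x \<in> carrier R"
  by (induction i) auto

lemma sigma_pow_minus:
  "\<lbrakk>x \<in> carrier R; y \<in> carrier R\<rbrakk> \<Longrightarrow> (\<sigma> ^^ i) (x \<ominus> y) = (\<sigma> ^^ i) x \<ominus> (\<sigma> ^^ i) y"
  by (induction i) (auto simp: a_minus_def)

lemma sigma_pow_add:
  "\<lbrakk>x \<in> carrier R; y \<in> carrier R\<rbrakk> \<Longrightarrow> (\<sigma> ^^ i) (x \<oplus> y) = (\<sigma> ^^ i) x \<oplus> (\<sigma> ^^ i) y"
  by (induction i) auto

lemma sigma_pow_mult: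
  "\<lbrakk>x \<in> carrier R; y \<in> carrier R\<rbrakk> \<Longrightarrow> (\<sigma> ^^ i) (x \<otimes> y) = (\<sigma> ^^ i) x \<otimes> (\<sigma> ^^ i) y"
  by (induction i) auto

lemma sigma_pow_veq: "x \<in> carrier R \<Longrightarrow> (\<sigma> ^^ i) x \<asymp> x"
proof (induction i)
  case 0 then show ?case by (simp add: veq_def le_refl)
next
  case (Suc i) then show ?case using sigma_veq[of "(\<sigma> ^^ i) x"] veq_trans[of "(\<sigma> ^^ Suc i) x" "(\<sigma> ^^ i) x" x] by simp
qed

lemma sigma_le:
  "\<lbrakk>x \<in> carrier R; y \<in> carrier R; x \<unlhd> y\<rbrakk> \<Longrightarrow> x \<unlhd> \<sigma> y"
  using sigma_veq[of y] le_trans[of x y "\<sigma> y"] by (auto simp: veq_def)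

lemma sigma_pi [simp]: "\<sigma> \<pi> = \<pi>"
proof -
  have "\<sigma> (add_pow R (n::nat) \<one>) = add_pow R n \<one>" for n by (induction n) auto
  then show ?thesis by (simp add: \<pi>_def)
qed

lemma O_closed: "x \<in> \<O> \<Longrightarrow> x \<in> carrier R" by (simp add: O_def)
lemma O_le: "x \<in> \<O> \<Longrightarrow> \<one> \<unlhd> x" by (simp add: O_def)

lemma zero_O [simp]: "\<zero> \<in> \<O>" and one_O [simp]: "\<one> \<in> \<O>" and pi_O [simp]: "\<pi> \<in> \<O>"
  by (simp_all add: O_def le_zero le_refl pi_integral)

lemma O_add [simp]: "\<lbrakk>x \<in> \<O>; y \<in> \<O>\<rbrakk> \<Longrightarrow> x \<oplus> y \<in> \<O>" by (simp add: O_def le_add)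
lemma O_minus [simp]: "\<lbrakk>x \<in> \<O>; y \<in> \<O>\<rbrakk> \<Longrightarrow> x \<ominus> y \<in> \<O>" by (simp add: O_def le_diff)
lemma O_uminus [simp]: "\<lbrakk>x \<in> \<O>\<rbrakk> \<Longrightarrow> \<ominus> x \<in> \<O>" by (simp add: O_def le_uminus)
lemma O_mult [simp]: "\<lbrakk>x \<in> \<O>; y \<in> \<O>\<rbrakk> \<Longrightarrow> x \<otimes> y \<in> \<O>" by (simp add: O_def le_mult_right)
lemma O_pow [simp]: "x \<in> \<O> \<Longrightarrow> x [^] (n::nat) \<in> \<O>" by (simp add: O_def one_le_pow)
lemma O_add_pow [simp]: "add_pow R (n::nat) \<one> \<in> \<O>" by (simp add: O_def one_le_add_pow)
lemma O_sigma [simp]: "x \<in> \<O> \<Longrightarrow> \<sigma> x \<in> \<O>" by (simp add: O_def sigma_le)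
lemma O_sigma_pow [simp]: "x \<in> \<O> \<Longrightarrow> (\<sigma> ^^ i) x \<in> \<O>" by (induction i) auto

lemma B_sub_O: "x \<in> B \<Longrightarrow> x \<in> \<O>" using B_integral by (simp add: O_def)

lemma delta_closed [simp]: "y \<in> carrier R \<Longrightarrow> \<delta> y \<in> carrier R"
  by (simp add: \<delta>_def)

lemma delta_O [simp]: "y \<in> \<O> \<Longrightarrow> \<delta> y \<in> \<O>"
  using inv_mult_le_iff[of \<pi> "\<sigma> y \<ominus> y [^] p"] sigma_frobenius[of y]
  by (simp add: O_def \<delta>_def \<pi>_def[symmetric])

declare O_closed [simp]

lemma delta_pow_O [simp]: "y \<in> \<O> \<Longrightarrow> (\<delta> ^^ i) y \<in> \<O>"
  by (induction i) auto

lemma le_cases: "x \<in> carrier R \<Longrightarrow> x \<unlhd> \<one> \<or> \<pi> \<unlhd> x"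
  using p_least by (auto simp: \<pi>_def)

text \<open>Translate of \<open>le_cases\<close> by v(s): no value lies strictly between v(s) and
  v(s \<pi>). So "larger than v(s)" can be replaced by divisibility by s \<pi>, which behaves well
  under sums and products. For nonzero s, \<open>not_pi_le\<close> says that the two cases exclude
  each other.\<close>

lemma le_cases_scaled:
  assumes "s \<in> carrier R" "x \<in> carrier R" shows "x \<unlhd> s \<or> s \<otimes> \<pi> \<unlhd> x"
proof (cases "s = \<zero>")
  case True then show ?thesis using assms le_zero by simp
next
  case False
  then have u: "s \<in> Units R" using assms by (simp add: field_Units)
  have e: "s \<otimes> (inv s \<otimes> x) = x" using assms u by (simp flip: m_assoc)
  have "inv s \<otimes> x \<unlhd> \<one> \<or> \<pi> \<unlhd> inv s \<otimes> x" using le_cases assms u by simp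
  then show ?thesis
    using le_mult_mono[of "inv s \<otimes> x" \<one> s] le_mult_mono[of \<pi> "inv s \<otimes> x" s] assms u e by auto
qed

lemma not_pi_le:
  assumes "s \<in> carrier R" "s \<noteq> \<zero>" "x \<in> carrier R" "x \<unlhd> s" shows "\<not> s \<otimes> \<pi> \<unlhd> x"
proof
  assume "s \<otimes> \<pi> \<unlhd> x"
  then have "s \<otimes> \<pi> \<unlhd> s \<otimes> \<one>" using le_trans[of "s \<otimes> \<pi>" x s] assms by simp
  then show False using le_cancel[of \<pi> \<one> s] assms p_less by (simp add: \<pi>_def)
qed

lemma O_cases: assumes "x \<in> \<O>" obtains "\<pi> \<unlhd> x" | "x \<asymp> \<one>"
  using le_cases[of x] O_closed[OF assms] O_le[OF assms] by (auto simp: veq_def)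

lemma pi_mult_delta:
  assumes "y \<in> carrier R" shows "\<pi> \<otimes> \<delta> y = \<sigma> y \<ominus> y [^] p"
  using assms pi_unit by (simp add: \<delta>_def flip: m_assoc)

lemma sigma_eq_delta: "y \<in> carrier R \<Longrightarrow> \<sigma> y = \<pi> \<otimes> \<delta> y \<oplus> y [^] p"
  by (simp add: pi_mult_delta a_minus_def a_assoc l_neg)

text \<open>Taylor expansion to first order. It is applied with k = p, where the linear coefficient
  contains \<pi>; so if \<pi> divides w, the change of x^p is divisible by \<pi> w. At k = 0 the
  truncated exponent \<open>k - 1\<close> is harmless because the coefficient is zero.\<close>

lemma pow_add_expand:
  assumes "x \<in> \<O>" "w \<in> \<O>"
  shows "\<exists>e\<in>\<O>. (x \<oplus> w) [^] (k::nat) = x [^] k \<oplus> w \<otimes> (add_pow R k \<one> \<otimes> x [^] (k - 1) \<oplus> w \<otimes> e)"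
proof (induction k)
  case 0
  then show ?case using assms by (intro bexI[of _ \<zero>]) auto
next
  case (Suc k)
  then obtain e where e: "e \<in> \<O>" "(x \<oplus> w) [^] k = x [^] k \<oplus> w \<otimes> (add_pow R k \<one> \<otimes> x [^] (k - 1) \<oplus> w \<otimes> e)"
    by blast
  define A V where "A = add_pow R k \<one> \<otimes> x [^] (k - 1)" and "V = x [^] k"
  have V: "V \<in> \<O>" and A: "A \<in> \<O>" using assms by (auto simp: V_def A_def)
  have A': "A \<otimes> x \<oplus> V = add_pow R (Suc k) \<one> \<otimes> x [^] (Suc k - 1)"
    using assms by (cases k) (auto simp: A_def V_def m_assoc l_distr)
  have "(x \<oplus> w) [^] Suc k = (V \<oplus> w \<otimes> (A \<oplus> w \<otimes> e)) \<otimes> (x \<oplus> w)"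
    using e by (simp add: A_def V_def)
  also have "\<dots> = V \<otimes> x \<oplus> w \<otimes> ((A \<otimes> x \<oplus> V) \<oplus> w \<otimes> (A \<oplus> w \<otimes> e \<oplus> e \<otimes> x))"
    using V A assms e by (simp add: l_distr r_distr m_ac a_ac)
  finally have "(x \<oplus> w) [^] Suc k = x [^] Suc k \<oplus> w \<otimes> (add_pow R (Suc k) \<one> \<otimes> x [^] (Suc k - 1)
      \<oplus> w \<otimes> (A \<oplus> w \<otimes> e \<oplus> e \<otimes> x))"
    unfolding A' by (simp add: V_def)
  moreover have "A \<oplus> w \<otimes> e \<oplus> e \<otimes> x \<in> \<O>" using A assms e by simp
  ultimately show ?case by (rule bexI)
qed

text \<open>The shift by \<pi>^(i+1) z changes \<sigma>(y) by \<pi>^(i+1) \<sigma>(z), but y^p only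
  by a multiple of \<pi>^(i+2). Dividing by \<pi> leaves \<pi>^i \<sigma>(z) up to a multiple of
  \<pi>^(i+1).\<close>

lemma delta_shift:
  assumes y: "y \<in> \<O>" and z: "z \<in> \<O>"
  shows "\<exists>e\<in>\<O>. \<delta> (y \<oplus> \<pi> [^] Suc i \<otimes> z) = \<delta> y \<oplus> \<pi> [^] i \<otimes> (\<sigma> z \<oplus> \<pi> \<otimes> e)"
proof -
  let ?w = "\<pi> [^] Suc i \<otimes> z"
  have w: "?w \<in> \<O>" using z by simp
  obtain e where e: "e \<in> \<O>" "(y \<oplus> ?w) [^] p = y [^] p \<oplus> ?w \<otimes> (\<pi> \<otimes> y [^] (p - 1) \<oplus> ?w \<otimes> e)"
    using pow_add_expand[OF y w, of p] unfolding \<pi>_def by blast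
  define P Y W D where "P = \<pi> [^] i" and "Y = y [^] (p - 1)" and "W = y [^] p" and "D = \<delta> y"
  \<comment> \<open>The change of y^p equals \<pi>^2 \<open>P\<close> \<open>e'\<close>, so
    \<open>Z\<close> is what remains of \<sigma>(z) once this is moved to the other side and a
    factor \<pi> \<open>P\<close> is taken out.\<close>
  define e' where "e' = z \<otimes> (Y \<oplus> P \<otimes> z \<otimes> e)"
  define Z where "Z = \<sigma> z \<ominus> \<pi> \<otimes> e'"
  have c: "P \<in> \<O>" "Y \<in> \<O>" "W \<in> \<O>" "D \<in> \<O>" "e' \<in> \<O>" "Z \<in> \<O>"
    using y z e by (auto simp: P_def Y_def D_def W_def e'_def Z_def)
  note c = c c[THEN O_closed] y[THEN O_closed] z[THEN O_closed] e(1)[THEN O_closed]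
  have "\<sigma> ?w = P \<otimes> \<pi> \<otimes> \<sigma> z" using z by (simp add: P_def \<sigma>.hom_nat_pow)
  also have "\<sigma> z = Z \<oplus> \<pi> \<otimes> e'" using c by (simp add: Z_def minus_add_same)
  finally have sw: "\<sigma> ?w = P \<otimes> \<pi> \<otimes> (Z \<oplus> \<pi> \<otimes> (z \<otimes> (Y \<oplus> P \<otimes> z \<otimes> e)))" by (simp add: e'_def)
  have "\<sigma> (y \<oplus> ?w) = (\<pi> \<otimes> D \<oplus> W) \<oplus> P \<otimes> \<pi> \<otimes> (Z \<oplus> \<pi> \<otimes> (z \<otimes> (Y \<oplus> P \<otimes> z \<otimes> e)))"
    using y w sw sigma_eq_delta[of y] by (simp add: D_def W_def)
  also have "\<dots> = \<pi> \<otimes> (D \<oplus> P \<otimes> Z) \<oplus> (W \<oplus> P \<otimes> \<pi> \<otimes> z \<otimes> (\<pi> \<otimes> Y \<oplus> P \<otimes> \<pi> \<otimes> z \<otimes> e))"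
    using c by (simp add: l_distr r_distr m_ac a_ac)
  also have "W \<oplus> P \<otimes> \<pi> \<otimes> z \<otimes> (\<pi> \<otimes> Y \<oplus> P \<otimes> \<pi> \<otimes> z \<otimes> e) = (y \<oplus> ?w) [^] p"
    unfolding e(2) by (simp add: P_def Y_def W_def)
  finally have "\<sigma> (y \<oplus> ?w) \<ominus> (y \<oplus> ?w) [^] p = \<pi> \<otimes> (D \<oplus> P \<otimes> Z)"
    using c w by (intro minus_eqI) simp_all
  then have "\<pi> \<otimes> \<delta> (y \<oplus> ?w) = \<pi> \<otimes> (D \<oplus> P \<otimes> Z)"
    using pi_mult_delta[of "y \<oplus> ?w"] y w by simp
  then have "\<delta> (y \<oplus> ?w) = D \<oplus> P \<otimes> Z"
    by (subst (asm) m_lcancel) (use c w in \<open>simp_all del: nat_pow_Suc\<close>)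
  moreover have "Z = \<sigma> z \<oplus> \<pi> \<otimes> (\<ominus> e')" using c by (simp add: Z_def a_minus_def r_minus)
  ultimately show ?thesis using c by (intro bexI[of _ "\<ominus> e'"]) (simp_all add: P_def D_def)
qed

text \<open>Each \<delta> consumes one factor \<pi> and applies \<sigma> to the leading term. For j
  < i the change is divisible by \<pi>; at j = i it is congruent to \<sigma>^i(z).\<close>

lemma delta_pow_shift:
  assumes y: "y \<in> \<O>" and z: "z \<in> \<O>" and "j \<le> i"
  shows "\<exists>e\<in>\<O>. (\<delta> ^^ j) (y \<oplus> \<pi> [^] i \<otimes> z) = (\<delta> ^^ j) y \<oplus> \<pi> [^] (i - j) \<otimes> ((\<sigma> ^^ j) z \<oplus> \<pi> \<otimes> e)"
  using \<open>j \<le> i\<close>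
proof (induction j)
  case 0
  then show ?case using y z by (intro bexI[of _ \<zero>]) auto
next
  case (Suc j)
  then obtain e where e: "e \<in> \<O>"
    "(\<delta> ^^ j) (y \<oplus> \<pi> [^] i \<otimes> z) = (\<delta> ^^ j) y \<oplus> \<pi> [^] (i - j) \<otimes> ((\<sigma> ^^ j) z \<oplus> \<pi> \<otimes> e)" by auto
  have ij: "i - j = Suc (i - Suc j)" using Suc by simp
  obtain e' where e': "e' \<in> \<O>" "\<delta> ((\<delta> ^^ j) y \<oplus> \<pi> [^] (i - j) \<otimes> ((\<sigma> ^^ j) z \<oplus> \<pi> \<otimes> e)) =
     \<delta> ((\<delta> ^^ j) y) \<oplus> \<pi> [^] (i - Suc j) \<otimes> (\<sigma> ((\<sigma> ^^ j) z \<oplus> \<pi> \<otimes> e) \<oplus> \<pi> \<otimes> e')"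
    using delta_shift[of "(\<delta> ^^ j) y" "(\<sigma> ^^ j) z \<oplus> \<pi> \<otimes> e" "i - Suc j"] y z e unfolding ij by auto
  have "\<sigma> ((\<sigma> ^^ j) z \<oplus> \<pi> \<otimes> e) \<oplus> \<pi> \<otimes> e' = (\<sigma> ^^ Suc j) z \<oplus> \<pi> \<otimes> (\<sigma> e \<oplus> e')"
    using z e e' by (simp add: r_distr a_assoc)
  then show ?case using e e' by (intro bexI[of _ "\<sigma> e \<oplus> e'"]) auto
qed

end

section \<open>Generic points\<close>

text \<open>Coefficients are in ascending order and trailing zeros are allowed, so that lists of
  coefficient functions can be evaluated pointwise without normalising them.\<close>

primrec (in ring) horner :: "'a list \<Rightarrow> 'a \<Rightarrow> 'a" where
  "horner [] t = \<zero>"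
| "horner (c # cs) t = c \<oplus> t \<otimes> horner cs t"

lemma (in ring) horner_closed [simp]:
  "\<lbrakk>set cs \<subseteq> carrier R; t \<in> carrier R\<rbrakk> \<Longrightarrow> horner cs t \<in> carrier R"
  by (induction cs) auto

context valuation_preorder begin

lemma le_horner:
  "\<lbrakk>set cs \<subseteq> carrier R; t \<in> carrier R; \<one> \<unlhd> t; s \<in> carrier R; \<forall>c\<in>set cs. s \<unlhd> c\<rbrakk> \<Longrightarrow> s \<unlhd> horner cs t"
  by (induction cs) (auto intro!: le_zero le_add le_mult_left)

text \<open>Synthetic division by t - \<open>t\<^sub>0\<close>. Since \<open>t\<^sub>0\<close> is
  integral, the quotient together with the remainder has the same common lower bounds as the
  coefficients; this says, without naming a minimum, that the minimal value is preserved.\<close>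

lemma horner_divide:
  assumes "set cs \<subseteq> carrier R" "t\<^sub>0 \<in> carrier R" "\<one> \<unlhd> t\<^sub>0"
  shows "\<exists>qs. length qs = length cs - 1 \<and> set qs \<subseteq> carrier R \<and>
    (\<forall>s\<in>carrier R. (\<forall>c\<in>set cs. s \<unlhd> c) \<longrightarrow> (\<forall>q\<in>set qs. s \<unlhd> q)) \<and>
    (\<forall>s\<in>carrier R. (\<forall>q\<in>set qs. s \<unlhd> q) \<and> s \<unlhd> horner cs t\<^sub>0 \<longrightarrow> (\<forall>c\<in>set cs. s \<unlhd> c)) \<and>
    (\<forall>t\<in>carrier R. horner cs t = (t \<ominus> t\<^sub>0) \<otimes> horner qs t \<oplus> horner cs t\<^sub>0)"
  using assms(1)
proof (induction cs)
  case Nil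
  then show ?case using assms by (intro exI[of _ "[]"]) simp
next
  case (Cons c ds)
  then have cl: "c \<in> carrier R" "set ds \<subseteq> carrier R" by auto
  show ?case
  \<comment> \<open>For a single coefficient the general quotient \<open>r # qs\<close> would
    consist of one zero and be one entry too long. The exact length drives the induction on the
    number of roots.\<close>
  proof (cases "ds = []")
    case True
    then show ?thesis using assms cl by (intro exI[of _ "[]"]) simp
  next
    case False
    from Cons.IH[OF cl(2)] obtain qs where qs: "length qs = length ds - 1" "set qs \<subseteq> carrier R"
      "\<And>s. s \<in> carrier R \<Longrightarrow> \<forall>c\<in>set ds. s \<unlhd> c \<Longrightarrow> \<forall>q\<in>set qs. s \<unlhd> q"
      "\<And>s. \<lbrakk>s \<in> carrier R; \<forall>q\<in>set qs. s \<unlhd> q; s \<unlhd> horner ds t\<^sub>0\<rbrakk> \<Longrightarrow> \<forall>c\<in>set ds. s \<unlhd> c"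
      "\<And>t. t \<in> carrier R \<Longrightarrow> horner ds t = (t \<ominus> t\<^sub>0) \<otimes> horner qs t \<oplus> horner ds t\<^sub>0"
      by (elim exE conjE) (rule that, blast+)
    define r where "r = horner ds t\<^sub>0"
    have r: "r \<in> carrier R" using cl assms by (simp add: r_def)
    have len: "length (r # qs) = length (c # ds) - 1" using qs(1) False by (cases ds) auto
    have sub: "set (r # qs) \<subseteq> carrier R" using qs(2) r by simp
    have down: "\<forall>q\<in>set (r # qs). s \<unlhd> q" if s: "s \<in> carrier R" "\<forall>c\<in>set (c # ds). s \<unlhd> c" for s
    proof -
      have "s \<unlhd> r" using le_horner[of ds t\<^sub>0 s] s cl assms(2,3) by (simp add: r_def)
      then show ?thesis using qs(3)[of s] s by simp
    qed
    have up: "\<forall>d\<in>set (c # ds). s \<unlhd> d"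
      if s: "s \<in> carrier R" "(\<forall>q\<in>set (r # qs). s \<unlhd> q) \<and> s \<unlhd> horner (c # ds) t\<^sub>0" for s
    proof -
      have "s \<unlhd> (c \<oplus> t\<^sub>0 \<otimes> r) \<ominus> t\<^sub>0 \<otimes> r"
        by (rule le_diff, use s r cl assms(2) in \<open>simp_all add: r_def\<close>)
          (rule le_mult_left, use s r cl assms(2,3) in \<open>simp_all add: r_def\<close>)
      moreover have "(c \<oplus> t\<^sub>0 \<otimes> r) \<ominus> t\<^sub>0 \<otimes> r = c"
        by (rule minus_eqI) (use r cl assms(2) in simp_all)
      ultimately have "s \<unlhd> c" by simp
      moreover have "\<forall>c\<in>set ds. s \<unlhd> c" using qs(4)[of s] s by (simp add: r_def)
      ultimately show ?thesis by simp
    qed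
    have ev: "horner (c # ds) t = (t \<ominus> t\<^sub>0) \<otimes> horner (r # qs) t \<oplus> horner (c # ds) t\<^sub>0"
      if t: "t \<in> carrier R" for t
    proof -
      define u h where "u = t \<ominus> t\<^sub>0" and "h = horner qs t"
      have u: "u \<in> carrier R" "h \<in> carrier R" "t = u \<oplus> t\<^sub>0"
        using t assms(2) qs(2) by (simp_all add: u_def h_def minus_add_same)
      have "horner (c # ds) t = c \<oplus> t \<otimes> (u \<otimes> h \<oplus> r)"
        using qs(5)[OF t] by (simp add: u_def h_def r_def)
      also have "\<dots> = c \<oplus> (t \<otimes> (u \<otimes> h) \<oplus> t \<otimes> r)"
        using cl(1) r u(1,2) t by (simp add: r_distr)
      also have "t \<otimes> r = (u \<oplus> t\<^sub>0) \<otimes> r" by (simp only: u(3)[symmetric])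
      also have "c \<oplus> (t \<otimes> (u \<otimes> h) \<oplus> (u \<oplus> t\<^sub>0) \<otimes> r) = u \<otimes> (r \<oplus> t \<otimes> h) \<oplus> (c \<oplus> t\<^sub>0 \<otimes> r)"
        using cl(1) r u(1,2) t assms(2) by (simp add: l_distr r_distr m_ac a_ac)
      finally show ?thesis
        by (simp add: u_def h_def r_def)
    qed
    show ?thesis
      using len sub down up ev by blast
  qed
qed

end

section \<open>Roots of polynomials modulo \<pi>, and generic conditions\<close>

context witt_difference begin

text \<open>After division by s the polynomial is nonzero over the residue field, hence has finitely
  many roots there. The residue field is avoided by working with roots modulo \<pi>; the induction
  splits off one root as usual.\<close>

lemma finite_residual_roots:
  assumes "set cs \<subseteq> carrier R" "s \<in> carrier R" "s \<noteq> \<zero>" "\<forall>c\<in>set cs. s \<unlhd> c" "\<exists>c\<in>set cs. c \<unlhd> s"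
  shows "\<exists>A. finite A \<and> A \<subseteq> carrier R \<and> (\<forall>t\<in>\<O>. s \<otimes> \<pi> \<unlhd> horner cs t \<longrightarrow> (\<exists>x\<in>A. \<pi> \<unlhd> t \<ominus> x))"
  using assms
proof (induction "length cs" arbitrary: cs rule: less_induct)
  case less
  note s = less.prems(2,3)
  show ?case
  proof (cases "\<exists>t\<^sub>0\<in>\<O>. s \<otimes> \<pi> \<unlhd> horner cs t\<^sub>0")
    case False
    then show ?thesis by (intro exI[of _ "{}"]) simp
  next
    case True
    then obtain t\<^sub>0 where t0: "t\<^sub>0 \<in> \<O>" "s \<otimes> \<pi> \<unlhd> horner cs t\<^sub>0" by blast
    obtain qs where qs: "length qs = length cs - 1" "set qs \<subseteq> carrier R"
        "\<And>s. s \<in> carrier R \<Longrightarrow> \<forall>c\<in>set cs. s \<unlhd> c \<Longrightarrow> \<forall>q\<in>set qs. s \<unlhd> q"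
        "\<And>s. \<lbrakk>s \<in> carrier R; \<forall>q\<in>set qs. s \<unlhd> q; s \<unlhd> horner cs t\<^sub>0\<rbrakk> \<Longrightarrow> \<forall>c\<in>set cs. s \<unlhd> c"
        "\<And>t. t \<in> carrier R \<Longrightarrow> horner cs t = (t \<ominus> t\<^sub>0) \<otimes> horner qs t \<oplus> horner cs t\<^sub>0"
      using horner_divide[OF less.prems(1) O_closed[OF t0(1)] O_le[OF t0(1)]]
      by (elim exE conjE) (rule that, blast+)
    \<comment> \<open>If all coefficients of the quotient were divisible by s \<pi>, then so would
      be those of \<open>cs\<close>, because the remainder is; but one of these has value
      v(s).\<close>
    have "\<not> (\<forall>q\<in>set qs. s \<otimes> \<pi> \<unlhd> q)"
    proof
      assume "\<forall>q\<in>set qs. s \<otimes> \<pi> \<unlhd> q"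
      then have *: "\<forall>c\<in>set cs. s \<otimes> \<pi> \<unlhd> c" using qs(4)[of "s \<otimes> \<pi>"] t0 s by simp
      obtain c where "c \<in> set cs" "c \<unlhd> s" using less.prems by blast
      then show False using not_pi_le[of s c] * s less.prems(1) by auto
    qed
    then have "\<exists>q\<in>set qs. q \<unlhd> s" using le_cases_scaled[of s] qs(2) s by blast
    moreover have "length qs < length cs" using less.prems(5) qs(1) by (cases cs) auto
    ultimately obtain A where A: "finite A" "A \<subseteq> carrier R"
        "\<And>t. \<lbrakk>t \<in> \<O>; s \<otimes> \<pi> \<unlhd> horner qs t\<rbrakk> \<Longrightarrow> \<exists>x\<in>A. \<pi> \<unlhd> t \<ominus> x"
      using less.hyps[of qs] qs(2) qs(3)[OF s(1) less.prems(4)] s by (elim meta_impE) auto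
    show ?thesis
    proof (intro exI[of _ "insert t\<^sub>0 A"] conjI ballI impI)
      fix t assume t: "t \<in> \<O>" "s \<otimes> \<pi> \<unlhd> horner cs t"
      define u h where "u = t \<ominus> t\<^sub>0" and "h = horner qs t"
      have u: "u \<in> \<O>" "h \<in> carrier R" "horner cs t\<^sub>0 \<in> carrier R" "horner cs t \<in> carrier R"
        using t t0 qs(2) less.prems(1) by (simp_all add: u_def h_def)
      from u(1) show "\<exists>x\<in>insert t\<^sub>0 A. \<pi> \<unlhd> t \<ominus> x"
      \<comment> \<open>Either t is congruent to \<open>t\<^sub>0\<close>, or the difference is a
        unit and can be cancelled, which leaves a root of the quotient modulo s \<pi>.\<close>
      proof (cases rule: O_cases)
        case 1
        then show ?thesis by (simp add: u_def)
      next
        case 2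
        have "s \<otimes> \<pi> \<unlhd> horner cs t \<ominus> horner cs t\<^sub>0" 
          by (rule le_diff) (use t t0 u s in simp_all)
        also have "horner cs t \<ominus> horner cs t\<^sub>0 = u \<otimes> h"
          by (rule minus_eqI) (use qs(5)[OF O_closed[OF t(1)]] u in \<open>simp_all flip: u_def h_def\<close>)
        finally have "s \<otimes> \<pi> \<unlhd> u \<otimes> h" .
        moreover have "u \<otimes> h \<unlhd> \<one> \<otimes> h" 
          by (rule le_mult_mono2) (use u 2 in \<open>simp_all add: veq_def le_refl\<close>)
        ultimately have "s \<otimes> \<pi> \<unlhd> h" using le_trans[of "s \<otimes> \<pi>" "u \<otimes> h" h] u s by simp
        then show ?thesis using A(3)[of t] t by (auto simp: h_def)
      qed
    qed (use A t0 in auto)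
  qed
qed

text \<open>\<open>E i y\<close> is the finite set of residues (given by representatives) that \<open>\<delta>\<^sup>i(y)\<close> has to avoid. It
  depends only on \<open>y\<close> modulo \<open>\<pi>\<^sup>i\<close>, so that later corrections of \<open>y\<close> do not change it.\<close>

definition residue_local :: "(nat \<Rightarrow> 'a \<Rightarrow> 'a set) \<Rightarrow> bool" where
  "residue_local E \<longleftrightarrow> (\<forall>i. \<forall>y\<in>\<O>. finite (E i y) \<and> E i y \<subseteq> carrier R \<and>
     (\<forall>z\<in>\<O>. E i (y \<oplus> \<pi> [^] i \<otimes> z) = E i y))"

text \<open>Comparable to containing a nonempty open set: \<open>P\<close> only has to follow from
  avoidance. This makes generic conditions stable under weakening, under larger n, and under finite
  conjunctions, where the exceptional sets are united.\<close>

definition generic :: "nat \<Rightarrow> ('a \<Rightarrow> bool) \<Rightarrow> bool" where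
  "generic n P \<longleftrightarrow> (\<exists>E. residue_local E \<and>
     (\<forall>y\<in>\<O>. (\<forall>i<n. \<forall>x\<in>E i y. \<not> \<pi> \<unlhd> (\<delta> ^^ i) y \<ominus> x) \<longrightarrow> P y))"

lemma generic_mono:
  assumes "generic n P" "n \<le> n'" "\<And>y. y \<in> \<O> \<Longrightarrow> P y \<Longrightarrow> Q y" shows "generic n' Q"
proof -
  obtain E where "residue_local E" "\<forall>y\<in>\<O>. (\<forall>i<n. \<forall>x\<in>E i y. \<not> \<pi> \<unlhd> (\<delta> ^^ i) y \<ominus> x) \<longrightarrow> P y"
    using assms(1) unfolding generic_def by blast
  then show ?thesis unfolding generic_def using assms(2,3)
    by (intro exI[of _ E]) (meson less_le_trans)
qed

lemma generic_conj:
  assumes "generic n P" "generic n Q" shows "generic n (\<lambda>y. P y \<and> Q y)"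
proof -
  obtain E where E: "residue_local E" "\<forall>y\<in>\<O>. (\<forall>i<n. \<forall>x\<in>E i y. \<not> \<pi> \<unlhd> (\<delta> ^^ i) y \<ominus> x) \<longrightarrow> P y"
    using assms(1) unfolding generic_def by blast
  obtain D where D: "residue_local D" "\<forall>y\<in>\<O>. (\<forall>i<n. \<forall>x\<in>D i y. \<not> \<pi> \<unlhd> (\<delta> ^^ i) y \<ominus> x) \<longrightarrow> Q y"
    using assms(2) unfolding generic_def by blast
  have "residue_local (\<lambda>i y. E i y \<union> D i y)"
    using E(1) D(1) unfolding residue_local_def by simp
  then show ?thesis unfolding generic_def using E(2) D(2)
    by (intro exI[of _ "\<lambda>i y. E i y \<union> D i y"]) auto
qed

lemma generic_ball:
  assumes "finite S" "\<And>g. g \<in> S \<Longrightarrow> generic n (P g)" shows "generic n (\<lambda>y. \<forall>g\<in>S. P g y)"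
  using assms
proof (induction S rule: finite_induct)
  case empty
  have "residue_local (\<lambda>_ _. {})" by (simp add: residue_local_def)
  then show ?case unfolding generic_def by auto
next
  case (insert g S)
  then show ?case using generic_conj[of n "P g" "\<lambda>y. \<forall>g\<in>S. P g y"] by simp
qed

text \<open>Controls one more coordinate. Replacing \<open>E n\<close> does not disturb
  \<open>P\<close>, whose avoidance condition concerns indices below n; the invariance of
  \<open>A\<close> is the locality that \<open>residue_local\<close> demands.\<close>

lemma generic_Suc:
  assumes "generic n P"
    and A: "\<And>y. y \<in> \<O> \<Longrightarrow> finite (A y) \<and> A y \<subseteq> carrier R"
    and A': "\<And>y z. \<lbrakk>y \<in> \<O>; z \<in> \<O>\<rbrakk> \<Longrightarrow> A (y \<oplus> \<pi> [^] n \<otimes> z) = A y"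
    and Q: "\<And>y. \<lbrakk>y \<in> \<O>; P y; \<forall>x\<in>A y. \<not> \<pi> \<unlhd> (\<delta> ^^ n) y \<ominus> x\<rbrakk> \<Longrightarrow> Q y"
  shows "generic (Suc n) Q"
proof -
  obtain E where E: "residue_local E" "\<forall>y\<in>\<O>. (\<forall>i<n. \<forall>x\<in>E i y. \<not> \<pi> \<unlhd> (\<delta> ^^ i) y \<ominus> x) \<longrightarrow> P y"
    using assms(1) unfolding generic_def by blast
  have "residue_local (E(n := A))"
    using E(1) A A' unfolding residue_local_def by auto
  moreover have "Q y" if "y \<in> \<O>" "\<forall>i<Suc n. \<forall>x\<in>(E(n := A)) i y. \<not> \<pi> \<unlhd> (\<delta> ^^ i) y \<ominus> x" for y
  proof (rule Q)
    have "\<forall>i<n. \<forall>x\<in>E i y. \<not> \<pi> \<unlhd> (\<delta> ^^ i) y \<ominus> x"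
    proof (intro allI impI)
      fix i assume "i < n"
      then show "\<forall>x\<in>E i y. \<not> \<pi> \<unlhd> (\<delta> ^^ i) y \<ominus> x" using that(2)[rule_format, of i] by auto
    qed
    then show "P y" using E(2) that(1) by blast
    show "\<forall>x\<in>A y. \<not> \<pi> \<unlhd> (\<delta> ^^ n) y \<ominus> x" using that(2)[rule_format, of n] by auto
  qed fact
  ultimately show ?thesis unfolding generic_def by blast
qed

text \<open>Pigeonhole: otherwise two of the infinitely many pairwise incongruent elements of
  \<open>B\<close> would have \<sigma>^k-images congruent to the same element of \<open>A\<close>,
  hence to each other. As \<sigma> preserves values, the two elements would be congruent
  themselves.\<close>

lemma B_avoids:
  assumes "finite A" "A \<subseteq> carrier R" shows "\<exists>z\<in>B. \<forall>x\<in>A. \<not> \<pi> \<unlhd> (\<sigma> ^^ k) z \<ominus> x"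
proof (rule ccontr)
  assume neg: "\<not> ?thesis"
  obtain Z where Z: "Z \<subseteq> B" "infinite Z" "\<And>x y. \<lbrakk>x \<in> Z; y \<in> Z; x \<noteq> y\<rbrakk> \<Longrightarrow> \<not> \<pi> \<unlhd> x \<ominus> y"
    using B_residues unfolding \<pi>_def by blast
  obtain g where g: "\<And>z. z \<in> Z \<Longrightarrow> g z \<in> A \<and> \<pi> \<unlhd> (\<sigma> ^^ k) z \<ominus> g z"
    using neg Z(1) by (metis subsetD)
  have "finite (g ` Z)" using g assms(1) by (meson finite_subset image_subsetI)
  then obtain z0 where "z0 \<in> Z" "infinite {z \<in> Z. g z = g z0}"
    using pigeonhole_infinite[OF Z(2)] by blast
  moreover have "{z \<in> Z. g z = g z0} \<subseteq> {z0}"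
  proof (rule subsetI, rule ccontr)
    fix z assume z: "z \<in> {z \<in> Z. g z = g z0}" "z \<notin> {z0}"
    have c: "z \<in> carrier R" "z0 \<in> carrier R" "g z0 \<in> carrier R"
      using z \<open>z0 \<in> Z\<close> Z(1) B_integral g assms(2) by auto
    have "\<pi> \<unlhd> (\<sigma> ^^ k) z \<ominus> g z0" "\<pi> \<unlhd> g z0 \<ominus> (\<sigma> ^^ k) z0"
      using g[of z] g[of z0] z \<open>z0 \<in> Z\<close> c le_minus_commute[of \<pi> "(\<sigma> ^^ k) z0" "g z0"] by auto
    then have "\<pi> \<unlhd> (\<sigma> ^^ k) z \<ominus> (\<sigma> ^^ k) z0"
      using le_diff_trans[of \<pi> "(\<sigma> ^^ k) z" "g z0" "(\<sigma> ^^ k) z0"] c by simp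
    then have "\<pi> \<unlhd> (\<sigma> ^^ k) (z \<ominus> z0)" using c by (simp add: sigma_pow_minus)
    then have "\<pi> \<unlhd> z \<ominus> z0"
      using sigma_pow_veq[of "z \<ominus> z0" k] le_trans[of \<pi> "(\<sigma> ^^ k) (z \<ominus> z0)" "z \<ominus> z0"] c
      by (simp add: veq_def)
    then show False using Z(3)[of z z0] z \<open>z0 \<in> Z\<close> by auto
  qed
  ultimately show False by (meson finite.emptyI finite_insert finite_subset)
qed

text \<open>Successive approximation: stage k adds \<pi>^k z, with z in \<open>B\<close> chosen so
  that \<delta>^k avoids its exceptional set. The base point d is any integral element of the big
  field; only the correction has to lie in \<open>B\<close>.\<close>

lemma generic_exists:
  assumes "generic n P" "d \<in> \<O>" shows "\<exists>m\<in>B. P (d \<oplus> m)"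
proof -
  obtain E where E: "residue_local E" "\<forall>y\<in>\<O>. (\<forall>i<n. \<forall>x\<in>E i y. \<not> \<pi> \<unlhd> (\<delta> ^^ i) y \<ominus> x) \<longrightarrow> P y"
    using assms(1) unfolding generic_def by blast
  have "\<exists>m\<in>B. \<forall>i<k. \<forall>x\<in>E i (d \<oplus> m). \<not> \<pi> \<unlhd> (\<delta> ^^ i) (d \<oplus> m) \<ominus> x" for k
  proof (induction k)
    case 0
    then show ?case using B_zero by blast
  next
    case (Suc k)
    then obtain m where m: "m \<in> B" "\<And>i x. \<lbrakk>i < k; x \<in> E i (d \<oplus> m)\<rbrakk> \<Longrightarrow> \<not> \<pi> \<unlhd> (\<delta> ^^ i) (d \<oplus> m) \<ominus> x"
      by blast
    define y where "y = d \<oplus> m"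
    have y: "y \<in> \<O>" using assms(2) m B_sub_O by (simp add: y_def)
    have Ey: "finite (E i y)" "E i y \<subseteq> carrier R" for i
      using E(1) y unfolding residue_local_def by auto
    \<comment> \<open>\<delta>^k(y + \<pi>^k z) is congruent to \<delta>^k(y) + \<sigma>^k(z), so
      avoiding x means that \<sigma>^k(z) avoids x - \<delta>^k(y).\<close>
    have "(\<lambda>x. x \<ominus> (\<delta> ^^ k) y) ` E k y \<subseteq> carrier R"
      using Ey(2)[of k] y by (auto dest: subsetD)
    then obtain z where z: "z \<in> B" "\<And>x. x \<in> E k y \<Longrightarrow> \<not> \<pi> \<unlhd> (\<sigma> ^^ k) z \<ominus> (x \<ominus> (\<delta> ^^ k) y)"
      using B_avoids[of "(\<lambda>x. x \<ominus> (\<delta> ^^ k) y) ` E k y" k] Ey[of k] y by auto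
    have zO: "z \<in> \<O>" using z B_sub_O by blast
    let ?y = "y \<oplus> \<pi> [^] k \<otimes> z"
    have y': "?y = d \<oplus> (m \<oplus> \<pi> [^] k \<otimes> z)"
      using assms(2) m B_sub_O zO by (simp add: y_def a_assoc)
    have "\<not> \<pi> \<unlhd> (\<delta> ^^ i) ?y \<ominus> x" if i: "i < Suc k" and x: "x \<in> E i ?y" for i x
    proof
      assume p: "\<pi> \<unlhd> (\<delta> ^^ i) ?y \<ominus> x"
      \<comment> \<open>Written as a multiple of \<pi>^i, the shift leaves the exceptional set of
        index i unchanged.\<close>
      have "?y = y \<oplus> \<pi> [^] i \<otimes> (\<pi> [^] (k - i) \<otimes> z)"
        using i zO by (simp add: nat_pow_mult flip: m_assoc)
      then have Eq: "E i ?y = E i y" using E(1) y zO unfolding residue_local_def by simp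
      then have xc: "x \<in> carrier R" "x \<in> E i y" using x Ey[of i] by auto
      obtain e where e: "e \<in> \<O>" "(\<delta> ^^ i) ?y = (\<delta> ^^ i) y \<oplus> \<pi> [^] (k - i) \<otimes> ((\<sigma> ^^ i) z \<oplus> \<pi> \<otimes> e)"
        using delta_pow_shift[OF y zO, of i k] i by auto
      have dO: "(\<delta> ^^ i) y \<in> \<O>" "(\<sigma> ^^ i) z \<in> \<O>" using y zO by auto
      show False
      proof (cases "i = k")
        case True
        have pe: "\<pi> \<unlhd> \<pi> \<otimes> e" using e O_le by (simp add: le_mult_right le_refl)
        have eq: "((\<delta> ^^ k) y \<oplus> ((\<sigma> ^^ k) z \<oplus> \<pi> \<otimes> e)) \<ominus> x \<ominus> \<pi> \<otimes> e = (\<sigma> ^^ k) z \<ominus> (x \<ominus> (\<delta> ^^ k) y)"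
          by (rule minus_eqI) (use xc e(1) dO True in \<open>simp_all add: a_minus_def minus_add a_ac r_neg1 r_neg2\<close>)
        have "\<pi> \<unlhd> ((\<delta> ^^ k) y \<oplus> ((\<sigma> ^^ k) z \<oplus> \<pi> \<otimes> e)) \<ominus> x \<ominus> \<pi> \<otimes> e"
          by (rule le_diff) (use p e pe xc dO True in simp_all)
        then show False using z(2)[of x] xc True unfolding eq by simp
      next
        case False
        \<comment> \<open>For i < k the change of \<delta>^i is still divisible by \<pi>, so
          avoidance is inherited from the previous stage.\<close>
        then obtain j where j: "k - i = Suc j" using i by (metis Suc_diff_Suc less_SucE)
        have r: "\<pi> [^] (k - i) \<otimes> ((\<sigma> ^^ i) z \<oplus> \<pi> \<otimes> e) = \<pi> \<otimes> (\<pi> [^] j \<otimes> ((\<sigma> ^^ i) z \<oplus> \<pi> \<otimes> e))"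
          using dO e by (simp add: j m_ac)
        define w where "w = \<pi> [^] j \<otimes> ((\<sigma> ^^ i) z \<oplus> \<pi> \<otimes> e)"
        have w: "w \<in> \<O>" using dO e by (simp add: w_def)
        have pw: "\<pi> \<unlhd> \<pi> \<otimes> w" using w O_le by (simp add: le_mult_right le_refl)
        have "\<pi> \<unlhd> (((\<delta> ^^ i) y \<oplus> \<pi> \<otimes> w) \<ominus> x) \<ominus> \<pi> \<otimes> w"
          by (rule le_diff) (use p pw xc dO w in \<open>simp_all add: e(2) r flip: w_def\<close>)
        moreover have "(((\<delta> ^^ i) y \<oplus> \<pi> \<otimes> w) \<ominus> x) \<ominus> \<pi> \<otimes> w = (\<delta> ^^ i) y \<ominus> x"
          by (rule minus_eqI) (use xc dO w in \<open>simp_all add: a_minus_def a_ac r_neg1 r_neg2\<close>)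
        ultimately have "\<pi> \<unlhd> (\<delta> ^^ i) y \<ominus> x" by simp
        then show False using m(2)[of i x] xc False i by (simp add: y_def)
      qed
    qed
    moreover have "m \<oplus> \<pi> [^] k \<otimes> z \<in> B" using B_shift m z by (simp add: \<pi>_def)
    ultimately show ?case unfolding y' by (intro bexI[of _ "m \<oplus> \<pi> [^] k \<otimes> z"]) blast
  qed
  from this[of n] show ?thesis using E(2) assms(2) B_sub_O by (meson O_add)
qed

end

section \<open>\<open>\<sigma>\<close>-polynomial functions\<close>

text \<open>Polynomials in one distinguished function \<open>T\<close> over a ring of coefficient
  functions \<open>A\<close>. Used twice: with \<open>T\<close> = \<delta>^n and coefficients of
  lower order, and with \<open>T\<close> the parameter t in the expansion of G(x + t y).\<close>

locale horner_functions = cring R for R (structure) +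
  fixes Z :: "'z set" and T :: "'z \<Rightarrow> 'a" and A :: "('z \<Rightarrow> 'a) \<Rightarrow> bool"
  assumes T_closed [simp]: "z \<in> Z \<Longrightarrow> T z \<in> carrier R"
    and A_closed: "\<lbrakk>A c; z \<in> Z\<rbrakk> \<Longrightarrow> c z \<in> carrier R"
    and A_zero: "A (\<lambda>_. \<zero>)"
    and A_add: "\<lbrakk>A c; A d\<rbrakk> \<Longrightarrow> A (\<lambda>z. c z \<oplus> d z)"
    and A_mult: "\<lbrakk>A c; A d\<rbrakk> \<Longrightarrow> A (\<lambda>z. c z \<otimes> d z)"
begin

definition hval :: "('z \<Rightarrow> 'a) list \<Rightarrow> 'z \<Rightarrow> 'a" where
  "hval cs z = horner (map (\<lambda>c. c z) cs) (T z)"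

lemma hval_Nil [simp]: "hval [] z = \<zero>"
  and hval_Cons [simp]: "hval (c # cs) z = c z \<oplus> T z \<otimes> hval cs z"
  by (simp_all add: hval_def)

lemma hval_closed [simp]: "\<lbrakk>\<forall>c\<in>set cs. A c; z \<in> Z\<rbrakk> \<Longrightarrow> hval cs z \<in> carrier R"
  by (induction cs) (auto intro: A_closed)

fun hadd :: "('z \<Rightarrow> 'a) list \<Rightarrow> ('z \<Rightarrow> 'a) list \<Rightarrow> ('z \<Rightarrow> 'a) list" where
  "hadd [] ds = ds"
| "hadd cs [] = cs"
| "hadd (c # cs) (d # ds) = (\<lambda>z. c z \<oplus> d z) # hadd cs ds"

lemma hadd_A: "\<lbrakk>\<forall>c\<in>set cs. A c; \<forall>d\<in>set ds. A d\<rbrakk> \<Longrightarrow> \<forall>e\<in>set (hadd cs ds). A e"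
  by (induction cs ds rule: hadd.induct) (auto intro: A_add)

lemma hval_hadd:
  "\<lbrakk>\<forall>c\<in>set cs. A c; \<forall>d\<in>set ds. A d; z \<in> Z\<rbrakk> \<Longrightarrow> hval (hadd cs ds) z = hval cs z \<oplus> hval ds z"
proof (induction cs ds rule: hadd.induct)
  case (3 c cs d ds)
  then show ?case by (simp add: A_closed r_distr a_ac)
qed (simp_all add: A_closed)

lemma length_hadd [simp]: "length (hadd cs ds) = max (length cs) (length ds)"
  by (induction cs ds rule: hadd.induct) auto

lemma hadd_eq_Nil [simp]: "hadd cs ds = [] \<longleftrightarrow> cs = [] \<and> ds = []"
  by (cases "(cs, ds)" rule: hadd.cases) auto

text \<open>No cancellation can occur at the top; this serves to follow a leading
  coefficient.\<close>

lemma last_hadd: "length ds < length cs \<Longrightarrow> last (hadd cs ds) = last cs"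
proof (induction cs ds rule: hadd.induct)
  case (3 c cs d ds)
  then show ?case by (cases cs) auto
qed auto

definition hscale :: "('z \<Rightarrow> 'a) \<Rightarrow> ('z \<Rightarrow> 'a) list \<Rightarrow> ('z \<Rightarrow> 'a) list" where
  "hscale a cs = map (\<lambda>c z. a z \<otimes> c z) cs"

lemma hscale_A: "\<lbrakk>A a; \<forall>c\<in>set cs. A c\<rbrakk> \<Longrightarrow> \<forall>c\<in>set (hscale a cs). A c"
  by (auto simp: hscale_def intro: A_mult)

lemma hval_hscale: "\<lbrakk>A a; \<forall>c\<in>set cs. A c; z \<in> Z\<rbrakk> \<Longrightarrow> hval (hscale a cs) z = a z \<otimes> hval cs z"
  by (induction cs) (simp_all add: hscale_def A_closed r_distr m_lcomm)

primrec hmult :: "('z \<Rightarrow> 'a) list \<Rightarrow> ('z \<Rightarrow> 'a) list \<Rightarrow> ('z \<Rightarrow> 'a) list" where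
  "hmult [] ds = []"
| "hmult (c # cs) ds = hadd (hscale c ds) ((\<lambda>_. \<zero>) # hmult cs ds)"

lemma hmult_A: "\<lbrakk>\<forall>c\<in>set cs. A c; \<forall>d\<in>set ds. A d\<rbrakk> \<Longrightarrow> \<forall>e\<in>set (hmult cs ds). A e"
proof (induction cs)
  case (Cons c cs)
  have "\<forall>e\<in>set (hadd (hscale c ds) ((\<lambda>_. \<zero>) # hmult cs ds)). A e"
    by (rule hadd_A) (use Cons A_zero hscale_A[of c ds] in auto)
  then show ?case by simp
qed simp

lemma hval_hmult:
  "\<lbrakk>\<forall>c\<in>set cs. A c; \<forall>d\<in>set ds. A d; z \<in> Z\<rbrakk> \<Longrightarrow> hval (hmult cs ds) z = hval cs z \<otimes> hval ds z"
proof (induction cs)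
  case (Cons c cs)
  have c: "A c" "\<forall>c\<in>set cs. A c" and d: "\<forall>d\<in>set ds. A d" using Cons.prems by auto
  have "\<forall>e\<in>set ((\<lambda>_. \<zero>) # hmult cs ds). A e" using hmult_A[OF c(2) d] A_zero by simp
  from hval_hadd[OF hscale_A[OF c(1) d] this Cons.prems(3)]
  have "hval (hmult (c # cs) ds) z = hval (hscale c ds) z \<oplus> T z \<otimes> hval (hmult cs ds) z"
    using hval_closed[OF hmult_A[OF c(2) d] Cons.prems(3)] Cons.prems(3) by simp
  with Cons show ?case using hval_closed[OF c(2) Cons.prems(3)] hval_closed[OF d Cons.prems(3)] A_closed[OF c(1) Cons.prems(3)]
    by (simp add: hval_hscale[OF c(1) d Cons.prems(3)] l_distr m_assoc)
qed simp

definition representable :: "('z \<Rightarrow> 'a) \<Rightarrow> bool" where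
  "representable F \<longleftrightarrow> (\<exists>cs. (\<forall>c\<in>set cs. A c) \<and> (\<forall>z\<in>Z. F z = hval cs z))"

lemma representableI: "\<lbrakk>\<forall>c\<in>set cs. A c; \<And>z. z \<in> Z \<Longrightarrow> F z = hval cs z\<rbrakk> \<Longrightarrow> representable F"
  unfolding representable_def by blast

lemma representable_add: "\<lbrakk>representable F; representable G\<rbrakk> \<Longrightarrow> representable (\<lambda>z. F z \<oplus> G z)"
  unfolding representable_def using hval_hadd hadd_A by metis

lemma representable_mult: "\<lbrakk>representable F; representable G\<rbrakk> \<Longrightarrow> representable (\<lambda>z. F z \<otimes> G z)"
  unfolding representable_def using hval_hmult hmult_A by metis

lemma representable_coeff: "A c \<Longrightarrow> representable c"
  by (rule representableI[of "[c]"]) (auto simp: A_closed)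

end

section \<open>Polynomial functions in y, \<sigma>(y), \<sigma>^2(y), ... and their generic
  values\<close>

context witt_difference begin

interpretation \<sigma>: ring_hom_ring R R \<sigma> by (rule sigma_ring_hom)

text \<open>Polynomials are taken as functions on \<open>\<O>\<close>, and \<open>sfun_cong\<close>
  forgets what happens elsewhere. Since \<pi> is invertible in the field, the same class arises from
  y, \<delta>(y), ..., \<delta>^(n-1)(y).\<close>

inductive sfun :: "nat \<Rightarrow> ('a \<Rightarrow> 'a) \<Rightarrow> bool" for n where
  sfun_const: "c \<in> carrier R \<Longrightarrow> sfun n (\<lambda>_. c)"
| sfun_sigma_pow: "i < n \<Longrightarrow> sfun n (\<lambda>y. (\<sigma> ^^ i) y)"
| sfun_add: "\<lbrakk>sfun n F; sfun n G\<rbrakk> \<Longrightarrow> sfun n (\<lambda>y. F y \<oplus> G y)"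
| sfun_mult: "\<lbrakk>sfun n F; sfun n G\<rbrakk> \<Longrightarrow> sfun n (\<lambda>y. F y \<otimes> G y)"
| sfun_cong: "\<lbrakk>sfun n F; \<And>y. y \<in> \<O> \<Longrightarrow> F' y = F y\<rbrakk> \<Longrightarrow> sfun n F'"

lemma sfun_closed: "\<lbrakk>sfun n F; y \<in> \<O>\<rbrakk> \<Longrightarrow> F y \<in> carrier R"
  by (induction rule: sfun.induct) auto

lemma sfun_mono: "\<lbrakk>sfun n F; n \<le> n'\<rbrakk> \<Longrightarrow> sfun n' F"
  by (induction rule: sfun.induct) (auto intro: sfun.intros)

lemma sfun_pow: "sfun n F \<Longrightarrow> sfun n (\<lambda>y. F y [^] (k::nat))"
  by (induction k) (auto intro: sfun_const sfun_mult)

lemma sfun_sigma: "sfun n F \<Longrightarrow> sfun (Suc n) (\<lambda>y. \<sigma> (F y))"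
proof (induction rule: sfun.induct)
  case (sfun_sigma_pow i)
  then show ?case using sfun.sfun_sigma_pow[of "Suc i" "Suc n"] by simp
next
  case (sfun_add F G)
  then show ?case by (intro sfun_cong[OF sfun.sfun_add[OF sfun_add.IH]]) (simp add: sfun_closed)
next
  case (sfun_mult F G)
  then show ?case by (intro sfun_cong[OF sfun.sfun_mult[OF sfun_mult.IH]]) (simp add: sfun_closed)
next
  case (sfun_cong F F')
  then show ?case by (intro sfun.sfun_cong[OF sfun_cong.IH]) simp
qed (simp add: sfun_const)

text \<open>Triangular change of variables between the powers of \<sigma> and those of \<delta>.
  Applying \<sigma> to the equation for n turns \<delta>^n(y) into \<pi> \<delta>^(n+1)(y) +
  \<delta>^n(y)^p, and the second summand goes into the remainder.\<close>

lemma sigma_pow_eq_delta_pow: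
  "\<exists>Q. sfun n Q \<and> (\<forall>y\<in>\<O>. (\<sigma> ^^ n) y = \<pi> [^] n \<otimes> (\<delta> ^^ n) y \<oplus> Q y)"
proof (induction n)
  case 0
  then show ?case by (intro exI[of _ "\<lambda>_. \<zero>"]) (simp add: sfun_const)
next
  case (Suc n)
  then obtain Q where Q: "sfun n Q" "\<And>y. y \<in> \<O> \<Longrightarrow> (\<sigma> ^^ n) y = \<pi> [^] n \<otimes> (\<delta> ^^ n) y \<oplus> Q y"
    by blast
  note Qc = sfun_closed[OF Q(1)]
  have u: "\<pi> [^] n \<in> Units R" using pi_unit by (induction n) simp_all
  \<comment> \<open>The equation for n, solved for \<delta>^n(y), shows that \<delta>^n is itself a
    polynomial function.\<close>
  have d: "sfun (Suc n) (\<delta> ^^ n)"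
  proof (rule sfun_cong)
    show "sfun (Suc n) (\<lambda>y. inv (\<pi> [^] n) \<otimes> ((\<sigma> ^^ n) y \<oplus> \<ominus> \<one> \<otimes> Q y))"
      using u by (intro sfun_mult sfun_add sfun_const sfun_sigma_pow sfun_mono[OF Q(1)]) auto
    fix y assume y: "y \<in> \<O>"
    have "(\<sigma> ^^ n) y \<oplus> \<ominus> \<one> \<otimes> Q y = \<pi> [^] n \<otimes> (\<delta> ^^ n) y"
      using Q(2)[OF y] Qc[OF y] y by (simp add: l_minus a_assoc r_neg)
    then show "(\<delta> ^^ n) y = inv (\<pi> [^] n) \<otimes> ((\<sigma> ^^ n) y \<oplus> \<ominus> \<one> \<otimes> Q y)"
      using u y by (simp flip: m_assoc)
  qed
  show ?case
  proof (intro exI[of _ "\<lambda>y. \<pi> [^] n \<otimes> (\<delta> ^^ n) y [^] p \<oplus> \<sigma> (Q y)"] conjI ballI)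
    show "sfun (Suc n) (\<lambda>y. \<pi> [^] n \<otimes> (\<delta> ^^ n) y [^] p \<oplus> \<sigma> (Q y))"
      using Q d by (intro sfun_add sfun_mult sfun_const sfun_pow sfun_sigma) auto
    fix y assume y: "y \<in> \<O>"
    have "(\<sigma> ^^ Suc n) y = \<pi> [^] n \<otimes> \<sigma> ((\<delta> ^^ n) y) \<oplus> \<sigma> (Q y)"
      using Q(2)[OF y] Qc[OF y] y by (simp add: \<sigma>.hom_nat_pow)
    also have "\<sigma> ((\<delta> ^^ n) y) = \<pi> \<otimes> (\<delta> ^^ Suc n) y \<oplus> (\<delta> ^^ n) y [^] p"
      using sigma_eq_delta[of "(\<delta> ^^ n) y"] y by simp
    finally show "(\<sigma> ^^ Suc n) y = \<pi> [^] Suc n \<otimes> (\<delta> ^^ Suc n) y \<oplus> (\<pi> [^] n \<otimes> (\<delta> ^^ n) y [^] p \<oplus> \<sigma> (Q y))"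
      using Qc[OF y] y by (simp add: r_distr m_assoc a_assoc)
  qed
qed

lemma horner_functions_sfun: "horner_functions R \<O> (\<delta> ^^ n) (sfun n)"
  by unfold_locales (auto intro: sfun_closed sfun_const sfun_add sfun_mult)

text \<open>Eliminating \<sigma>^n(y) in favour of \<delta>^n(y) presents F as a polynomial in
  \<delta>^n(y) whose coefficients have lower order.\<close>

lemma sfun_Suc_horner:
  assumes "sfun (Suc n) F"
  shows "\<exists>cs. (\<forall>c\<in>set cs. sfun n c) \<and> (\<forall>y\<in>\<O>. F y = horner (map (\<lambda>c. c y) cs) ((\<delta> ^^ n) y))"
proof -
  interpret H: horner_functions R \<O> "\<delta> ^^ n" "sfun n" by (rule horner_functions_sfun)
  have "H.representable F"
    using assms
  proof (induction rule: sfun.induct)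
    case (sfun_const c)
    then show ?case by (intro H.representable_coeff sfun.sfun_const)
  next
    case (sfun_sigma_pow i)
    show ?case
    proof (cases "i = n")
      case False
      then show ?thesis using sfun_sigma_pow by (intro H.representable_coeff sfun.sfun_sigma_pow) simp
    next
      case True
      obtain Q where Q: "sfun n Q" "\<And>y. y \<in> \<O> \<Longrightarrow> (\<sigma> ^^ n) y = \<pi> [^] n \<otimes> (\<delta> ^^ n) y \<oplus> Q y"
        using sigma_pow_eq_delta_pow by blast
      show ?thesis
      proof (rule H.representableI[of "[Q, \<lambda>_. \<pi> [^] n]"])
        show "\<forall>c\<in>set [Q, \<lambda>_. \<pi> [^] n]. sfun n c" using Q by (simp add: sfun_const)
        fix y assume y: "y \<in> \<O>"
        then show "(\<sigma> ^^ i) y = H.hval [Q, \<lambda>_. \<pi> [^] n] y"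
          using Q(2)[OF y] sfun_closed[OF Q(1) y] True by (simp add: m_comm a_comm)
      qed
    qed
  next
    case (sfun_cong F F')
    then show ?case by (simp add: H.representable_def)
  qed (simp_all add: H.representable_add H.representable_mult)
  then show ?thesis by (simp add: H.representable_def H.hval_def)
qed

text \<open>The values of F may all exceed v(s), and F may even vanish: only in this weak form can
  all coefficients of a polynomial share one s. The second clause makes exceptional sets computed
  from F modulo s \<pi> fit for \<open>residue_local\<close>.\<close>

definition wscaled :: "nat \<Rightarrow> ('a \<Rightarrow> 'a) \<Rightarrow> 'a \<Rightarrow> bool" where
  "wscaled n F s \<longleftrightarrow> (\<forall>y\<in>\<O>. s \<unlhd> F y \<and> (\<forall>z\<in>\<O>. s \<otimes> \<pi> \<unlhd> F (y \<oplus> \<pi> [^] n \<otimes> z) \<ominus> F y))"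

text \<open>Now v(s) is the value that F takes at generic points, hence the minimum of its
  values.\<close>

definition scaled :: "nat \<Rightarrow> ('a \<Rightarrow> 'a) \<Rightarrow> 'a \<Rightarrow> bool" where
  "scaled n F s \<longleftrightarrow> s \<in> carrier R \<and> s \<noteq> \<zero> \<and> wscaled n F s \<and> generic n (\<lambda>y. F y \<unlhd> s)"

lemma wscaled_zero: "\<lbrakk>s \<in> carrier R; \<forall>y\<in>\<O>. F y = \<zero>\<rbrakk> \<Longrightarrow> wscaled n F s"
  by (simp add: wscaled_def le_zero a_minus_def)

lemma wscaled_mono:
  assumes "wscaled n F s" "s \<in> carrier R" "s' \<in> carrier R" "s' \<unlhd> s" "sfun n F"
  shows "wscaled n F s'"
  unfolding wscaled_def
proof (intro ballI conjI)
  fix y assume y: "y \<in> \<O>"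
  then show "s' \<unlhd> F y" using assms le_trans[of s' s "F y"] sfun_closed[of n F y] by (simp add: wscaled_def)
  fix z assume z: "z \<in> \<O>"
  have "s' \<otimes> \<pi> \<unlhd> s \<otimes> \<pi>" using assms le_mult_mono2[of s' s \<pi> \<pi>] le_refl by simp
  moreover have "s \<otimes> \<pi> \<unlhd> F (y \<oplus> \<pi> [^] n \<otimes> z) \<ominus> F y" using assms(1) y z by (simp add: wscaled_def)
  ultimately show "s' \<otimes> \<pi> \<unlhd> F (y \<oplus> \<pi> [^] n \<otimes> z) \<ominus> F y"
    using le_trans[of "s' \<otimes> \<pi>" "s \<otimes> \<pi>" "F (y \<oplus> \<pi> [^] n \<otimes> z) \<ominus> F y"] y z assms
      sfun_closed[of n F y] sfun_closed[of n F "y \<oplus> \<pi> [^] n \<otimes> z"] by simp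
qed

text \<open>The least of the scales of the nonzero coefficients serves for all of them, and
  \<open>c\<^sub>0\<close> is a coefficient that it belongs to.\<close>

lemma common_scale:
  assumes "\<forall>c\<in>set cs. sfun n c \<and> ((\<forall>y\<in>\<O>. c y = \<zero>) \<or> (\<exists>s. scaled n c s))"
  shows "(\<forall>c\<in>set cs. \<forall>y\<in>\<O>. c y = \<zero>) \<or>
    (\<exists>s. \<exists>c\<^sub>0\<in>set cs. scaled n c\<^sub>0 s \<and> (\<forall>c\<in>set cs. wscaled n c s))"
  using assms
proof (induction cs)
  case (Cons c cs)
  have c: "sfun n c" "\<And>d. d \<in> set cs \<Longrightarrow> sfun n d" using Cons.prems by auto
  from Cons consider "\<forall>c\<in>set cs. \<forall>y\<in>\<O>. c y = \<zero>"
    | s c\<^sub>0 where "c\<^sub>0 \<in> set cs" "scaled n c\<^sub>0 s" "\<forall>c\<in>set cs. wscaled n c s" by auto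
  then show ?case
  proof cases
    case 1
    show ?thesis
    proof (cases "\<forall>y\<in>\<O>. c y = \<zero>")
      case False
      then obtain s where "scaled n c s" using Cons.prems by auto
      then show ?thesis using 1 wscaled_zero[of s] by (auto simp: scaled_def)
    qed (use 1 in auto)
  next
    case (2 s c\<^sub>0)
    then have s: "s \<in> carrier R" by (simp add: scaled_def)
    show ?thesis
    proof (cases "\<forall>y\<in>\<O>. c y = \<zero>")
      case True
      then show ?thesis using 2 wscaled_zero[OF s True] by auto
    next
      case False
      then obtain s' where s': "scaled n c s'" using Cons.prems by auto
      then have s'': "s' \<in> carrier R" "wscaled n c s'" by (auto simp: scaled_def)
      show ?thesis
      proof (cases "s \<unlhd> s'")
        case True
        then show ?thesis using 2 wscaled_mono[OF s''(2,1) s True c(1)] by auto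
      next
        case False
        then have "s' \<unlhd> s" using le_total s s'' by blast
        then have "\<forall>d\<in>set cs. wscaled n d s'" using 2(3) wscaled_mono s s''(1) c(2) by blast
        then show ?thesis using s' s'' by auto
      qed
    qed
  qed
qed simp

text \<open>Continuity of polynomials whose coefficients are bounded below by s, from t' h' - t h =
  t' (h' - h) + h (t' - t): in the first summand the congruence of the coefficients supplies s
  \<pi>, in the second s comes from h and \<pi> from the arguments.\<close>

lemma horner_diff_le:
  assumes "s \<in> carrier R" "t \<in> \<O>" "t' \<in> \<O>" "\<pi> \<unlhd> t' \<ominus> t"
    and "\<forall>c\<in>set cs. c y \<in> carrier R \<and> c y' \<in> carrier R \<and> s \<unlhd> c y \<and> s \<otimes> \<pi> \<unlhd> c y' \<ominus> c y"
  shows "s \<otimes> \<pi> \<unlhd> horner (map (\<lambda>c. c y') cs) t' \<ominus> horner (map (\<lambda>c. c y) cs) t"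
  using assms(5)
proof (induction cs)
  case Nil
  then show ?case using assms by (simp add: le_zero a_minus_def)
next
  case (Cons c cs)
  define h h' where "h = horner (map (\<lambda>c. c y) cs) t" and "h' = horner (map (\<lambda>c. c y') cs) t'"
  have h: "h \<in> carrier R" "h' \<in> carrier R"
    unfolding h_def h'_def by (rule horner_closed, use Cons.prems assms in auto)+
  have c: "c y \<in> carrier R" "c y' \<in> carrier R" "s \<otimes> \<pi> \<unlhd> c y' \<ominus> c y" using Cons.prems by auto
  have sh: "s \<unlhd> h" unfolding h_def by (rule le_horner) (use Cons.prems assms O_le in auto)
  have 1: "s \<otimes> \<pi> \<unlhd> h' \<ominus> h" using Cons by (simp add: h_def h'_def)
  define a b u where "a = c y' \<ominus> c y" and "b = h' \<ominus> h" and "u = t' \<ominus> t"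
  have abu: "a \<in> carrier R" "b \<in> carrier R" "u \<in> carrier R" using c h assms by (auto simp: a_def b_def u_def)
  have e: "c y' = a \<oplus> c y" "h' = b \<oplus> h" "t' = u \<oplus> t"
    using c h assms by (simp_all add: a_def b_def u_def minus_add_same)
  have "(c y' \<oplus> t' \<otimes> h') \<ominus> (c y \<oplus> t \<otimes> h) = (a \<oplus> t' \<otimes> b) \<oplus> h \<otimes> u"
  proof (rule minus_eqI)
    have "c y' \<oplus> t' \<otimes> h' = (a \<oplus> c y) \<oplus> (t' \<otimes> b \<oplus> t' \<otimes> h)"
      using e(1,2) abu h assms(3) by (simp add: r_distr)
    also have "t' \<otimes> h = u \<otimes> h \<oplus> t \<otimes> h" using abu h assms(2) by (simp add: e(3) l_distr)
    finally show "c y' \<oplus> t' \<otimes> h' = a \<oplus> t' \<otimes> b \<oplus> h \<otimes> u \<oplus> (c y \<oplus> t \<otimes> h)"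
      using abu c h assms(2,3) by (simp add: a_ac m_ac)
  qed (use abu c h assms in simp_all)
  moreover have "s \<otimes> \<pi> \<unlhd> t' \<otimes> b"
    by (rule le_mult_left) (use 1 abu assms O_le[OF assms(3)] in \<open>simp_all add: b_def\<close>)
  moreover have "s \<otimes> \<pi> \<unlhd> h \<otimes> u"
    by (rule le_mult_mono2) (use sh h abu assms in \<open>simp_all add: u_def\<close>)
  ultimately have "s \<otimes> \<pi> \<unlhd> (c y' \<oplus> t' \<otimes> h') \<ominus> (c y \<oplus> t \<otimes> h)"
    using abu h c(3) assms by (simp add: le_add a_def)
  then show ?case by (simp add: h_def h'_def)
qed

lemma delta_pow_diff:
  assumes "y \<in> \<O>" "z \<in> \<O>" "j \<le> i" shows "\<pi> \<unlhd> (\<delta> ^^ j) (y \<oplus> \<pi> [^] Suc i \<otimes> z) \<ominus> (\<delta> ^^ j) y"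
proof -
  obtain e where e: "e \<in> \<O>" "(\<delta> ^^ j) (y \<oplus> \<pi> [^] Suc i \<otimes> z) = (\<delta> ^^ j) y \<oplus> \<pi> [^] (Suc i - j) \<otimes> ((\<sigma> ^^ j) z \<oplus> \<pi> \<otimes> e)"
    using delta_pow_shift[of y z j "Suc i"] assms by auto
  define w where "w = \<pi> [^] (i - j) \<otimes> ((\<sigma> ^^ j) z \<oplus> \<pi> \<otimes> e)"
  have w: "w \<in> \<O>" using e assms by (simp add: w_def)
  have "\<pi> [^] (Suc i - j) \<otimes> ((\<sigma> ^^ j) z \<oplus> \<pi> \<otimes> e) = \<pi> \<otimes> w"
    using e assms by (simp add: w_def Suc_diff_le m_ac)
  then have "(\<delta> ^^ j) (y \<oplus> \<pi> [^] Suc i \<otimes> z) \<ominus> (\<delta> ^^ j) y = \<pi> \<otimes> w"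
    unfolding e(2) by (intro minus_eqI) (use w assms in \<open>simp_all add: a_comm\<close>)
  then show ?thesis using w O_le[OF w] by (simp add: le_mult_right le_refl)
qed

text \<open>Where \<open>c\<^sub>0\<close> attains v(s), the coefficients divided by s form a
  nonzero polynomial over the residue field. Its finitely many roots are the residues that
  \<delta>^n(y) must avoid for F to attain v(s) as well.\<close>

lemma horner_scaled:
  assumes cs: "\<forall>c\<in>set cs. sfun n c \<and> wscaled n c s" and c0: "c\<^sub>0 \<in> set cs" "scaled n c\<^sub>0 s"
    and F: "\<forall>y\<in>\<O>. F y = horner (map (\<lambda>c. c y) cs) ((\<delta> ^^ n) y)"
  shows "scaled (Suc n) F s"
proof -
  have s: "s \<in> carrier R" "s \<noteq> \<zero>" using c0 by (auto simp: scaled_def)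
  have cc: "\<forall>c\<in>set cs. c y \<in> carrier R \<and> s \<unlhd> c y" if "y \<in> \<O>" for y
    using cs that sfun_closed unfolding wscaled_def by blast
  have cd: "s \<otimes> \<pi> \<unlhd> c (y \<oplus> \<pi> [^] n \<otimes> z) \<ominus> c y" if "c \<in> set cs" "y \<in> \<O>" "z \<in> \<O>" for c y z
    using cs that by (auto simp: wscaled_def)
  define h where "h y t = horner (map (\<lambda>c. c y) cs) t" for y t
  have hc: "h y t \<in> carrier R" if "y \<in> \<O>" "t \<in> \<O>" for y t
    unfolding h_def by (rule horner_closed) (use cc[OF that(1)] that in auto)
  have inv: "s \<otimes> \<pi> \<unlhd> h (y \<oplus> \<pi> [^] n \<otimes> z) t \<longleftrightarrow> s \<otimes> \<pi> \<unlhd> h y t"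
    if "y \<in> \<O>" "z \<in> \<O>" "t \<in> \<O>" for y z t
  proof -
    have d: "s \<otimes> \<pi> \<unlhd> h (y \<oplus> \<pi> [^] n \<otimes> z) t \<ominus> h y t" unfolding h_def
      by (rule horner_diff_le) (use s that cc[of y] cc[of "y \<oplus> \<pi> [^] n \<otimes> z"] cd[OF _ that(1,2)]
        in \<open>simp_all add: a_minus_def r_neg le_zero\<close>)
    define a b where "a = h (y \<oplus> \<pi> [^] n \<otimes> z) t" and "b = h y t"
    have ab: "a \<in> carrier R" "b \<in> carrier R" using hc that by (auto simp: a_def b_def)
    have "a = (a \<ominus> b) \<oplus> b" "b = a \<ominus> (a \<ominus> b)"
      using ab by (simp add: minus_add_same, intro minus_eqI[symmetric]) (simp_all add: minus_add_same a_comm[of b])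
    then show ?thesis using d ab s le_add[of "s \<otimes> \<pi>" "a \<ominus> b" b] le_diff[of "s \<otimes> \<pi>" a "a \<ominus> b"]
      unfolding a_def[symmetric] b_def[symmetric] by auto
  qed
  define good where "good y A \<longleftrightarrow> finite A \<and> A \<subseteq> carrier R \<and>
    (\<forall>t\<in>\<O>. s \<otimes> \<pi> \<unlhd> h y t \<longrightarrow> (\<exists>x\<in>A. \<pi> \<unlhd> t \<ominus> x))" for y A
  have good_inv: "good (y \<oplus> \<pi> [^] n \<otimes> z) = good y" if "y \<in> \<O>" "z \<in> \<O>" for y z
    unfolding good_def by (intro ext) (simp add: inv[OF that] cong: ball_cong)
  \<comment> \<open>\<open>good\<close> is the same predicate at y and at y + \<pi>^n z, so
    \<open>SOME\<close> picks the same set; this is the invariance demanded by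
    \<open>generic_Suc\<close>. Where no good set exists, the empty set keeps \<open>A y\<close>
    finite.\<close>
  define A where "A y = (if \<exists>A. good y A then SOME A. good y A else {})" for y
  have A: "good y (A y)" if "\<exists>A. good y A" for y using that someI_ex[OF that] by (simp add: A_def)
  have "generic (Suc n) (\<lambda>y. F y \<unlhd> s)"
  proof (rule generic_Suc[where A = A and P = "\<lambda>y. c\<^sub>0 y \<unlhd> s"])
    show "generic n (\<lambda>y. c\<^sub>0 y \<unlhd> s)" using c0 by (simp add: scaled_def)
    show "finite (A y) \<and> A y \<subseteq> carrier R" for y
    proof (cases "\<exists>A. good y A")
      case True
      then show ?thesis using A[OF True] unfolding good_def by blast
    next
      case False
      then have "A y = {}" unfolding A_def by (rule if_not_P)
      then show ?thesis by simp
    qed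
    show "A (y \<oplus> \<pi> [^] n \<otimes> z) = A y" if "y \<in> \<O>" "z \<in> \<O>" for y z
      unfolding A_def good_inv[OF that] ..
    fix y assume y: "y \<in> \<O>" "c\<^sub>0 y \<unlhd> s" "\<forall>x\<in>A y. \<not> \<pi> \<unlhd> (\<delta> ^^ n) y \<ominus> x"
    have "set (map (\<lambda>c. c y) cs) \<subseteq> carrier R" "\<forall>a\<in>set (map (\<lambda>c. c y) cs). s \<unlhd> a"
      using cc[OF y(1)] by auto
    moreover have "\<exists>a\<in>set (map (\<lambda>c. c y) cs). a \<unlhd> s"
      by (rule bexI[of _ "c\<^sub>0 y"]) (use y(2) c0(1) in simp_all)
    ultimately have "\<exists>A. good y A"
      unfolding good_def h_def using s by (intro finite_residual_roots)
    then have "good y (A y)" by (rule A)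
    then have "\<not> s \<otimes> \<pi> \<unlhd> h y ((\<delta> ^^ n) y)" using y by (auto simp: good_def)
    then show "F y \<unlhd> s" using F y(1) s le_cases_scaled[of s "F y"] hc[of y "(\<delta> ^^ n) y"] by (auto simp: h_def)
  qed
  moreover have "wscaled (Suc n) F s"
    unfolding wscaled_def
  proof (intro ballI conjI)
    fix y assume y: "y \<in> \<O>"
    have "s \<unlhd> h y ((\<delta> ^^ n) y)"
      unfolding h_def by (rule le_horner) (use s y cc[OF y] O_le[OF delta_pow_O[OF y]] in auto)
    then show "s \<unlhd> F y" using F y by (simp add: h_def)
    fix z assume z: "z \<in> \<O>"
    let ?y = "y \<oplus> \<pi> [^] Suc n \<otimes> z"
    have y': "?y = y \<oplus> \<pi> [^] n \<otimes> (\<pi> \<otimes> z)" using z y by (simp add: m_assoc)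
    have "s \<otimes> \<pi> \<unlhd> h ?y ((\<delta> ^^ n) ?y) \<ominus> h y ((\<delta> ^^ n) y)"
      unfolding h_def
    proof (rule horner_diff_le)
      show "\<pi> \<unlhd> (\<delta> ^^ n) ?y \<ominus> (\<delta> ^^ n) y" using delta_pow_diff[OF y z order_refl] .
      have "?y \<in> \<O>" using y z by simp
      moreover have "s \<otimes> \<pi> \<unlhd> c ?y \<ominus> c y" if "c \<in> set cs" for c
        using cd[OF that y, of "\<pi> \<otimes> z"] z by (simp only: y') simp
      ultimately show "\<forall>c\<in>set cs. c y \<in> carrier R \<and> c ?y \<in> carrier R \<and> s \<unlhd> c y \<and> s \<otimes> \<pi> \<unlhd> c ?y \<ominus> c y"
        using cc y by blast
    qed (use s y z in \<open>simp_all del: nat_pow_Suc\<close>)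
    moreover have "?y \<in> \<O>" using y z by simp
    ultimately show "s \<otimes> \<pi> \<unlhd> F ?y \<ominus> F y" using F y by (simp add: h_def del: nat_pow_Suc)
  qed
  ultimately show ?thesis using s by (simp add: scaled_def)
qed

text \<open>A function of order 0 is constant and, if nonzero, is its own scale. In the step F is a
  polynomial in \<delta>^n(y) whose coefficients have scales by induction, and the least of these is
  a scale of F.\<close>

theorem sfun_scaled:
  "sfun n F \<Longrightarrow> (\<forall>y\<in>\<O>. F y = \<zero>) \<or> (\<exists>s. scaled n F s)"
proof (induction n arbitrary: F)
  case 0
  then have "\<exists>c\<in>carrier R. \<forall>y\<in>\<O>. F y = c"
    by (induction rule: sfun.induct) auto
  then obtain c where c: "c \<in> carrier R" "\<forall>y\<in>\<O>. F y = c" by blast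
  have "generic 0 (\<lambda>y. F y \<unlhd> c)"
    unfolding generic_def using c le_refl by (intro exI[of _ "\<lambda>_ _. {}"]) (auto simp: residue_local_def)
  moreover have "wscaled 0 F c" unfolding wscaled_def using c le_refl
    by (simp add: le_zero a_minus_def r_neg)
  ultimately have "c \<noteq> \<zero> \<Longrightarrow> scaled 0 F c" using c(1) by (simp add: scaled_def)
  then show ?case using c by blast
next
  case (Suc n)
  obtain cs where cs: "\<forall>c\<in>set cs. sfun n c" "\<forall>y\<in>\<O>. F y = horner (map (\<lambda>c. c y) cs) ((\<delta> ^^ n) y)"
    using sfun_Suc_horner[OF Suc.prems] by blast
  then have "(\<forall>c\<in>set cs. \<forall>y\<in>\<O>. c y = \<zero>) \<or>
    (\<exists>s. \<exists>c\<^sub>0\<in>set cs. scaled n c\<^sub>0 s \<and> (\<forall>c\<in>set cs. wscaled n c s))"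
    using Suc.IH by (intro common_scale) blast
  then consider "\<forall>c\<in>set cs. \<forall>y\<in>\<O>. c y = \<zero>"
    | s c\<^sub>0 where "c\<^sub>0 \<in> set cs" "scaled n c\<^sub>0 s" "\<forall>c\<in>set cs. wscaled n c s" by blast
  then show ?case
  proof cases
    case 1
    have "horner (map (\<lambda>c. c y) cs) t = \<zero>" if "y \<in> \<O>" "t \<in> carrier R" for y t
      using 1 that by (induction cs) auto
    then show ?thesis using cs(2) by auto
  next
    case 2
    then show ?thesis using horner_scaled[of cs n s c\<^sub>0 F] cs by blast
  qed
qed

lemma scaled_nonzero:
  assumes "scaled n F s" shows "\<exists>y\<in>\<O>. F y \<noteq> \<zero>"
proof -
  have s: "s \<in> carrier R" "s \<noteq> \<zero>" using assms by (auto simp: scaled_def)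
  obtain m where "m \<in> B" "F (\<zero> \<oplus> m) \<unlhd> s"
    using assms generic_exists[of n "\<lambda>y. F y \<unlhd> s" \<zero>] by (auto simp: scaled_def)
  then show ?thesis using zero_le[of s] s B_sub_O by (metis O_add zero_O)
qed

text \<open>Stands for y \<mapsto> g(a + y, \<sigma>(a + y), ...) with g a formally nonzero
  polynomial in n variables, built by Horner's scheme in the last variable X: if F is formally
  nonzero, then so is d + X F, whatever d. The predicate remembers formal nonvanishing, from which
  nonvanishing as a function is to be derived.\<close>

inductive nonzero_poly :: "'a \<Rightarrow> nat \<Rightarrow> ('a \<Rightarrow> 'a) \<Rightarrow> bool" for a where
  nonzero_poly_const: "\<lbrakk>c \<in> carrier R; c \<noteq> \<zero>\<rbrakk> \<Longrightarrow> nonzero_poly a 0 (\<lambda>_. c)"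
| nonzero_poly_lift: "nonzero_poly a n F \<Longrightarrow> nonzero_poly a (Suc n) F"
| nonzero_poly_step: "\<lbrakk>nonzero_poly a (Suc n) F; sfun n d\<rbrakk> \<Longrightarrow>
    nonzero_poly a (Suc n) (\<lambda>y. d y \<oplus> (\<sigma> ^^ n) (a \<oplus> y) \<otimes> F y)"
| nonzero_poly_cong: "\<lbrakk>nonzero_poly a n F; \<And>y. y \<in> \<O> \<Longrightarrow> F' y = F y\<rbrakk> \<Longrightarrow> nonzero_poly a n F'"

lemma nonzero_poly_sfun:
  assumes a: "a \<in> carrier R" shows "nonzero_poly a n F \<Longrightarrow> sfun n F"
proof (induction rule: nonzero_poly.induct)
  case (nonzero_poly_const c)
  then show ?case by (intro sfun_const)
next
  case (nonzero_poly_lift n F)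
  then show ?case by (blast intro: sfun_mono[where n' = "Suc n"] le_SucI)
next
  case (nonzero_poly_step n F d)
  have "sfun (Suc n) (\<lambda>y. d y \<oplus> ((\<sigma> ^^ n) a \<oplus> (\<sigma> ^^ n) y) \<otimes> F y)"
    using nonzero_poly_step a
    by (intro sfun_add sfun_mult sfun_const sfun_sigma_pow sfun_mono[of n d "Suc n"]) auto
  then show ?case by (rule sfun_cong) (simp add: sigma_pow_add a)
next
  case (nonzero_poly_cong n F F')
  then show ?case by (blast intro: sfun_cong)
qed

text \<open>The last variable is \<sigma>^n(a + y) = \<pi>^n \<delta>^n(y) + \<open>Q' y\<close>,
  linear in \<delta>^n(y). So multiplication by it multiplies the leading coefficient by \<pi>^n,
  and the summand d does not reach the new top degree.\<close>

lemma nonzero_poly_leading: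
  assumes a: "a \<in> carrier R" and IH: "\<And>F. nonzero_poly a n F \<Longrightarrow> \<exists>y\<in>\<O>. F y \<noteq> \<zero>"
    and "nonzero_poly a (Suc n) F"
  shows "\<exists>cs. cs \<noteq> [] \<and> (\<forall>c\<in>set cs. sfun n c) \<and> (\<exists>y\<in>\<O>. last cs y \<noteq> \<zero>) \<and>
    (\<forall>y\<in>\<O>. F y = horner (map (\<lambda>c. c y) cs) ((\<delta> ^^ n) y))"
  using assms(3)
proof (induction "Suc n" F rule: nonzero_poly.induct)
  case (nonzero_poly_lift F)
  then show ?case using IH[of F] nonzero_poly_sfun[OF a, of n F] sfun_closed[of n F]
    by (intro exI[of _ "[F]"]) simp
next
  case (nonzero_poly_cong F F')
  then show ?case by simp
next
  case (nonzero_poly_step F d)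
  interpret H: horner_functions R \<O> "\<delta> ^^ n" "sfun n" by (rule horner_functions_sfun)
  obtain cs where cs: "cs \<noteq> []" "\<forall>c\<in>set cs. sfun n c" "\<exists>y\<in>\<O>. last cs y \<noteq> \<zero>" "\<And>y. y \<in> \<O> \<Longrightarrow> F y = H.hval cs y"
    using nonzero_poly_step.hyps(2) by (auto simp: H.hval_def)
  obtain Q where Q: "sfun n Q" "\<And>y. y \<in> \<O> \<Longrightarrow> (\<sigma> ^^ n) y = \<pi> [^] n \<otimes> (\<delta> ^^ n) y \<oplus> Q y"
    using sigma_pow_eq_delta_pow by blast
  define Q' where "Q' y = (\<sigma> ^^ n) a \<oplus> Q y" for y
  have Q': "sfun n Q'" unfolding Q'_def using a Q by (intro sfun_add sfun_const) auto
  have d: "sfun n d" by fact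
  \<comment> \<open>In the coefficients with respect to \<delta>^n(y), \<open>us\<close> represents
    \<pi>^n \<delta>^n(y) F and \<open>vs\<close> represents d + \<open>Q'\<close> F.\<close>
  define us where "us = (\<lambda>_. \<zero>) # H.hscale (\<lambda>_. \<pi> [^] n) cs"
  define vs where "vs = H.hadd [d] (H.hscale Q' cs)"
  have P: "sfun n (\<lambda>_. \<pi> [^] n)" by (simp add: sfun_const)
  have us: "\<forall>c\<in>set us. sfun n c" and vs: "\<forall>c\<in>set vs. sfun n c"
    unfolding us_def vs_def using H.hscale_A[OF P cs(2)] H.hadd_A[OF _ H.hscale_A[OF Q' cs(2)], of "[d]"] d
    by (simp_all add: sfun_const)
  \<comment> \<open>As \<open>vs\<close> is shorter, the leading coefficient of the sum is that of
    \<open>us\<close>.\<close>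
  have len: "length vs < length us" using cs(1) by (cases cs) (auto simp: us_def vs_def H.hscale_def)
  show ?case
  proof (intro exI[of _ "H.hadd us vs"] conjI)
    show "H.hadd us vs \<noteq> []" by (simp add: us_def)
    show "\<forall>c\<in>set (H.hadd us vs). sfun n c" using H.hadd_A us vs .
    have "last (H.hadd us vs) = last us" using H.last_hadd[OF len] .
    also have "\<dots> = (\<lambda>y. \<pi> [^] n \<otimes> last cs y)" using cs(1) by (simp add: us_def H.hscale_def last_map)
    finally have l: "last (H.hadd us vs) = (\<lambda>y. \<pi> [^] n \<otimes> last cs y)" .
    obtain y where y: "y \<in> \<O>" "last cs y \<noteq> \<zero>" using cs(3) by blast
    have "last cs y \<in> carrier R" using cs(1,2) y(1) sfun_closed[of n "last cs" y] by simp
    moreover have "\<pi> [^] n \<noteq> \<zero>" by (induction n) (auto simp: integral_iff)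
    ultimately have "\<pi> [^] n \<otimes> last cs y \<noteq> \<zero>" using y(2) by (simp add: integral_iff)
    then show "\<exists>y\<in>\<O>. last (H.hadd us vs) y \<noteq> \<zero>" unfolding l using y(1) by blast
    have "d y \<oplus> (\<sigma> ^^ n) (a \<oplus> y) \<otimes> F y = H.hval (H.hadd us vs) y" if y: "y \<in> \<O>" for y
    proof -
      define D P h where "D = (\<delta> ^^ n) y" and "P = \<pi> [^] n" and "h = H.hval cs y"
      have c: "D \<in> carrier R" "P \<in> carrier R" "h \<in> carrier R" "d y \<in> carrier R" "Q y \<in> carrier R" "(\<sigma> ^^ n) a \<in> carrier R"
        using y cs(2) a sfun_closed[OF d y] sfun_closed[OF Q(1) y] by (simp_all add: D_def P_def h_def)
      have "H.hval (H.hadd us vs) y = D \<otimes> (P \<otimes> h) \<oplus> (d y \<oplus> Q' y \<otimes> h)"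
        using H.hval_hadd[OF us vs y] H.hval_hscale[OF P cs(2) y] H.hval_hscale[OF Q' cs(2) y] c
          H.hval_hadd[of "[d]" "H.hscale Q' cs" y] H.hscale_A[OF Q' cs(2)] d y
        by (simp add: us_def vs_def D_def P_def h_def)
      moreover have "(\<sigma> ^^ n) (a \<oplus> y) = (\<sigma> ^^ n) a \<oplus> (P \<otimes> D \<oplus> Q y)"
        using Q(2)[OF y] a y by (simp add: sigma_pow_add P_def D_def)
      moreover have "F y = h" using cs(4)[OF y] by (simp add: h_def)
      moreover have "d y \<oplus> ((\<sigma> ^^ n) a \<oplus> (P \<otimes> D \<oplus> Q y)) \<otimes> h = D \<otimes> (P \<otimes> h) \<oplus> (d y \<oplus> ((\<sigma> ^^ n) a \<oplus> Q y) \<otimes> h)"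
        using c by (simp add: l_distr r_distr m_ac a_ac)
      ultimately show ?thesis by (simp add: Q'_def)
    qed
    then show "\<forall>y\<in>\<O>. d y \<oplus> (\<sigma> ^^ n) (a \<oplus> y) \<otimes> F y = horner (map (\<lambda>c. c y) (H.hadd us vs)) ((\<delta> ^^ n) y)"
      by (simp add: H.hval_def)
  qed
qed

text \<open>The leading coefficient is a nonzero function by induction, so F has a scale and attains
  it at a generic point. The infinitely many residues enter here, through
  \<open>generic_exists\<close>.\<close>

theorem nonzero_poly_nonzero:
  assumes "a \<in> carrier R" shows "nonzero_poly a n F \<Longrightarrow> \<exists>y\<in>\<O>. F y \<noteq> \<zero>"
proof (induction n arbitrary: F)
  case 0
  then show ?case by (induction "0::nat" F rule: nonzero_poly.induct) (auto intro: exI[of _ \<zero>])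
next
  case (Suc n)
  obtain cs where cs: "cs \<noteq> []" "\<forall>c\<in>set cs. sfun n c" "\<exists>y\<in>\<O>. last cs y \<noteq> \<zero>"
    "\<forall>y\<in>\<O>. F y = horner (map (\<lambda>c. c y) cs) ((\<delta> ^^ n) y)"
    using nonzero_poly_leading[OF assms Suc.IH Suc.prems] by blast
  have "\<forall>c\<in>set cs. sfun n c \<and> ((\<forall>y\<in>\<O>. c y = \<zero>) \<or> (\<exists>s. scaled n c s))"
    using cs(2) sfun_scaled by blast
  moreover have "\<not> (\<forall>c\<in>set cs. \<forall>y\<in>\<O>. c y = \<zero>)" using cs(1,3) last_in_set by blast
  ultimately obtain s c\<^sub>0 where "c\<^sub>0 \<in> set cs" "scaled n c\<^sub>0 s" "\<forall>c\<in>set cs. wscaled n c s"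
    using common_scale by blast
  then have "scaled (Suc n) F s" using horner_scaled[of cs n s c\<^sub>0 F] cs by blast
  then show ?case by (rule scaled_nonzero)
qed

end

section \<open>Expansion of \<open>\<sigma>\<close>-polynomials around a point\<close>

text \<open>The monomials of \<open>sigma_eval\<close> for an arbitrary assignment of the variables
  and over a bare ring; in this form they also make sense in the ultrapower.\<close>

definition mono_eval :: "('a, 'm) ring_scheme \<Rightarrow> (nat \<Rightarrow> 'a) \<Rightarrow> nat multiset \<Rightarrow> 'a" where
  "mono_eval R u m = (\<Otimes>\<^bsub>R\<^esub> i \<in> set_mset m. u i [^]\<^bsub>R\<^esub> count m i)"

definition poly_eval :: "('a, 'm) ring_scheme \<Rightarrow> (nat multiset \<Rightarrow> 'a) \<Rightarrow> (nat \<Rightarrow> 'a) \<Rightarrow> 'a" where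
  "poly_eval R g u = (\<Oplus>\<^bsub>R\<^esub> m \<in> {m. g m \<noteq> \<zero>\<^bsub>R\<^esub>}. g m \<otimes>\<^bsub>R\<^esub> mono_eval R u m)"

context cring begin

lemma mono_eval_empty [simp]: "mono_eval R u {#} = \<one>"
  by (simp add: mono_eval_def)

lemma mono_eval_closed [simp]: "(\<And>i. u i \<in> carrier R) \<Longrightarrow> mono_eval R u m \<in> carrier R"
  unfolding mono_eval_def by (intro finprod_closed) auto

lemma mono_eval_add_mset:
  assumes u: "\<And>i. u i \<in> carrier R"
  shows "mono_eval R u (add_mset i m) = u i \<otimes> mono_eval R u m"
proof -
  \<comment> \<open>Both products are extended to the index set \<open>insert i A\<close>, where the
    new factors have exponent zero. This treats uniformly the cases that i does or does not occur in
    m.\<close>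
  define A where "A = set_mset m - {i}"
  have *: "mono_eval R u m' = (\<Otimes>j\<in>insert i A. u j [^] count m' j)"
    if "set_mset m' \<subseteq> insert i A" for m'
    unfolding mono_eval_def
    by (rule add.finprod_mono_neutral_cong_left finprod_mono_neutral_cong_left)
      (use that u in \<open>auto simp: A_def not_in_iff\<close>)
  have A: "finite A" "i \<notin> A" by (auto simp: A_def)
  have "mono_eval R u (add_mset i m) = (\<Otimes>j\<in>insert i A. u j [^] count (add_mset i m) j)"
    by (rule *) (auto simp: A_def)
  also have "\<dots> = u i [^] Suc (count m i) \<otimes> (\<Otimes>j\<in>A. u j [^] count (add_mset i m) j)"
    using A u by (subst finprod_insert) auto
  also have "(\<Otimes>j\<in>A. u j [^] count (add_mset i m) j) = (\<Otimes>j\<in>A. u j [^] count m j)"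
    using A u by (intro finprod_cong) (auto simp: simp_implies_def)
  also have "u i [^] Suc (count m i) \<otimes> (\<Otimes>j\<in>A. u j [^] count m j)
      = u i \<otimes> (u i [^] count m i \<otimes> (\<Otimes>j\<in>A. u j [^] count m j))"
    using u by (simp add: m_ac Pi_def)
  also have "u i [^] count m i \<otimes> (\<Otimes>j\<in>A. u j [^] count m j) = (\<Otimes>j\<in>insert i A. u j [^] count m j)"
    using A u by (subst finprod_insert) auto
  also have "\<dots> = mono_eval R u m" by (rule *[symmetric]) (auto simp: A_def)
  finally show ?thesis .
qed

end

section \<open>Expansion of G(x + t y) in powers of a parameter t fixed by \<sigma>, and
  nonconstancy of G as a function\<close>

context witt_difference begin

interpretation \<sigma>: ring_hom_ring R R \<sigma> by (rule sigma_ring_hom)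

definition fixed :: "'a set" where "fixed = {t \<in> carrier R. \<sigma> t = t}"

lemma zero_fixed [simp]: "\<zero> \<in> fixed" and one_fixed [simp]: "\<one> \<in> fixed"
  by (simp_all add: fixed_def)

lemma sigma_pow_fixed [simp]: "t \<in> fixed \<Longrightarrow> (\<sigma> ^^ i) t = t"
  by (induction i) (simp_all add: fixed_def)

lemma fixed_closed [simp]: "t \<in> fixed \<Longrightarrow> t \<in> carrier R" by (simp add: fixed_def)

abbreviation orbit :: "'a \<Rightarrow> nat \<Rightarrow> 'a" where "orbit x \<equiv> \<lambda>i. (\<sigma> ^^ i) x"

text \<open>Functions of the pair (t, y) that ignore t, so that \<open>horner_functions\<close>
  applies with t as the distinguished variable.\<close>

definition lifted_sfun :: "nat \<Rightarrow> ('a \<times> 'a \<Rightarrow> 'a) \<Rightarrow> bool" where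
  "lifted_sfun n c \<longleftrightarrow> (\<exists>F. sfun n F \<and> (\<forall>t. \<forall>y\<in>\<O>. c (t, y) = F y))"

lemma lifted_sfunI: "\<lbrakk>sfun n F; \<And>t y. y \<in> \<O> \<Longrightarrow> c (t, y) = F y\<rbrakk> \<Longrightarrow> lifted_sfun n c"
  unfolding lifted_sfun_def by blast

lemma horner_functions_lifted: "horner_functions R (fixed \<times> \<O>) fst (lifted_sfun n)"
proof unfold_locales
  fix c z assume "lifted_sfun n c" "z \<in> fixed \<times> \<O>"
  then obtain F where "sfun n F" "c z = F (snd z)" "snd z \<in> \<O>" by (cases z) (auto simp: lifted_sfun_def)
  then show "c z \<in> carrier R" using sfun_closed by simp
next
  fix c d assume "lifted_sfun n c" "lifted_sfun n d"
  then obtain F G where FG: "sfun n F" "sfun n G" "\<And>t y. y \<in> \<O> \<Longrightarrow> c (t, y) = F y" "\<And>t y. y \<in> \<O> \<Longrightarrow> d (t, y) = G y"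
    unfolding lifted_sfun_def by blast
  show "lifted_sfun n (\<lambda>z. c z \<oplus> d z)"
    by (rule lifted_sfunI[OF sfun_add[OF FG(1,2)]]) (simp add: FG)
  show "lifted_sfun n (\<lambda>z. c z \<otimes> d z)"
    by (rule lifted_sfunI[OF sfun_mult[OF FG(1,2)]]) (simp add: FG)
next
  show "lifted_sfun n (\<lambda>_. \<zero>)" by (rule lifted_sfunI[of n "\<lambda>_. \<zero>"]) (simp_all add: sfun_const)
qed auto

text \<open>Because t is fixed, \<sigma>^i(x + t y) = \<sigma>^i(x) + t \<sigma>^i(y) is linear in
  t. The coefficients of the resulting polynomial in t are polynomial functions of y, the same for
  all t.\<close>

lemma poly_expansion:
  assumes x: "x \<in> carrier R" and S: "finite S" "\<And>m. m \<in> S \<Longrightarrow> set_mset m \<subseteq> {..<n}"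
    and g: "\<And>m. m \<in> S \<Longrightarrow> g m \<in> carrier R"
  shows "\<exists>cs. (\<forall>c\<in>set cs. sfun n c) \<and> (\<forall>t\<in>fixed. \<forall>y\<in>\<O>.
    (\<Oplus>m\<in>S. g m \<otimes> mono_eval R (orbit (x \<oplus> t \<otimes> y)) m) = horner (map (\<lambda>c. c y) cs) t)"
proof -
  interpret H: horner_functions R "fixed \<times> \<O>" fst "lifted_sfun n" by (rule horner_functions_lifted)
  have const: "H.representable (\<lambda>_. c)" if "c \<in> carrier R" for c
    by (rule H.representable_coeff, rule lifted_sfunI[of n "\<lambda>_. c"]) (simp_all add: sfun_const that)
  have cl: "orbit (x \<oplus> fst z \<otimes> snd z) i \<in> carrier R" if "z \<in> fixed \<times> \<O>" for z i
    using that x by auto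
  have cong: "H.representable F" if "H.representable G" "\<And>z. z \<in> fixed \<times> \<O> \<Longrightarrow> F z = G z" for F G
    using that unfolding H.representable_def by simp
  have var: "H.representable (\<lambda>z. orbit (x \<oplus> fst z \<otimes> snd z) i)" if i: "i < n" for i
  proof (rule H.representableI[of "[\<lambda>_. (\<sigma> ^^ i) x, \<lambda>z. (\<sigma> ^^ i) (snd z)]"])
    show "\<forall>c\<in>set [\<lambda>_. (\<sigma> ^^ i) x, \<lambda>z. (\<sigma> ^^ i) (snd z)]. lifted_sfun n c"
      using i x lifted_sfunI[of n "\<lambda>_. (\<sigma> ^^ i) x" "\<lambda>_. (\<sigma> ^^ i) x"]
        lifted_sfunI[of n "\<sigma> ^^ i" "\<lambda>z. (\<sigma> ^^ i) (snd z)"] by (simp add: sfun_const sfun_sigma_pow)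
    fix z assume "z \<in> fixed \<times> \<O>"
    then show "orbit (x \<oplus> fst z \<otimes> snd z) i = H.hval [\<lambda>_. (\<sigma> ^^ i) x, \<lambda>z. (\<sigma> ^^ i) (snd z)] z"
      using x by (auto simp: sigma_pow_add sigma_pow_mult)
  qed
  have mono: "H.representable (\<lambda>z. mono_eval R (orbit (x \<oplus> fst z \<otimes> snd z)) m)" if "set_mset m \<subseteq> {..<n}" for m
    using that
  proof (induction m)
    case empty
    then show ?case using const by simp
  next
    case (add i m)
    have "H.representable (\<lambda>z. orbit (x \<oplus> fst z \<otimes> snd z) i \<otimes> mono_eval R (orbit (x \<oplus> fst z \<otimes> snd z)) m)"
      using add by (intro H.representable_mult var) auto
    then show ?case by (rule cong) (intro mono_eval_add_mset cl)
  qed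
  have "H.representable (\<lambda>z. \<Oplus>m\<in>S. g m \<otimes> mono_eval R (orbit (x \<oplus> fst z \<otimes> snd z)) m)"
    using S g
  proof (induction S rule: finite_induct)
    case empty
    then show ?case using const by simp
  next
    case (insert m S)
    have gm: "g m \<in> carrier R" using insert.prems by simp
    have "H.representable (\<lambda>z. g m \<otimes> mono_eval R (orbit (x \<oplus> fst z \<otimes> snd z)) m \<oplus>
       (\<Oplus>m\<in>S. g m \<otimes> mono_eval R (orbit (x \<oplus> fst z \<otimes> snd z)) m))"
      by (rule H.representable_add[OF H.representable_mult[OF const[OF gm] mono]])
        (use insert in auto)
    then show ?case
    proof (rule cong)
      fix z assume "z \<in> fixed \<times> \<O>"
      then have "g m \<otimes> mono_eval R (orbit (x \<oplus> fst z \<otimes> snd z)) m \<in> carrier R" if "m \<in> insert m S" "g m \<in> carrier R" for m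
        using that by (intro m_closed mono_eval_closed cl)
      then show "(\<Oplus>m\<in>insert m S. g m \<otimes> mono_eval R (orbit (x \<oplus> fst z \<otimes> snd z)) m) =
         g m \<otimes> mono_eval R (orbit (x \<oplus> fst z \<otimes> snd z)) m \<oplus>
         (\<Oplus>m\<in>S. g m \<otimes> mono_eval R (orbit (x \<oplus> fst z \<otimes> snd z)) m)"
        using insert.hyps insert.prems(2) by (intro finsum_insert) auto
    qed
  qed
  then obtain cs where cs: "\<forall>c\<in>set cs. lifted_sfun n c"
    "\<And>z. z \<in> fixed \<times> \<O> \<Longrightarrow> (\<Oplus>m\<in>S. g m \<otimes> mono_eval R (orbit (x \<oplus> fst z \<otimes> snd z)) m) = H.hval cs z"
    unfolding H.representable_def by blast
  show ?thesis
  \<comment> \<open>The coefficients ignore t; its value 0 is an arbitrary choice.\<close>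
  proof (intro exI[of _ "map (\<lambda>c y. c (\<zero>, y)) cs"] conjI ballI)
    fix c assume "c \<in> set (map (\<lambda>c y. c (\<zero>, y)) cs)"
    then obtain d where d: "d \<in> set cs" "c = (\<lambda>y. d (\<zero>, y))" by auto
    then obtain F where "sfun n F" "\<And>y. y \<in> \<O> \<Longrightarrow> c y = F y" using cs(1) unfolding lifted_sfun_def by blast
    then show "sfun n c" by (rule sfun_cong)
  next
    fix t y assume ty: "t \<in> fixed" "y \<in> \<O>"
    have "c (t, y) = c (\<zero>, y)" if "c \<in> set cs" for c
      using cs(1) ty(2) that unfolding lifted_sfun_def by fastforce
    then have "map (\<lambda>c. c (t, y)) cs = map (\<lambda>c. c y) (map (\<lambda>c y. c (\<zero>, y)) cs)" by simp
    with cs(2)[of "(t, y)"] ty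
    show "(\<Oplus>m\<in>S. g m \<otimes> mono_eval R (orbit (x \<oplus> t \<otimes> y)) m) =
        horner (map (\<lambda>c. c y) (map (\<lambda>c y. c (\<zero>, y)) cs)) t"
      unfolding H.hval_def by (simp del: map_map map_eq_conv)
  qed
qed

lemma sfun_poly:
  assumes x: "x \<in> carrier R" and S: "finite S" "\<And>m. m \<in> S \<Longrightarrow> set_mset m \<subseteq> {..<n}"
    and g: "\<And>m. m \<in> S \<Longrightarrow> g m \<in> carrier R"
  shows "sfun n (\<lambda>y. \<Oplus>m\<in>S. g m \<otimes> mono_eval R (orbit (x \<oplus> y)) m)"
proof -
  obtain cs where cs: "\<forall>c\<in>set cs. sfun n c" "\<And>t y. t\<in>fixed \<Longrightarrow> y\<in>\<O> \<Longrightarrow>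
    (\<Oplus>m\<in>S. g m \<otimes> mono_eval R (orbit (x \<oplus> t \<otimes> y)) m) = horner (map (\<lambda>c. c y) cs) t"
    using poly_expansion[of x S n g] x S g by blast
  have "sfun n (\<lambda>y. horner (map (\<lambda>c. c y) cs) \<one>)" using cs(1)
    by (induction cs) (auto intro!: sfun_const sfun_add sfun_mult)
  then show ?thesis by (rule sfun_cong) (use cs(2)[of \<one>] in simp)
qed

text \<open>Induction on the number of variables, and inside it on a bound N for the degree in the
  last variable. The monomials that contain this variable are divided by it once; if their
  coefficients all vanish, a polynomial in fewer variables remains.\<close>

lemma nonzero_poly_monomials:
  assumes x: "x \<in> carrier R"
  shows "\<lbrakk>finite S; \<And>m. m \<in> S \<Longrightarrow> set_mset m \<subseteq> {..<n}; \<And>m. m \<in> S \<Longrightarrow> g m \<in> carrier R; \<exists>m\<in>S. g m \<noteq> \<zero>\<rbrakk>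
    \<Longrightarrow> nonzero_poly x n (\<lambda>y. \<Oplus>m\<in>S. g m \<otimes> mono_eval R (orbit (x \<oplus> y)) m)"
proof (induction n arbitrary: S g)
  case 0
  have "m = {#}" if "m \<in> S" for m using 0(2)[OF that] by simp
  then have S: "S = {{#}}" using 0(4) by blast
  show ?case
  proof (rule nonzero_poly_cong)
    show "nonzero_poly x 0 (\<lambda>_. g {#})" using 0 S by (intro nonzero_poly_const) auto
    fix y assume "y \<in> \<O>"
    show "(\<Oplus>m\<in>S. g m \<otimes> mono_eval R (orbit (x \<oplus> y)) m) = g {#}"
      using 0 by (simp add: S)
  qed
next
  case (Suc n)
  have cl: "mono_eval R (orbit (x \<oplus> y)) m \<in> carrier R" if "y \<in> \<O>" for y m
    using that x by (intro mono_eval_closed) simp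
  have "\<exists>N. \<forall>m\<in>S. count m n \<le> N" using Suc.prems(1) 
    using finite_nat_set_iff_bounded_le[of "(\<lambda>m. count m n) ` S"] by simp
  then obtain N where N: "\<And>m. m \<in> S \<Longrightarrow> count m n \<le> N" by blast
  from Suc.prems N show ?case
  proof (induction N arbitrary: S g)
    case 0
    have "set_mset m \<subseteq> {..<n}" if "m \<in> S" for m
    proof
      fix i assume i: "i \<in># m"
      then have "i < Suc n" using 0(2)[OF that] by auto
      moreover have "i \<noteq> n" using 0(5)[OF that] i by (auto simp: count_eq_zero_iff)
      ultimately show "i \<in> {..<n}" by simp
    qed
    then show ?case using 0 Suc.IH by (intro nonzero_poly_lift) auto
  next
    case (Suc N)
    define S0 S1 where "S0 = {m \<in> S. n \<notin># m}" and "S1 = {m \<in> S. n \<in># m}"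
    have S01: "S = S0 \<union> S1" "S0 \<inter> S1 = {}" "finite S0" "finite S1"
      using Suc.prems(1) by (auto simp: S0_def S1_def)
    have S0v: "set_mset m \<subseteq> {..<n}" if "m \<in> S0" for m
    proof
      fix i assume i: "i \<in># m"
      then have "i < Suc n" using Suc.prems(2)[of m] that by (auto simp: S0_def)
      moreover have "i \<noteq> n" using i that by (auto simp: S0_def)
      ultimately show "i \<in> {..<n}" by simp
    qed
    define E where "E S g y = (\<Oplus>m\<in>S. g m \<otimes> mono_eval R (orbit (x \<oplus> y)) m)" for S and g :: "nat multiset \<Rightarrow> 'a" and y
    have gS: "g m \<in> carrier R" if "m \<in> S0 \<union> S1" for m using Suc.prems(3) S01 that by blast
    have Esplit: "E S g y = E S0 g y \<oplus> E S1 g y" if y: "y \<in> \<O>" for y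
      unfolding E_def S01(1) by (rule finsum_Un_disjoint) (use S01 gS cl[OF y] in auto)
    show ?case
    proof (cases "\<exists>m\<in>S1. g m \<noteq> \<zero>")
      case True
      \<comment> \<open>Divides the monomials of \<open>S1\<close> by the last variable;
        \<open>g'\<close> carries their coefficients along.\<close>
      define r where "r m = m - {#n#}" for m :: "nat multiset"
      define g' where "g' m = g (add_mset n m)" for m
      have r: "add_mset n (r m) = m" if "m \<in> S1" for m using that by (simp add: r_def S1_def)
      have inj: "inj_on r S1" by (rule inj_on_inverseI[of _ "add_mset n"]) (rule r)
      have g'r: "g' (r m) = g m" if "m \<in> S1" for m using r[OF that] by (simp add: g'_def)
      have "nonzero_poly x (Suc n) (E (r ` S1) g')"
        unfolding E_def
      proof (rule Suc.IH)
        show "finite (r ` S1)" using S01 by simp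
        show "\<exists>m\<in>r ` S1. g' m \<noteq> \<zero>" using True g'r by auto
        fix m assume "m \<in> r ` S1"
        then obtain m' where m': "m' \<in> S1" "m = r m'" by blast
        then show "g' m \<in> carrier R" using g'r gS by simp
        have "set_mset m \<subseteq> set_mset m'" using m' by (auto simp: r_def dest: in_diffD)
        then show "set_mset m \<subseteq> {..<Suc n}" using Suc.prems(2)[of m'] m'(1) S01 by blast
        have "Suc (count m n) = count m' n" using r[OF m'(1)] m'(2) by (metis count_add_mset)
        then show "count m n \<le> N" using Suc.prems(5)[of m'] m'(1) S01 by auto
      qed
      moreover have "sfun n (E S0 g)" unfolding E_def
        by (rule sfun_poly[OF x S01(3) S0v]) (use gS in auto)
      ultimately have "nonzero_poly x (Suc n) (\<lambda>y. E S0 g y \<oplus> (\<sigma> ^^ n) (x \<oplus> y) \<otimes> E (r ` S1) g' y)"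
        by (rule nonzero_poly_step)
      then have "nonzero_poly x (Suc n) (E S g)"
      proof (rule nonzero_poly_cong)
        fix y assume y: "y \<in> \<O>"
        have o: "orbit (x \<oplus> y) i \<in> carrier R" for i using x y by simp
        have "E (r ` S1) g' y = (\<Oplus>m\<in>S1. g' (r m) \<otimes> mono_eval R (orbit (x \<oplus> y)) (r m))"
          unfolding E_def by (rule finsum_reindex[OF _ inj]) (use g'r gS cl[OF y] in auto)
        then have "(\<sigma> ^^ n) (x \<oplus> y) \<otimes> E (r ` S1) g' y =
            (\<Oplus>m\<in>S1. (\<sigma> ^^ n) (x \<oplus> y) \<otimes> (g' (r m) \<otimes> mono_eval R (orbit (x \<oplus> y)) (r m)))"
          using o[of n] cl[OF y] g'r gS S01 by (simp add: finsum_rdistr)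
        also have "\<dots> = E S1 g y"
          unfolding E_def
        proof (rule finsum_cong')
          fix m assume m: "m \<in> S1"
          have "g m \<otimes> mono_eval R (orbit (x \<oplus> y)) m = g m \<otimes> mono_eval R (orbit (x \<oplus> y)) (add_mset n (r m))"
            by (simp only: r[OF m])
          also have "\<dots> = g m \<otimes> ((\<sigma> ^^ n) (x \<oplus> y) \<otimes> mono_eval R (orbit (x \<oplus> y)) (r m))"
            by (simp only: mono_eval_add_mset[OF o])
          finally show "(\<sigma> ^^ n) (x \<oplus> y) \<otimes> (g' (r m) \<otimes> mono_eval R (orbit (x \<oplus> y)) (r m)) =
              g m \<otimes> mono_eval R (orbit (x \<oplus> y)) m"
            using o[of n] cl[OF y] gS[of m] m by (simp add: g'r m_lcomm)
        qed (use gS cl[OF y] in auto)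
        finally show "E S g y = E S0 g y \<oplus> (\<sigma> ^^ n) (x \<oplus> y) \<otimes> E (r ` S1) g' y"
          using Esplit[OF y] by simp
      qed
      then show ?thesis unfolding E_def .
    next
      case False
      \<comment> \<open>This is the hypothesis of the outer induction, quoted in full because
        \<open>Suc.IH\<close> now denotes that of the inner one.\<close>
      have "nonzero_poly x n (E S0 g)"
        unfolding E_def
        by (rule \<open>\<And>S g. \<lbrakk>finite S; \<And>m. m \<in> S \<Longrightarrow> set_mset m \<subseteq> {..<n}; \<And>m. m \<in> S \<Longrightarrow> g m \<in> carrier R; \<exists>m\<in>S. g m \<noteq> \<zero>\<rbrakk>
            \<Longrightarrow> nonzero_poly x n (\<lambda>y. \<Oplus>m\<in>S. g m \<otimes> mono_eval R (orbit (x \<oplus> y)) m)\<close>[OF S01(3) S0v])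
          (use gS False Suc.prems(4) S01 in auto)
      then have "nonzero_poly x (Suc n) (E S0 g)" by (rule nonzero_poly_lift)
      then have "nonzero_poly x (Suc n) (E S g)"
      proof (rule nonzero_poly_cong)
        fix y assume y: "y \<in> \<O>"
        have "E S1 g y = (\<Oplus>m\<in>S1. \<zero>)"
          unfolding E_def by (rule finsum_cong') (use False cl[OF y] in auto)
        then have "E S1 g y = \<zero>" by simp
        moreover have "E S0 g y \<in> carrier R"
          unfolding E_def by (rule finsum_closed) (use gS cl[OF y] in auto)
        ultimately show "E S g y = E S0 g y" using Esplit[OF y] by simp
      qed
      then show ?thesis unfolding E_def .
    qed
  qed
qed

lemma poly_eval_cong_support:
  assumes "finite S" "{m. g m \<noteq> \<zero>} \<subseteq> S" "\<And>m. g m \<in> carrier R" "\<And>i. u i \<in> carrier R"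
  shows "poly_eval R g u = (\<Oplus>m\<in>S. g m \<otimes> mono_eval R u m)"
  unfolding poly_eval_def
  by (rule add.finprod_mono_neutral_cong_left) (use assms in auto)

text \<open>Subtracting c changes only the constant coefficient, so the polynomial remains formally
  nonzero and cannot vanish on all of x + \<open>\<O>\<close>.\<close>

lemma poly_not_locally_constant:
  assumes x: "x \<in> carrier R" and g: "finite {m. g m \<noteq> \<zero>}" "\<And>m. g m \<in> carrier R"
    and m: "m \<noteq> {#}" "g m \<noteq> \<zero>" and c: "c \<in> carrier R"
  shows "\<exists>y\<in>\<O>. poly_eval R g (orbit (x \<oplus> y)) \<noteq> c"
proof (rule ccontr)
  assume "\<not> ?thesis"
  then have const: "\<And>y. y \<in> \<O> \<Longrightarrow> poly_eval R g (orbit (x \<oplus> y)) = c" by blast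
  define S where "S = {m. g m \<noteq> \<zero>} - {{#}}"
  have S: "finite S" "{#} \<notin> S" "m \<in> S" using g m by (auto simp: S_def)
  define h where "h k = (if k = {#} then g {#} \<ominus> c else g k)" for k
  have h: "h k \<in> carrier R" for k using g c by (simp add: h_def)
  have "finite (\<Union>k\<in>S. set_mset k)" using S by simp
  then obtain n where n: "\<forall>i\<in>(\<Union>k\<in>S. set_mset k). i < n" using finite_nat_set_iff_bounded by blast
  have "nonzero_poly x n (\<lambda>y. \<Oplus>k\<in>insert {#} S. h k \<otimes> mono_eval R (orbit (x \<oplus> y)) k)"
  proof (rule nonzero_poly_monomials[OF x])
    show "\<exists>k\<in>insert {#} S. h k \<noteq> \<zero>" using S m by (intro bexI[of _ m]) (auto simp: h_def)
    show "set_mset k \<subseteq> {..<n}" if "k \<in> insert {#} S" for k using n that by auto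
  qed (use S h in auto)
  then obtain y where y: "y \<in> \<O>" "(\<Oplus>k\<in>insert {#} S. h k \<otimes> mono_eval R (orbit (x \<oplus> y)) k) \<noteq> \<zero>"
    using nonzero_poly_nonzero[OF x] by blast
  have o: "orbit (x \<oplus> y) i \<in> carrier R" for i using x y by simp
  define r where "r = (\<Oplus>k\<in>S. g k \<otimes> mono_eval R (orbit (x \<oplus> y)) k)"
  have r: "r \<in> carrier R" unfolding r_def by (rule finsum_closed) (use g o in auto)
  have "c = (\<Oplus>k\<in>insert {#} S. g k \<otimes> mono_eval R (orbit (x \<oplus> y)) k)"
    unfolding const[OF y(1), symmetric] by (rule poly_eval_cong_support) (use S(1) g o in \<open>auto simp: S_def\<close>)
  also have "\<dots> = g {#} \<oplus> r"
    using S g(2) o by (subst finsum_insert) (auto simp: r_def)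
  finally have c': "c = g {#} \<oplus> r" .
  have "(\<Oplus>k\<in>insert {#} S. h k \<otimes> mono_eval R (orbit (x \<oplus> y)) k) =
      h {#} \<oplus> (\<Oplus>k\<in>S. h k \<otimes> mono_eval R (orbit (x \<oplus> y)) k)"
    using S h o by (subst finsum_insert) auto
  also have "(\<Oplus>k\<in>S. h k \<otimes> mono_eval R (orbit (x \<oplus> y)) k) = r"
    unfolding r_def by (rule finsum_cong') (use g o S in \<open>auto simp: h_def\<close>)
  also have "h {#} = \<ominus> r"
    unfolding h_def c' using g(2)[of "{#}"] r by (auto intro!: minus_eqI simp: a_lcomm[of "\<ominus> r"] l_neg)
  also have "\<ominus> r \<oplus> r = \<zero>" using r by (rule l_neg)
  finally show False using y by simp
qed

end

section \<open>Eventual dominance\<close>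

context valuation_preorder begin

lemma strict_pow:
  assumes "x \<in> carrier R" "y \<in> carrier R" "y \<noteq> \<zero>" "\<not> y \<unlhd> x"
  shows "\<not> y [^] Suc k \<unlhd> x [^] Suc k"
proof
  assume le: "y [^] Suc k \<unlhd> x [^] Suc k"
  have "x \<unlhd> y" using assms le_total by blast
  then have "x [^] k \<unlhd> y [^] k"
    by (induction k) (use assms in \<open>auto intro: le_mult_mono2 simp: le_refl\<close>)
  then have "x [^] k \<otimes> x \<unlhd> y [^] k \<otimes> x" using assms by (intro le_mult_mono2) (auto simp: le_refl)
  then have "y [^] k \<otimes> y \<unlhd> y [^] k \<otimes> x"
    using le le_trans[of "y [^] Suc k" "x [^] Suc k" "y [^] k \<otimes> x"] assms by simp
  moreover have "y [^] k \<noteq> \<zero>" using assms by (induction k) (auto simp: integral_iff)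
  ultimately show False using le_cancel[of y x "y [^] k"] assms by simp
qed

lemma strict_le_trans:
  assumes "x \<in> carrier R" "y \<in> carrier R" "z \<in> carrier R" "x \<unlhd> y" "\<not> z \<unlhd> y" shows "\<not> z \<unlhd> x"
  using assms le_trans[of z x y] by blast

text \<open>As the values of the \<open>\<theta> \<rho>\<close> increase strictly, two monomials of different degrees in
  \<open>\<theta> \<rho>\<close> have the same value for at most one \<open>\<rho>\<close>, so that one of them dominates eventually.\<close>

lemma horner_dominant:
  fixes \<theta> :: "'i::{wellorder,no_top} \<Rightarrow> 'a"
  assumes \<theta>: "\<And>\<rho>. \<rho>\<^sub>0 \<le> \<rho> \<Longrightarrow> \<theta> \<rho> \<in> carrier R \<and> \<theta> \<rho> \<noteq> \<zero>"
      "\<And>\<rho> \<rho>'. \<lbrakk>\<rho>\<^sub>0 \<le> \<rho>; \<rho> < \<rho>'\<rbrakk> \<Longrightarrow> \<not> \<theta> \<rho>' \<unlhd> \<theta> \<rho>"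
    and hs: "\<forall>h\<in>set hs. (\<forall>\<rho>\<ge>\<rho>\<^sub>0. h \<rho> = \<zero>) \<or>
      (\<exists>s\<in>carrier R. s \<noteq> \<zero> \<and> (\<forall>\<rho>\<ge>\<rho>\<^sub>0. h \<rho> \<in> carrier R \<and> h \<rho> \<asymp> s))"
  shows "(\<forall>h\<in>set hs. \<forall>\<rho>\<ge>\<rho>\<^sub>0. h \<rho> = \<zero>) \<or>
    (\<exists>s\<in>carrier R. \<exists>k \<rho>\<^sub>1. s \<noteq> \<zero> \<and> \<rho>\<^sub>0 \<le> \<rho>\<^sub>1 \<and>
      (\<forall>\<rho>\<ge>\<rho>\<^sub>1. horner (map (\<lambda>h. h \<rho>) hs) (\<theta> \<rho>) \<asymp> s \<otimes> \<theta> \<rho> [^] (k::nat)))"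
  using hs
proof (induction hs)
  case (Cons h hs)
  define W where "W \<rho> = horner (map (\<lambda>h. h \<rho>) hs) (\<theta> \<rho>)" for \<rho>
  have hc: "\<forall>h\<in>set (h # hs). h \<rho> \<in> carrier R" if "\<rho>\<^sub>0 \<le> \<rho>" for \<rho>
  proof
    fix g assume "g \<in> set (h # hs)"
    then have "(\<forall>\<rho>\<ge>\<rho>\<^sub>0. g \<rho> = \<zero>) \<or> (\<forall>\<rho>\<ge>\<rho>\<^sub>0. g \<rho> \<in> carrier R)" using Cons.prems by blast
    then show "g \<rho> \<in> carrier R" using that by auto
  qed
  have Wc: "W \<rho> \<in> carrier R" if "\<rho>\<^sub>0 \<le> \<rho>" for \<rho>
    unfolding W_def by (rule horner_closed) (use \<theta>(1)[OF that] hc[OF that] in auto)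
  have step: "horner (map (\<lambda>h. h \<rho>) (h # hs)) (\<theta> \<rho>) = h \<rho> \<oplus> \<theta> \<rho> \<otimes> W \<rho>" for \<rho>
    by (simp add: W_def)
  have zero: "W \<rho> = \<zero>" if "\<forall>h\<in>set hs. \<forall>\<rho>\<ge>\<rho>\<^sub>0. h \<rho> = \<zero>" "\<rho>\<^sub>0 \<le> \<rho>" for \<rho>
    unfolding W_def using that \<theta>(1)[of \<rho>] by (induction hs) auto
  have veqW: "\<theta> \<rho> \<otimes> W \<rho> \<asymp> s \<otimes> \<theta> \<rho> [^] Suc k"
    if "W \<rho> \<asymp> s \<otimes> \<theta> \<rho> [^] k" "s \<in> carrier R" "\<rho>\<^sub>0 \<le> \<rho>" for s \<rho> and k :: nat
  proof -
    have "\<theta> \<rho> \<otimes> W \<rho> \<asymp> \<theta> \<rho> \<otimes> (s \<otimes> \<theta> \<rho> [^] k)"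
      using that \<theta>(1)[of \<rho>] Wc[of \<rho>] le_refl by (intro veq_mult) (auto simp: veq_def)
    then show ?thesis using that \<theta>(1)[of \<rho>] by (simp add: m_ac)
  qed
  have "(\<forall>h\<in>set hs. \<forall>\<rho>\<ge>\<rho>\<^sub>0. h \<rho> = \<zero>) \<or>
    (\<exists>s\<in>carrier R. \<exists>k \<rho>\<^sub>1. s \<noteq> \<zero> \<and> \<rho>\<^sub>0 \<le> \<rho>\<^sub>1 \<and> (\<forall>\<rho>\<ge>\<rho>\<^sub>1. W \<rho> \<asymp> s \<otimes> \<theta> \<rho> [^] (k::nat)))"
    using Cons unfolding W_def by simp
  then consider (zz) "\<forall>h\<in>set hs. \<forall>\<rho>\<ge>\<rho>\<^sub>0. h \<rho> = \<zero>"
    | (nz) s k \<rho>\<^sub>1 where "s \<in> carrier R" "s \<noteq> \<zero>" "\<rho>\<^sub>0 \<le> \<rho>\<^sub>1" "\<And>\<rho>. \<rho>\<^sub>1 \<le> \<rho> \<Longrightarrow> W \<rho> \<asymp> s \<otimes> \<theta> \<rho> [^] (k::nat)"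
    by blast
  then show ?case
  proof cases
    case zz
    consider "\<forall>\<rho>\<ge>\<rho>\<^sub>0. h \<rho> = \<zero>" | r where "r \<in> carrier R" "r \<noteq> \<zero>" "\<And>\<rho>. \<rho>\<^sub>0 \<le> \<rho> \<Longrightarrow> h \<rho> \<in> carrier R \<and> h \<rho> \<asymp> r"
      using Cons.prems by auto
    then show ?thesis
    proof cases
      case 1
      then show ?thesis using zz by simp
    next
      case 2
      have "\<forall>\<rho>\<ge>\<rho>\<^sub>0. horner (map (\<lambda>h. h \<rho>) (h # hs)) (\<theta> \<rho>) \<asymp> r \<otimes> \<theta> \<rho> [^] (0::nat)"
        unfolding step using 2 zero[OF zz] \<theta>(1) by simp
      then show ?thesis using 2(1,2) by blast
    qed
  next
    case nz
    note \<rho>1 = order_trans[OF nz(3)]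
    have mc: "s \<otimes> \<theta> \<rho> [^] Suc k \<in> carrier R" if "\<rho>\<^sub>1 \<le> \<rho>" for \<rho>
      using \<theta>(1)[OF \<rho>1[OF that]] nz(1) by simp
    have tW: "\<theta> \<rho> \<otimes> W \<rho> \<in> carrier R" "\<theta> \<rho> \<otimes> W \<rho> \<asymp> s \<otimes> \<theta> \<rho> [^] Suc k" if "\<rho>\<^sub>1 \<le> \<rho>" for \<rho>
      using \<theta>(1)[OF \<rho>1[OF that]] Wc[OF \<rho>1[OF that]] veqW[OF nz(4)[OF that] nz(1) \<rho>1[OF that]] by auto
    consider "\<forall>\<rho>\<ge>\<rho>\<^sub>0. h \<rho> = \<zero>" | r where "r \<in> carrier R" "r \<noteq> \<zero>" "\<And>\<rho>. \<rho>\<^sub>0 \<le> \<rho> \<Longrightarrow> h \<rho> \<in> carrier R \<and> h \<rho> \<asymp> r"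
      using Cons.prems by auto
    then show ?thesis
    proof cases
      case 1
      have "horner (map (\<lambda>h. h \<rho>) (h # hs)) (\<theta> \<rho>) \<asymp> s \<otimes> \<theta> \<rho> [^] Suc k" if "\<rho>\<^sub>1 \<le> \<rho>" for \<rho>
        unfolding step using 1 tW[OF that] \<rho>1[OF that] by simp
      then show ?thesis using nz(1-3) by blast
    next
      case 2
      show ?thesis
      \<comment> \<open>Once v(r) is at most the value of s \<theta>^(k+1), it is strictly smaller
        at all later indices, and the constant term dominates with exponent 0. If this never
        happens, the other summand dominates from \<open>\<rho>\<^sub>1\<close> on.\<close>
      proof (cases "\<exists>\<rho>\<ge>\<rho>\<^sub>1. r \<unlhd> s \<otimes> \<theta> \<rho> [^] Suc k")
        case True
        then obtain \<tau> where \<tau>: "\<rho>\<^sub>1 \<le> \<tau>" "r \<unlhd> s \<otimes> \<theta> \<tau> [^] Suc k" by blast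
        obtain \<rho>\<^sub>2 where \<rho>2: "\<tau> < \<rho>\<^sub>2" using gt_ex by blast
        have "horner (map (\<lambda>h. h \<rho>) (h # hs)) (\<theta> \<rho>) \<asymp> r \<otimes> \<theta> \<rho> [^] (0::nat)" if \<rho>: "\<rho>\<^sub>2 \<le> \<rho>" for \<rho>
        proof -
          have gt: "\<tau> < \<rho>" "\<rho>\<^sub>1 \<le> \<rho>" using \<rho> \<rho>2 \<tau>(1) by auto
          note h = 2(3)[OF \<rho>1[OF gt(2)]]
          have t: "\<theta> \<tau> \<in> carrier R" "\<theta> \<rho> \<in> carrier R" "\<theta> \<rho> \<noteq> \<zero>" using \<theta>(1) \<rho>1 gt \<tau>(1) by auto
          have "\<not> \<theta> \<rho> [^] Suc k \<unlhd> \<theta> \<tau> [^] Suc k"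
            using strict_pow[OF t(1,2,3) \<theta>(2)[OF \<rho>1[OF \<tau>(1)] gt(1)]] .
          then have "\<not> s \<otimes> \<theta> \<rho> [^] Suc k \<unlhd> s \<otimes> \<theta> \<tau> [^] Suc k"
            using le_cancel[of "\<theta> \<rho> [^] Suc k" "\<theta> \<tau> [^] Suc k" s] nz t by auto
          then have "\<not> s \<otimes> \<theta> \<rho> [^] Suc k \<unlhd> r"
            using strict_le_trans[OF 2(1) mc[OF \<tau>(1)] mc[OF gt(2)] \<tau>(2)] by blast
          then have "\<not> \<theta> \<rho> \<otimes> W \<rho> \<unlhd> h \<rho>"
            using veq_le_iff[OF tW(1)[OF gt(2)] mc[OF gt(2)] _ 2(1) tW(2)[OF gt(2)]] h by blast
          then have "h \<rho> \<oplus> \<theta> \<rho> \<otimes> W \<rho> \<asymp> h \<rho>"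
            using strict_le_add[of "h \<rho>" "\<theta> \<rho> \<otimes> W \<rho>"] h tW(1)[OF gt(2)] by (simp add: veq_def)
          then have "h \<rho> \<oplus> \<theta> \<rho> \<otimes> W \<rho> \<asymp> r"
            using veq_trans[of "h \<rho> \<oplus> \<theta> \<rho> \<otimes> W \<rho>" "h \<rho>" r] h 2(1) tW(1)[OF gt(2)] by simp
          then show ?thesis unfolding step using 2(1) by simp
        qed
        moreover have "\<rho>\<^sub>0 \<le> \<rho>\<^sub>2" using \<rho>2 \<tau>(1) \<rho>1 by (meson order_trans less_imp_le)
        ultimately show ?thesis using 2(1,2) by blast
      next
        case False
        have "horner (map (\<lambda>h. h \<rho>) (h # hs)) (\<theta> \<rho>) \<asymp> s \<otimes> \<theta> \<rho> [^] Suc k" if \<rho>: "\<rho>\<^sub>1 \<le> \<rho>" for \<rho>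
        proof -
          note h = 2(3)[OF \<rho>1[OF \<rho>]]
          have "\<not> r \<unlhd> s \<otimes> \<theta> \<rho> [^] Suc k" using False \<rho> by blast
          then have "\<not> h \<rho> \<unlhd> \<theta> \<rho> \<otimes> W \<rho>"
            using veq_le_iff[OF _ 2(1) tW(1)[OF \<rho>] mc[OF \<rho>] _ tW(2)[OF \<rho>]] h by blast
          then have "\<theta> \<rho> \<otimes> W \<rho> \<oplus> h \<rho> \<asymp> \<theta> \<rho> \<otimes> W \<rho>"
            using strict_le_add[of "\<theta> \<rho> \<otimes> W \<rho>" "h \<rho>"] h tW(1)[OF \<rho>] by (simp add: veq_def)
          then have "\<theta> \<rho> \<otimes> W \<rho> \<oplus> h \<rho> \<asymp> s \<otimes> \<theta> \<rho> [^] Suc k"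
            using veq_trans[OF _ tW(1)[OF \<rho>] mc[OF \<rho>] _ tW(2)[OF \<rho>]] h tW(1)[OF \<rho>] by simp
          then show ?thesis unfolding step using h tW(1)[OF \<rho>] a_comm by simp
        qed
        then show ?thesis using nz(1-3) by blast
      qed
    qed
  qed
qed simp

end

section \<open>Growth of G along generic perturbations, and the choice of the \<mu>\<close>

context witt_difference begin

definition nonconst_poly :: "(nat multiset \<Rightarrow> 'a) \<Rightarrow> bool" where
  "nonconst_poly g \<longleftrightarrow> finite {m. g m \<noteq> \<zero>} \<and> (\<forall>m. g m \<in> carrier R) \<and> (\<exists>m. m \<noteq> {#} \<and> g m \<noteq> \<zero>)"

text \<open>\<open>P\<close> asks every coefficient function of the expansion that is not
  identically zero to take its generic value. Then these values are constant along the sequence and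
  \<open>horner_dominant\<close> applies. \<open>P\<close> is fixed before y, so that finitely many
  polynomials can be handled at once.\<close>

lemma poly_generic_growth:
  fixes \<theta> :: "'i::{wellorder,no_top} \<Rightarrow> 'a"
  assumes x: "x \<in> carrier R" and g: "nonconst_poly g"
    and \<theta>: "\<And>\<rho>. \<rho>\<^sub>0 \<le> \<rho> \<Longrightarrow> \<theta> \<rho> \<in> fixed \<and> \<theta> \<rho> \<noteq> \<zero>"
      "\<And>\<rho> \<rho>'. \<lbrakk>\<rho>\<^sub>0 \<le> \<rho>; \<rho> < \<rho>'\<rbrakk> \<Longrightarrow> \<not> \<theta> \<rho>' \<unlhd> \<theta> \<rho>"
  shows "\<exists>n P. generic n P \<and> (\<forall>y. (\<forall>\<rho>\<ge>\<rho>\<^sub>0. y \<rho> \<in> \<O> \<and> P (y \<rho>)) \<longrightarrow>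
    (\<exists>\<rho>\<^sub>1. \<forall>\<rho> \<rho>'. \<rho>\<^sub>1 \<le> \<rho> \<and> \<rho> < \<rho>' \<longrightarrow>
      \<not> poly_eval R g (orbit x) \<ominus> poly_eval R g (orbit (x \<oplus> \<theta> \<rho>' \<otimes> y \<rho>')) \<unlhd>
        poly_eval R g (orbit x) \<ominus> poly_eval R g (orbit (x \<oplus> \<theta> \<rho> \<otimes> y \<rho>))))"
proof -
  define S where "S = {m. g m \<noteq> \<zero>}"
  have S: "finite S" and gc: "\<And>m. g m \<in> carrier R" using g by (auto simp: nonconst_poly_def S_def)
  have "finite (\<Union>k\<in>S. set_mset k)" using S by simp
  then obtain n where n: "\<forall>i\<in>(\<Union>k\<in>S. set_mset k). i < n" using finite_nat_set_iff_bounded by blast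
  define E where "E y = poly_eval R g (orbit y)" for y
  obtain cs' where cs': "\<forall>c\<in>set cs'. sfun n c" "\<And>t y. \<lbrakk>t \<in> fixed; y \<in> \<O>\<rbrakk> \<Longrightarrow>
      E (x \<oplus> t \<otimes> y) = horner (map (\<lambda>c. c y) cs') t"
    using poly_expansion[of x S n g] x S gc n unfolding E_def poly_eval_def S_def[symmetric] by blast
  \<comment> \<open>Splits off the term of degree 0 in t. For the empty list, which represents the
    zero polynomial, this term is the zero function.\<close>
  define c0 cs where "c0 = (if cs' = [] then (\<lambda>_. \<zero>) else hd cs')" and "cs = tl cs'"
  have c0: "sfun n c0" using cs'(1) by (simp add: c0_def sfun_const)
  have cs: "\<forall>c\<in>set cs. sfun n c" using cs'(1) unfolding cs_def by (cases cs') auto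
  have csc: "set (map (\<lambda>c. c y) cs) \<subseteq> carrier R" if "y \<in> \<O>" for y
    using cs that sfun_closed by auto
  have Eh: "E (x \<oplus> t \<otimes> y) = c0 y \<oplus> t \<otimes> horner (map (\<lambda>c. c y) cs) t" if "t \<in> fixed" "y \<in> \<O>" for t y
    using cs'(2)[OF that] that by (cases cs') (auto simp: c0_def cs_def)
  \<comment> \<open>t = 0 shows that the term of degree 0 is the constant
    \<open>E x\<close>.\<close>
  have E0: "c0 y = E x" if "y \<in> \<O>" for y
    using Eh[of \<zero> y] that csc[OF that] x sfun_closed[OF c0 that] by simp
  have Ec: "E x \<in> carrier R" using sfun_closed[OF c0 zero_O] E0[of \<zero>] by simp
  have diff: "E x \<ominus> E (x \<oplus> t \<otimes> y) = \<ominus> (t \<otimes> horner (map (\<lambda>c. c y) cs) t)" if "t \<in> fixed" "y \<in> \<O>" for t y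
  proof -
    have "t \<otimes> horner (map (\<lambda>c. c y) cs) t \<in> carrier R" using csc[OF that(2)] that(1) by simp
    then show ?thesis unfolding Eh[OF that] E0[OF that(2)] using Ec
      by (simp add: a_minus_def minus_add a_assoc[symmetric] r_neg)
  qed
  \<comment> \<open>Otherwise, by taking t = 1, \<open>E\<close> would be constant on x +
    \<open>\<O>\<close>.\<close>
  have nz: "\<exists>c\<in>set cs. \<not> (\<forall>y\<in>\<O>. c y = \<zero>)"
  proof (rule ccontr)
    assume *: "\<not> ?thesis"
    have "horner (map (\<lambda>c. c y) cs) \<one> = \<zero>" if "y \<in> \<O>" for y
      using * that by (induction cs) auto
    then have "E (x \<oplus> y) = E x" if "y \<in> \<O>" for y
      using Eh[of \<one> y] E0[OF that] that Ec by simp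
    moreover obtain m where "m \<noteq> {#}" "g m \<noteq> \<zero>" using g by (auto simp: nonconst_poly_def)
    ultimately show False
      using poly_not_locally_constant[OF x S[unfolded S_def] gc, of m "E x"] Ec by (auto simp: E_def)
  qed
  define sc where "sc c = (SOME s. scaled n c s)" for c
  have sc: "scaled n c (sc c)" if "c \<in> set cs" "\<not> (\<forall>y\<in>\<O>. c y = \<zero>)" for c
    unfolding sc_def using sfun_scaled[of n c] cs that by (intro someI_ex[of "scaled n c"]) blast
  define D where "D = {c \<in> set cs. \<not> (\<forall>y\<in>\<O>. c y = \<zero>)}"
  have D: "finite D" "\<And>c. c \<in> D \<Longrightarrow> scaled n c (sc c)" using sc by (auto simp: D_def)
  have "generic n (\<lambda>y. \<forall>c\<in>D. c y \<unlhd> sc c)"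
    by (rule generic_ball[OF D(1)]) (use D(2) in \<open>simp add: scaled_def\<close>)
  moreover have "\<exists>\<rho>\<^sub>1. \<forall>\<rho> \<rho>'. \<rho>\<^sub>1 \<le> \<rho> \<and> \<rho> < \<rho>' \<longrightarrow>
      \<not> E x \<ominus> E (x \<oplus> \<theta> \<rho>' \<otimes> y \<rho>') \<unlhd> E x \<ominus> E (x \<oplus> \<theta> \<rho> \<otimes> y \<rho>)"
    if y: "\<forall>\<rho>\<ge>\<rho>\<^sub>0. y \<rho> \<in> \<O> \<and> (\<forall>c\<in>D. c (y \<rho>) \<unlhd> sc c)" for y
  proof -
    define hs where "hs = map (\<lambda>c \<rho>. c (y \<rho>)) cs"
    have hsD: "\<forall>\<rho>\<ge>\<rho>\<^sub>0. c (y \<rho>) \<in> carrier R \<and> c (y \<rho>) \<asymp> sc c" "sc c \<in> carrier R" "sc c \<noteq> \<zero>" if "c \<in> D" for c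
      using D(2)[OF that] y that cs sfun_closed[of n c] by (auto simp: scaled_def wscaled_def veq_def D_def)
    have hs0: "\<forall>\<rho>\<ge>\<rho>\<^sub>0. c (y \<rho>) = \<zero>" if "c \<in> set cs" "c \<notin> D" for c
      using y that by (auto simp: D_def)
    have "(\<forall>h\<in>set hs. \<forall>\<rho>\<ge>\<rho>\<^sub>0. h \<rho> = \<zero>) \<or>
      (\<exists>s\<in>carrier R. \<exists>k \<rho>\<^sub>1. s \<noteq> \<zero> \<and> \<rho>\<^sub>0 \<le> \<rho>\<^sub>1 \<and>
        (\<forall>\<rho>\<ge>\<rho>\<^sub>1. horner (map (\<lambda>h. h \<rho>) hs) (\<theta> \<rho>) \<asymp> s \<otimes> \<theta> \<rho> [^] (k::nat)))"
    proof (rule horner_dominant)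
      show "\<forall>h\<in>set hs. (\<forall>\<rho>\<ge>\<rho>\<^sub>0. h \<rho> = \<zero>) \<or>
          (\<exists>s\<in>carrier R. s \<noteq> \<zero> \<and> (\<forall>\<rho>\<ge>\<rho>\<^sub>0. h \<rho> \<in> carrier R \<and> h \<rho> \<asymp> s))"
      proof
        fix h assume "h \<in> set hs"
        then obtain c where c: "c \<in> set cs" "h = (\<lambda>\<rho>. c (y \<rho>))" by (auto simp: hs_def)
        show "(\<forall>\<rho>\<ge>\<rho>\<^sub>0. h \<rho> = \<zero>) \<or> (\<exists>s\<in>carrier R. s \<noteq> \<zero> \<and> (\<forall>\<rho>\<ge>\<rho>\<^sub>0. h \<rho> \<in> carrier R \<and> h \<rho> \<asymp> s))"
          unfolding c(2) using hs0[OF c(1)] hsD[of c] by (cases "c \<in> D") blast+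
      qed
    qed (use \<theta> in auto)
    moreover have "\<not> (\<forall>h\<in>set hs. \<forall>\<rho>\<ge>\<rho>\<^sub>0. h \<rho> = \<zero>)"
    proof
      assume *: "\<forall>h\<in>set hs. \<forall>\<rho>\<ge>\<rho>\<^sub>0. h \<rho> = \<zero>"
      obtain c where c: "c \<in> D" using nz by (auto simp: D_def)
      then have "c (y \<rho>\<^sub>0) = \<zero>" using * by (auto simp: hs_def D_def)
      then have "\<zero> \<unlhd> sc c" using hsD(1)[OF c] by (auto simp: veq_def)
      then show False using zero_le hsD(2,3)[OF c] by blast
    qed
    ultimately obtain s k \<rho>\<^sub>1 where s: "s \<in> carrier R" "s \<noteq> \<zero>" "\<rho>\<^sub>0 \<le> \<rho>\<^sub>1"
      "\<And>\<rho>. \<rho>\<^sub>1 \<le> \<rho> \<Longrightarrow> horner (map (\<lambda>h. h \<rho>) hs) (\<theta> \<rho>) \<asymp> s \<otimes> \<theta> \<rho> [^] (k::nat)" by blast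
    \<comment> \<open>One factor \<theta> was taken out of the difference, so the exponent is
      \<open>Suc k\<close>; the value grows strictly even if k = 0.\<close>
    have main: "E x \<ominus> E (x \<oplus> \<theta> \<rho> \<otimes> y \<rho>) \<asymp> s \<otimes> \<theta> \<rho> [^] Suc k \<and>
        E x \<ominus> E (x \<oplus> \<theta> \<rho> \<otimes> y \<rho>) \<in> carrier R \<and> s \<otimes> \<theta> \<rho> [^] Suc k \<in> carrier R" if "\<rho>\<^sub>1 \<le> \<rho>" for \<rho>
    proof -
      have \<rho>: "\<rho>\<^sub>0 \<le> \<rho>" using that s by simp
      then have t: "\<theta> \<rho> \<in> fixed" "y \<rho> \<in> \<O>" using \<theta>(1) y by auto
      define W where "W = horner (map (\<lambda>c. c (y \<rho>)) cs) (\<theta> \<rho>)"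
      have W: "W \<in> carrier R" using csc[OF t(2)] t(1) by (simp add: W_def)
      have tc: "\<theta> \<rho> \<in> carrier R" using t by simp
      have "W \<asymp> s \<otimes> \<theta> \<rho> [^] k" using s(4)[OF that] by (simp add: W_def hs_def comp_def)
      then have "\<theta> \<rho> \<otimes> W \<asymp> \<theta> \<rho> \<otimes> (s \<otimes> \<theta> \<rho> [^] k)"
        using W tc s(1) le_refl by (intro veq_mult) (auto simp: veq_def)
      moreover have "\<theta> \<rho> \<otimes> (s \<otimes> \<theta> \<rho> [^] k) = s \<otimes> \<theta> \<rho> [^] Suc k" using tc s(1) by (simp add: m_ac)
      moreover have "\<ominus> (\<theta> \<rho> \<otimes> W) \<asymp> \<theta> \<rho> \<otimes> W"
        using veq_minus_commute[of \<zero> "\<theta> \<rho> \<otimes> W"] W tc by (simp add: a_minus_def)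
      ultimately have "\<ominus> (\<theta> \<rho> \<otimes> W) \<asymp> s \<otimes> \<theta> \<rho> [^] Suc k"
        using veq_trans[of "\<ominus> (\<theta> \<rho> \<otimes> W)" "\<theta> \<rho> \<otimes> W" "s \<otimes> \<theta> \<rho> [^] Suc k"] W tc s(1) by simp
      then show ?thesis using diff[OF t] W tc s(1) by (simp add: W_def)
    qed
    have "\<not> E x \<ominus> E (x \<oplus> \<theta> \<rho>' \<otimes> y \<rho>') \<unlhd> E x \<ominus> E (x \<oplus> \<theta> \<rho> \<otimes> y \<rho>)"
      if \<rho>: "\<rho>\<^sub>1 \<le> \<rho>" "\<rho> < \<rho>'" for \<rho> \<rho>'
    proof -
      have \<rho>': "\<rho>\<^sub>1 \<le> \<rho>'" "\<rho>\<^sub>0 \<le> \<rho>" "\<rho>\<^sub>0 \<le> \<rho>'" using \<rho> s(3) by auto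
      have t: "\<theta> \<rho> \<in> carrier R" "\<theta> \<rho>' \<in> carrier R" "\<theta> \<rho>' \<noteq> \<zero>" using \<theta>(1) \<rho>' by auto
      have "\<not> \<theta> \<rho>' [^] Suc k \<unlhd> \<theta> \<rho> [^] Suc k" using strict_pow[OF t \<theta>(2)[OF \<rho>'(2) \<rho>(2)]] .
      then have "\<not> s \<otimes> \<theta> \<rho>' [^] Suc k \<unlhd> s \<otimes> \<theta> \<rho> [^] Suc k"
        using le_cancel[of "\<theta> \<rho>' [^] Suc k" "\<theta> \<rho> [^] Suc k" s] s t by auto
      then show ?thesis using veq_le_iff main[OF \<rho>(1)] main[OF \<rho>'(1)] by blast
    qed
    then show ?thesis by blast
  qed
  ultimately show ?thesis unfolding E_def
    by (intro exI[of _ n] exI[of _ "\<lambda>y. \<forall>c\<in>D. c y \<unlhd> sc c"]) blast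
qed

text \<open>Only the residue 0 has to be avoided. The purpose is that the corrected point keeps a
  distance of exactly v(\<theta>) from the pseudolimit.\<close>

lemma generic_unit: "generic (Suc 0) (\<lambda>y. y \<unlhd> \<one>)"
proof (rule generic_Suc[where A = "\<lambda>_. {\<zero>}" and P = "\<lambda>_. True"])
  show "generic 0 (\<lambda>_. True)"
    unfolding generic_def by (intro exI[of _ "\<lambda>_ _. {}"]) (simp add: residue_local_def)
  fix y assume "y \<in> \<O>" "\<forall>x\<in>{\<zero>}. \<not> \<pi> \<unlhd> (\<delta> ^^ 0) y \<ominus> x"
  then show "y \<unlhd> \<one>" using le_cases[of y] by (simp add: a_minus_def)
qed auto

text \<open>With d = (c - x)/\<theta> the corrected point is x + \<theta> (d + \<mu>). Genericity of
  d + \<mu> gives the growth for every g in \<open>S\<close>, and its being a unit gives the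
  distance v(\<theta>) from x.\<close>

theorem exists_generic_shift:
  fixes \<theta> c :: "'i::{wellorder,no_top} \<Rightarrow> 'a"
  assumes x: "x \<in> carrier R" and S: "finite S" "\<forall>g\<in>S. nonconst_poly g"
    and \<theta>: "\<And>\<rho>. \<rho>\<^sub>0 \<le> \<rho> \<Longrightarrow> \<theta> \<rho> \<in> fixed \<and> \<theta> \<rho> \<noteq> \<zero> \<and> c \<rho> \<in> carrier R \<and> c \<rho> \<ominus> x \<asymp> \<theta> \<rho>"
      "\<And>\<rho> \<rho>'. \<lbrakk>\<rho>\<^sub>0 \<le> \<rho>; \<rho> < \<rho>'\<rbrakk> \<Longrightarrow> \<not> \<theta> \<rho>' \<unlhd> \<theta> \<rho>"
  shows "\<exists>\<mu>. (\<forall>\<rho>\<ge>\<rho>\<^sub>0. \<mu> \<rho> \<in> B \<and> (c \<rho> \<oplus> \<theta> \<rho> \<otimes> \<mu> \<rho>) \<ominus> x \<asymp> \<theta> \<rho>) \<and>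
    (\<forall>g\<in>S. \<exists>\<rho>\<^sub>1. \<forall>\<rho> \<rho>'. \<rho>\<^sub>1 \<le> \<rho> \<and> \<rho> < \<rho>' \<longrightarrow>
      \<not> poly_eval R g (orbit x) \<ominus> poly_eval R g (orbit (c \<rho>' \<oplus> \<theta> \<rho>' \<otimes> \<mu> \<rho>')) \<unlhd>
        poly_eval R g (orbit x) \<ominus> poly_eval R g (orbit (c \<rho> \<oplus> \<theta> \<rho> \<otimes> \<mu> \<rho>)))"
proof -
  define grows where "grows g y \<longleftrightarrow> (\<exists>\<rho>\<^sub>1. \<forall>\<rho> \<rho>'. \<rho>\<^sub>1 \<le> \<rho> \<and> \<rho> < \<rho>' \<longrightarrow>
      \<not> poly_eval R g (orbit x) \<ominus> poly_eval R g (orbit (y \<rho>')) \<unlhd>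
        poly_eval R g (orbit x) \<ominus> poly_eval R g (orbit (y \<rho>)))" for g and y :: "'i \<Rightarrow> 'a"
  have "\<forall>g\<in>S. \<exists>n P. generic n P \<and> (\<forall>y. (\<forall>\<rho>\<ge>\<rho>\<^sub>0. y \<rho> \<in> \<O> \<and> P (y \<rho>)) \<longrightarrow> grows g (\<lambda>\<rho>. x \<oplus> \<theta> \<rho> \<otimes> y \<rho>))"
  proof
    fix g assume "g \<in> S"
    then have "nonconst_poly g" using S by blast
    then show "\<exists>n P. generic n P \<and> (\<forall>y. (\<forall>\<rho>\<ge>\<rho>\<^sub>0. y \<rho> \<in> \<O> \<and> P (y \<rho>)) \<longrightarrow> grows g (\<lambda>\<rho>. x \<oplus> \<theta> \<rho> \<otimes> y \<rho>))"
      unfolding grows_def by (rule poly_generic_growth[OF x]) (use \<theta> in auto)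
  qed
  from bchoice[OF this] obtain n where "\<forall>g\<in>S. \<exists>P. generic (n g) P \<and>
    (\<forall>y. (\<forall>\<rho>\<ge>\<rho>\<^sub>0. y \<rho> \<in> \<O> \<and> P (y \<rho>)) \<longrightarrow> grows g (\<lambda>\<rho>. x \<oplus> \<theta> \<rho> \<otimes> y \<rho>))" by blast
  from bchoice[OF this] obtain P where nP: "\<And>g. g \<in> S \<Longrightarrow> generic (n g) (P g)"
    "\<And>g y. \<lbrakk>g \<in> S; \<forall>\<rho>\<ge>\<rho>\<^sub>0. y \<rho> \<in> \<O> \<and> P g (y \<rho>)\<rbrakk> \<Longrightarrow> grows g (\<lambda>\<rho>. x \<oplus> \<theta> \<rho> \<otimes> y \<rho>)"
    by blast
  \<comment> \<open>A common order for all g; the entry 1 makes room for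
    \<open>generic_unit\<close>.\<close>
  define N where "N = Max (insert 1 (n ` S))"
  have N: "n g \<le> N" if "g \<in> S" for g unfolding N_def using S(1) that by (intro Max_ge) auto
  have N1: "Suc 0 \<le> N" unfolding N_def using S(1) by (intro Max_ge) auto
  have "generic N (\<lambda>y. \<forall>g\<in>S. P g y)"
    by (rule generic_ball[OF S(1)]) (rule generic_mono[OF nP(1) N])
  then have gen: "generic N (\<lambda>y. y \<unlhd> \<one> \<and> (\<forall>g\<in>S. P g y))"
    using generic_conj[OF generic_mono[OF generic_unit N1, where Q = "\<lambda>y. y \<unlhd> \<one>"]] by blast
  define d where "d \<rho> = inv (\<theta> \<rho>) \<otimes> (c \<rho> \<ominus> x)" for \<rho>
  have d: "d \<rho> \<in> \<O>" "\<theta> \<rho> \<otimes> d \<rho> = c \<rho> \<ominus> x" if "\<rho>\<^sub>0 \<le> \<rho>" for \<rho>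
  proof -
    have t: "\<theta> \<rho> \<in> carrier R" "\<theta> \<rho> \<noteq> \<zero>" "c \<rho> \<in> carrier R" "\<theta> \<rho> \<unlhd> c \<rho> \<ominus> x" using \<theta>(1)[OF that] by (auto simp: veq_def)
    then have u: "\<theta> \<rho> \<in> Units R" by (simp add: field_Units)
    show "d \<rho> \<in> \<O>" unfolding O_def using inv_mult_le_iff[of "\<theta> \<rho>" "c \<rho> \<ominus> x"] t u x by (simp add: d_def)
    show "\<theta> \<rho> \<otimes> d \<rho> = c \<rho> \<ominus> x" using t u x by (simp add: d_def flip: m_assoc)
  qed
  have "\<forall>\<rho>. \<exists>m. \<rho>\<^sub>0 \<le> \<rho> \<longrightarrow> m \<in> B \<and> (d \<rho> \<oplus> m) \<unlhd> \<one> \<and> (\<forall>g\<in>S. P g (d \<rho> \<oplus> m))"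
    using generic_exists[OF gen d(1)] by blast
  from choice[OF this] obtain \<mu> where \<mu>: "\<And>\<rho>. \<rho>\<^sub>0 \<le> \<rho> \<Longrightarrow> \<mu> \<rho> \<in> B \<and> (d \<rho> \<oplus> \<mu> \<rho>) \<unlhd> \<one> \<and> (\<forall>g\<in>S. P g (d \<rho> \<oplus> \<mu> \<rho>))"
    by blast
  have y: "d \<rho> \<oplus> \<mu> \<rho> \<in> \<O>" "x \<oplus> \<theta> \<rho> \<otimes> (d \<rho> \<oplus> \<mu> \<rho>) = c \<rho> \<oplus> \<theta> \<rho> \<otimes> \<mu> \<rho>"
    "(c \<rho> \<oplus> \<theta> \<rho> \<otimes> \<mu> \<rho>) \<ominus> x = \<theta> \<rho> \<otimes> (d \<rho> \<oplus> \<mu> \<rho>)" if "\<rho>\<^sub>0 \<le> \<rho>" for \<rho>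
  proof -
    have t: "\<theta> \<rho> \<in> carrier R" "c \<rho> \<in> carrier R" using \<theta>(1)[OF that] by auto
    have m: "\<mu> \<rho> \<in> \<O>" "\<mu> \<rho> \<in> carrier R" using \<mu>[OF that] B_sub_O by auto
    show 1: "d \<rho> \<oplus> \<mu> \<rho> \<in> \<O>" using d(1)[OF that] m by simp
    have "x \<oplus> \<theta> \<rho> \<otimes> (d \<rho> \<oplus> \<mu> \<rho>) = (c \<rho> \<ominus> x \<oplus> x) \<oplus> \<theta> \<rho> \<otimes> \<mu> \<rho>"
      using d[OF that] t m x by (simp add: r_distr a_ac)
    then show 2: "x \<oplus> \<theta> \<rho> \<otimes> (d \<rho> \<oplus> \<mu> \<rho>) = c \<rho> \<oplus> \<theta> \<rho> \<otimes> \<mu> \<rho>" using t x by (simp add: minus_add_same)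
    show "(c \<rho> \<oplus> \<theta> \<rho> \<otimes> \<mu> \<rho>) \<ominus> x = \<theta> \<rho> \<otimes> (d \<rho> \<oplus> \<mu> \<rho>)"
      unfolding 2[symmetric] using O_closed[OF 1] t(1) x by (intro minus_eqI a_comm) auto
  qed
  have "\<mu> \<rho> \<in> B \<and> (c \<rho> \<oplus> \<theta> \<rho> \<otimes> \<mu> \<rho>) \<ominus> x \<asymp> \<theta> \<rho>" if "\<rho>\<^sub>0 \<le> \<rho>" for \<rho>
  proof -
    have t: "\<theta> \<rho> \<in> carrier R" using \<theta>(1)[OF that] by auto
    have "d \<rho> \<oplus> \<mu> \<rho> \<asymp> \<one>" using \<mu>[OF that] O_le[OF y(1)[OF that]] by (simp add: veq_def)
    then have "\<theta> \<rho> \<otimes> (d \<rho> \<oplus> \<mu> \<rho>) \<asymp> \<theta> \<rho> \<otimes> \<one>"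
      using t O_closed[OF y(1)[OF that]] le_refl by (intro veq_mult) (auto simp: veq_def)
    then show ?thesis unfolding y(3)[OF that] using \<mu>[OF that] t by simp
  qed
  moreover have "grows g (\<lambda>\<rho>. c \<rho> \<oplus> \<theta> \<rho> \<otimes> \<mu> \<rho>)" if g: "g \<in> S" for g
  proof -
    have "grows g (\<lambda>\<rho>. x \<oplus> \<theta> \<rho> \<otimes> (d \<rho> \<oplus> \<mu> \<rho>))"
      by (rule nP(2)[OF g]) (use y(1) \<mu> g in blast)
    then obtain \<rho>\<^sub>1 where \<rho>1: "\<And>\<rho> \<rho>'. \<lbrakk>\<rho>\<^sub>1 \<le> \<rho>; \<rho> < \<rho>'\<rbrakk> \<Longrightarrow>
      \<not> poly_eval R g (orbit x) \<ominus> poly_eval R g (orbit (x \<oplus> \<theta> \<rho>' \<otimes> (d \<rho>' \<oplus> \<mu> \<rho>'))) \<unlhd>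
        poly_eval R g (orbit x) \<ominus> poly_eval R g (orbit (x \<oplus> \<theta> \<rho> \<otimes> (d \<rho> \<oplus> \<mu> \<rho>)))"
      unfolding grows_def by blast
    show ?thesis unfolding grows_def
    proof (intro exI[of _ "max \<rho>\<^sub>0 \<rho>\<^sub>1"] allI impI)
      fix \<rho> \<rho>' assume "max \<rho>\<^sub>0 \<rho>\<^sub>1 \<le> \<rho> \<and> \<rho> < \<rho>'"
      then have \<rho>: "\<rho>\<^sub>0 \<le> \<rho>" "\<rho>\<^sub>0 \<le> \<rho>'" "\<rho>\<^sub>1 \<le> \<rho>" "\<rho> < \<rho>'" by auto
      show "\<not> poly_eval R g (orbit x) \<ominus> poly_eval R g (orbit (c \<rho>' \<oplus> \<theta> \<rho>' \<otimes> \<mu> \<rho>')) \<unlhd>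
        poly_eval R g (orbit x) \<ominus> poly_eval R g (orbit (c \<rho> \<oplus> \<theta> \<rho> \<otimes> \<mu> \<rho>))"
        using \<rho>1[OF \<rho>(3,4)] unfolding y(2)[OF \<rho>(1)] y(2)[OF \<rho>(2)] .
    qed
  qed
  ultimately show ?thesis unfolding grows_def by (intro exI[of _ \<mu>]) blast
qed

end

section \<open>Ultrapowers\<close>

text \<open>Zorn's lemma for the proper filters below \<open>F\<close> in the reversed order, as
  smaller filters are the finer ones. A chain is bounded by its infimum, which is proper because an
  event of \<open>Inf C\<close> already is an event of a member.\<close>

lemma ultrafilter_exists:
  fixes F :: "'i filter" assumes "F \<noteq> bot"
  shows "\<exists>U\<le>F. U \<noteq> bot \<and> (\<forall>P. eventually P U \<or> eventually (\<lambda>i. \<not> P i) U)"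
proof -
  define A where "A = {G. G \<le> F \<and> G \<noteq> bot}"
  have "partial_order_on A (relation_of (\<lambda>G H. H \<le> G) A)"
    by (rule partial_order_on_relation_ofI) auto
  moreover have "\<exists>u\<in>A. \<forall>G\<in>C. u \<le> G" if C: "C \<in> Chains (relation_of (\<lambda>G H. H \<le> G) A)" for C
  proof (cases "C = {}")
    case True
    then show ?thesis using assms by (auto simp: A_def)
  next
    case False
    have CA: "C \<subseteq> A" using C by (auto simp: Chains_def relation_of_def)
    have tot: "G \<le> H \<or> H \<le> G" if "G \<in> C" "H \<in> C" for G H
      using C that by (auto simp: Chains_def relation_of_def)
    have "Inf C \<noteq> bot"
    proof
      assume "Inf C = bot"
      then have "eventually (\<lambda>_. False) (Inf C)" by simp
      also have "eventually (\<lambda>_. False) (Inf C) \<longleftrightarrow> (\<exists>G\<in>C. eventually (\<lambda>_. False) G)"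
      proof (rule eventually_Inf_base[OF False])
        show "\<exists>K\<in>C. K \<le> inf G H" if "G \<in> C" "H \<in> C" for G H
          using tot[OF that] that by (auto simp: inf_absorb1 inf_absorb2)
      qed
      finally show False using CA by (auto simp: A_def trivial_limit_def)
    qed
    moreover obtain G where "G \<in> C" using False by blast
    then have "Inf C \<le> F" using CA by (auto simp: A_def intro: Inf_lower2)
    ultimately show ?thesis by (intro bexI[of _ "Inf C"]) (auto simp: A_def intro: Inf_lower)
  qed
  ultimately obtain U where U: "U \<in> A" "\<And>G. \<lbrakk>G \<in> A; G \<le> U\<rbrakk> \<Longrightarrow> G = U"
    using predicate_Zorn[of A "\<lambda>G H. H \<le> G"] by blast
  have "eventually (\<lambda>i. \<not> P i) U" if "\<not> eventually P U" for P
  proof -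
    \<comment> \<open>Adjoining the complement of \<open>P\<close> keeps the filter proper; as
      \<open>U\<close> is extremal, it contained that complement already.\<close>
    let ?G = "inf U (principal {i. \<not> P i})"
    have "?G \<noteq> bot" using that by (auto simp: trivial_limit_def eventually_inf_principal)
    moreover have "?G \<le> F" using U(1) by (auto simp: A_def intro: le_infI1)
    ultimately have "?G = U" by (intro U(2)) (auto simp: A_def)
    moreover have "eventually (\<lambda>i. \<not> P i) ?G" by (simp add: eventually_inf_principal)
    ultimately show ?thesis by simp
  qed
  then show ?thesis using U(1) unfolding A_def by blast
qed

text \<open>In the ultrapower, classes of functions modulo \<open>U\<close> are replaced by representatives: \<open>unf U\<close>
  picks one function from each class.\<close>

definition unf :: "'i filter \<Rightarrow> ('i \<Rightarrow> 'a) \<Rightarrow> 'i \<Rightarrow> 'a" where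
  "unf U x = (SOME y. \<forall>\<^sub>F i in U. y i = x i)"

lemma unf_eventually: "\<forall>\<^sub>F i in U. unf U x i = x i"
  unfolding unf_def by (rule someI_ex[of "\<lambda>y. \<forall>\<^sub>F i in U. y i = x i"]) (intro exI[of _ x], simp)

lemma unf_cong: "\<forall>\<^sub>F i in U. x i = y i \<Longrightarrow> unf U x = unf U y"
proof -
  assume "\<forall>\<^sub>F i in U. x i = y i"
  then have "(\<forall>\<^sub>F i in U. z i = x i) \<longleftrightarrow> (\<forall>\<^sub>F i in U. z i = y i)" for z
    by (auto elim: eventually_elim2)
  then show ?thesis by (simp add: unf_def)
qed

lemma unf_unf [simp]: "unf U (unf U x) = unf U x"
  by (rule unf_cong) (rule unf_eventually)

definition ultrapower :: "'i filter \<Rightarrow> ('a, 'm) ring_scheme \<Rightarrow> ('i \<Rightarrow> 'a) ring" where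
  "ultrapower U R = ring.make {x. unf U x = x \<and> (\<forall>\<^sub>F i in U. x i \<in> carrier R)}
     (\<lambda>x y. unf U (\<lambda>i. x i \<otimes>\<^bsub>R\<^esub> y i)) (unf U (\<lambda>_. \<one>\<^bsub>R\<^esub>))
     (unf U (\<lambda>_. \<zero>\<^bsub>R\<^esub>)) (\<lambda>x y. unf U (\<lambda>i. x i \<oplus>\<^bsub>R\<^esub> y i))"

lemma ultrapower_simps:
  "carrier (ultrapower U R) = {x. unf U x = x \<and> (\<forall>\<^sub>F i in U. x i \<in> carrier R)}"
  "x \<otimes>\<^bsub>ultrapower U R\<^esub> y = unf U (\<lambda>i. x i \<otimes>\<^bsub>R\<^esub> y i)"
  "\<one>\<^bsub>ultrapower U R\<^esub> = unf U (\<lambda>_. \<one>\<^bsub>R\<^esub>)"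
  "\<zero>\<^bsub>ultrapower U R\<^esub> = unf U (\<lambda>_. \<zero>\<^bsub>R\<^esub>)"
  "x \<oplus>\<^bsub>ultrapower U R\<^esub> y = unf U (\<lambda>i. x i \<oplus>\<^bsub>R\<^esub> y i)"
  by (simp_all add: ultrapower_def ring.defs)

locale field_ultrapower = field R for R (structure) +
  fixes U :: "'i filter"
  assumes U_proper: "U \<noteq> bot"
    and U_ultra: "eventually P U \<or> eventually (\<lambda>i. \<not> P i) U"
begin

abbreviation UR :: "('i \<Rightarrow> 'a) ring" where "UR \<equiv> ultrapower U R"

lemma UR_carrier: "x \<in> carrier UR \<longleftrightarrow> unf U x = x \<and> (\<forall>\<^sub>F i in U. x i \<in> carrier R)"
  by (simp add: ultrapower_simps)

lemma UR_coord: "x \<in> carrier UR \<Longrightarrow> \<forall>\<^sub>F i in U. x i \<in> carrier R"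
  by (simp add: UR_carrier)

lemma UR_eqI: "\<lbrakk>x \<in> carrier UR; y \<in> carrier UR; \<forall>\<^sub>F i in U. x i = y i\<rbrakk> \<Longrightarrow> x = y"
  using unf_cong[of x y U] by (simp add: UR_carrier)

lemma unf_closed: "\<forall>\<^sub>F i in U. x i \<in> carrier R \<Longrightarrow> unf U x \<in> carrier UR"
  using unf_eventually[of U x] by (auto simp: UR_carrier elim: eventually_elim2)

lemma UR_mult: "\<forall>\<^sub>F i in U. (x \<otimes>\<^bsub>UR\<^esub> y) i = x i \<otimes> y i"
  and UR_add: "\<forall>\<^sub>F i in U. (x \<oplus>\<^bsub>UR\<^esub> y) i = x i \<oplus> y i"
  and UR_one: "\<forall>\<^sub>F i in U. \<one>\<^bsub>UR\<^esub> i = \<one>"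
  and UR_zero: "\<forall>\<^sub>F i in U. \<zero>\<^bsub>UR\<^esub> i = \<zero>"
  by (simp_all add: ultrapower_simps unf_eventually)

lemma UR_closed:
  shows "\<lbrakk>x \<in> carrier UR; y \<in> carrier UR\<rbrakk> \<Longrightarrow> x \<otimes>\<^bsub>UR\<^esub> y \<in> carrier UR"
    and "\<lbrakk>x \<in> carrier UR; y \<in> carrier UR\<rbrakk> \<Longrightarrow> x \<oplus>\<^bsub>UR\<^esub> y \<in> carrier UR"
    and "\<one>\<^bsub>UR\<^esub> \<in> carrier UR" and "\<zero>\<^bsub>UR\<^esub> \<in> carrier UR"
proof -
  show "x \<otimes>\<^bsub>UR\<^esub> y \<in> carrier UR" "x \<oplus>\<^bsub>UR\<^esub> y \<in> carrier UR" if "x \<in> carrier UR" "y \<in> carrier UR"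
    unfolding ultrapower_simps(2,5) using UR_coord[OF that(1)] UR_coord[OF that(2)]
    by (auto intro!: unf_closed elim: eventually_elim2)
  show "\<one>\<^bsub>UR\<^esub> \<in> carrier UR" "\<zero>\<^bsub>UR\<^esub> \<in> carrier UR"
    using unf_closed[of "\<lambda>_. \<one>"] unf_closed[of "\<lambda>_. \<zero>"] by (simp_all add: ultrapower_simps)
qed

text \<open>Among the field axioms this is the one that uses the dichotomy \<open>U_ultra\<close>: a
  nonzero class is nonzero at almost all indices and can be inverted there.\<close>

lemma UR_inverse:
  assumes x: "x \<in> carrier UR" "x \<noteq> \<zero>\<^bsub>UR\<^esub>"
  shows "\<exists>y\<in>carrier UR. x \<otimes>\<^bsub>UR\<^esub> y = \<one>\<^bsub>UR\<^esub>"
proof -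
  have "\<not> (\<forall>\<^sub>F i in U. x i = \<zero>)"
  proof
    assume "\<forall>\<^sub>F i in U. x i = \<zero>"
    then have "x = \<zero>\<^bsub>UR\<^esub>" using UR_zero by (intro UR_eqI[OF x(1) UR_closed(4)]) (auto elim: eventually_elim2)
    then show False using x by simp
  qed
  then have nz: "\<forall>\<^sub>F i in U. x i \<noteq> \<zero>" using U_ultra by blast
  define y where "y = unf U (\<lambda>i. inv (x i))"
  have u: "\<forall>\<^sub>F i in U. x i \<in> Units R"
    using nz UR_coord[OF x(1)] by eventually_elim (simp add: field_Units)
  then have yc: "y \<in> carrier UR"
    unfolding y_def by (intro unf_closed) (auto elim: eventually_mono)
  have "x \<otimes>\<^bsub>UR\<^esub> y = \<one>\<^bsub>UR\<^esub>"
  proof (rule UR_eqI)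
    show "\<forall>\<^sub>F i in U. (x \<otimes>\<^bsub>UR\<^esub> y) i = \<one>\<^bsub>UR\<^esub> i"
      using u UR_mult[of x y] UR_one unf_eventually[of U "\<lambda>i. inv (x i)", folded y_def]
      by eventually_elim simp
  qed (use x yc UR_closed in auto)
  then show ?thesis using yc by blast
qed

lemma UR_field: "field UR"
proof -
  have "abelian_group UR"
  proof (rule abelian_groupI)
    fix x y z assume x: "x \<in> carrier UR" and y: "y \<in> carrier UR" and z: "z \<in> carrier UR"
    show "x \<oplus>\<^bsub>UR\<^esub> y \<in> carrier UR" using UR_closed x y by blast
    show "x \<oplus>\<^bsub>UR\<^esub> y = y \<oplus>\<^bsub>UR\<^esub> x"
    proof (rule UR_eqI)
      show "\<forall>\<^sub>F i in U. (x \<oplus>\<^bsub>UR\<^esub> y) i = (y \<oplus>\<^bsub>UR\<^esub> x) i"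
        using UR_add[of x y] UR_add[of y x] UR_coord[OF x] UR_coord[OF y]
        by eventually_elim (simp add: a_comm)
    qed (use UR_closed x y in auto)
    show "x \<oplus>\<^bsub>UR\<^esub> y \<oplus>\<^bsub>UR\<^esub> z = x \<oplus>\<^bsub>UR\<^esub> (y \<oplus>\<^bsub>UR\<^esub> z)"
    proof (rule UR_eqI)
      show "\<forall>\<^sub>F i in U. (x \<oplus>\<^bsub>UR\<^esub> y \<oplus>\<^bsub>UR\<^esub> z) i = (x \<oplus>\<^bsub>UR\<^esub> (y \<oplus>\<^bsub>UR\<^esub> z)) i"
        using UR_add[of x y] UR_add[of "x \<oplus>\<^bsub>UR\<^esub> y" z] UR_add[of y z] UR_add[of x "y \<oplus>\<^bsub>UR\<^esub> z"]
          UR_coord[OF x] UR_coord[OF y] UR_coord[OF z]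
        by eventually_elim (simp add: a_assoc)
    qed (use UR_closed x y z in auto)
    show "\<zero>\<^bsub>UR\<^esub> \<oplus>\<^bsub>UR\<^esub> x = x"
    proof (rule UR_eqI)
      show "\<forall>\<^sub>F i in U. (\<zero>\<^bsub>UR\<^esub> \<oplus>\<^bsub>UR\<^esub> x) i = x i"
        using UR_add[of "\<zero>\<^bsub>UR\<^esub>" x] UR_zero UR_coord[OF x] by eventually_elim simp
    qed (use UR_closed x in auto)
    show "\<exists>y\<in>carrier UR. y \<oplus>\<^bsub>UR\<^esub> x = \<zero>\<^bsub>UR\<^esub>"
    proof
      define w where "w = unf U (\<lambda>i. \<ominus> x i)"
      show w: "w \<in> carrier UR"
        unfolding w_def using UR_coord[OF x] by (intro unf_closed) (auto elim: eventually_mono)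
      show "w \<oplus>\<^bsub>UR\<^esub> x = \<zero>\<^bsub>UR\<^esub>"
      proof (rule UR_eqI)
        show "\<forall>\<^sub>F i in U. (w \<oplus>\<^bsub>UR\<^esub> x) i = \<zero>\<^bsub>UR\<^esub> i"
          using UR_add[of w x] UR_zero UR_coord[OF x] unf_eventually[of U "\<lambda>i. \<ominus> x i", folded w_def]
          by eventually_elim (simp add: l_neg)
      qed (use UR_closed x w in auto)
    qed
  qed (rule UR_closed)
  moreover have "comm_monoid UR"
  proof (rule comm_monoidI)
    fix x y z assume x: "x \<in> carrier UR" and y: "y \<in> carrier UR" and z: "z \<in> carrier UR"
    show "x \<otimes>\<^bsub>UR\<^esub> y \<in> carrier UR" using UR_closed x y by blast
    show "x \<otimes>\<^bsub>UR\<^esub> y = y \<otimes>\<^bsub>UR\<^esub> x"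
    proof (rule UR_eqI)
      show "\<forall>\<^sub>F i in U. (x \<otimes>\<^bsub>UR\<^esub> y) i = (y \<otimes>\<^bsub>UR\<^esub> x) i"
        using UR_mult[of x y] UR_mult[of y x] UR_coord[OF x] UR_coord[OF y]
        by eventually_elim (simp add: m_comm)
    qed (use UR_closed x y in auto)
    show "x \<otimes>\<^bsub>UR\<^esub> y \<otimes>\<^bsub>UR\<^esub> z = x \<otimes>\<^bsub>UR\<^esub> (y \<otimes>\<^bsub>UR\<^esub> z)"
    proof (rule UR_eqI)
      show "\<forall>\<^sub>F i in U. (x \<otimes>\<^bsub>UR\<^esub> y \<otimes>\<^bsub>UR\<^esub> z) i = (x \<otimes>\<^bsub>UR\<^esub> (y \<otimes>\<^bsub>UR\<^esub> z)) i"
        using UR_mult[of x y] UR_mult[of "x \<otimes>\<^bsub>UR\<^esub> y" z] UR_mult[of y z] UR_mult[of x "y \<otimes>\<^bsub>UR\<^esub> z"]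
          UR_coord[OF x] UR_coord[OF y] UR_coord[OF z]
        by eventually_elim (simp add: m_assoc)
    qed (use UR_closed x y z in auto)
    show "\<one>\<^bsub>UR\<^esub> \<otimes>\<^bsub>UR\<^esub> x = x"
    proof (rule UR_eqI)
      show "\<forall>\<^sub>F i in U. (\<one>\<^bsub>UR\<^esub> \<otimes>\<^bsub>UR\<^esub> x) i = x i"
        using UR_mult[of "\<one>\<^bsub>UR\<^esub>" x] UR_one UR_coord[OF x] by eventually_elim simp
    qed (use UR_closed x in auto)
  qed (rule UR_closed)
  ultimately have "cring UR"
  proof (rule cringI)
    fix x y z assume x: "x \<in> carrier UR" and y: "y \<in> carrier UR" and z: "z \<in> carrier UR"
    show "(x \<oplus>\<^bsub>UR\<^esub> y) \<otimes>\<^bsub>UR\<^esub> z = x \<otimes>\<^bsub>UR\<^esub> z \<oplus>\<^bsub>UR\<^esub> y \<otimes>\<^bsub>UR\<^esub> z"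
    proof (rule UR_eqI)
      show "\<forall>\<^sub>F i in U. ((x \<oplus>\<^bsub>UR\<^esub> y) \<otimes>\<^bsub>UR\<^esub> z) i = (x \<otimes>\<^bsub>UR\<^esub> z \<oplus>\<^bsub>UR\<^esub> y \<otimes>\<^bsub>UR\<^esub> z) i"
        using UR_add[of x y] UR_mult[of "x \<oplus>\<^bsub>UR\<^esub> y" z] UR_mult[of x z] UR_mult[of y z]
          UR_add[of "x \<otimes>\<^bsub>UR\<^esub> z" "y \<otimes>\<^bsub>UR\<^esub> z"] UR_coord[OF x] UR_coord[OF y] UR_coord[OF z]
        by eventually_elim (simp add: l_distr)
    qed (use UR_closed x y z in auto)
  qed
  then interpret UR: cring UR .
  show "field UR"
  proof (rule UR.cring_fieldI2)
    show "\<zero>\<^bsub>UR\<^esub> \<noteq> \<one>\<^bsub>UR\<^esub>"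
    proof
      assume *: "\<zero>\<^bsub>UR\<^esub> = \<one>\<^bsub>UR\<^esub>"
      have "\<forall>\<^sub>F i in U. False"
        using UR_zero UR_one unfolding * by eventually_elim simp
      then show False using U_proper by (simp add: trivial_limit_def)
    qed
  qed (rule UR_inverse)
qed

sublocale UR: field UR by (rule UR_field)

lemma UR_uminus: assumes x: "x \<in> carrier UR" shows "\<forall>\<^sub>F i in U. (\<ominus>\<^bsub>UR\<^esub> x) i = \<ominus> x i"
proof -
  have "\<ominus>\<^bsub>UR\<^esub> x \<oplus>\<^bsub>UR\<^esub> x = \<zero>\<^bsub>UR\<^esub>" using x by (rule UR.l_neg)
  then have "\<forall>\<^sub>F i in U. (\<ominus>\<^bsub>UR\<^esub> x) i \<oplus> x i = \<zero>"
    using UR_add[of "\<ominus>\<^bsub>UR\<^esub> x" x] UR_zero by (auto elim: eventually_elim2)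
  then show ?thesis using UR_coord[OF x] UR_coord[OF UR.a_inv_closed[OF x]]
    by eventually_elim (metis minus_equality)
qed

lemma UR_minus:
  assumes "x \<in> carrier UR" "y \<in> carrier UR" shows "\<forall>\<^sub>F i in U. (x \<ominus>\<^bsub>UR\<^esub> y) i = x i \<ominus> y i"
  using UR_uminus[OF assms(2)] UR_add[of x "\<ominus>\<^bsub>UR\<^esub> y"] by eventually_elim (simp add: a_minus_def)

lemma UR_pow: "\<forall>\<^sub>F i in U. (x [^]\<^bsub>UR\<^esub> (n::nat)) i = x i [^] n"
proof (induction n)
  case 0
  then show ?case using UR_one by simp
next
  case (Suc n)
  then show ?case using UR_mult[of "x [^]\<^bsub>UR\<^esub> n" x] by eventually_elim simp
qed

lemma UR_add_pow_one: "\<forall>\<^sub>F i in U. (add_pow UR (n::nat) \<one>\<^bsub>UR\<^esub>) i = add_pow R n \<one>"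
proof (induction n)
  case 0
  then show ?case using UR_zero by simp
next
  case (Suc n)
  then show ?case using UR_add[of "add_pow UR n \<one>\<^bsub>UR\<^esub>" "\<one>\<^bsub>UR\<^esub>"] UR_one by eventually_elim simp
qed

definition embed :: "'a \<Rightarrow> 'i \<Rightarrow> 'a" where "embed c = unf U (\<lambda>_. c)"

lemma embed_coord: "\<forall>\<^sub>F i in U. embed c i = c"
  using unf_eventually[of U "\<lambda>_. c"] by (simp add: embed_def)

lemma embed_closed: "c \<in> carrier R \<Longrightarrow> embed c \<in> carrier UR"
  unfolding embed_def by (rule unf_closed) simp

lemma embed_hom: "embed \<in> ring_hom R UR"
proof (rule ring_hom_memI)
  fix x y assume x: "x \<in> carrier R" and y: "y \<in> carrier R"
  show "embed x \<in> carrier UR" using embed_closed x .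
  show "embed (x \<otimes> y) = embed x \<otimes>\<^bsub>UR\<^esub> embed y"
  proof (rule UR_eqI)
    show "\<forall>\<^sub>F i in U. embed (x \<otimes> y) i = (embed x \<otimes>\<^bsub>UR\<^esub> embed y) i"
      using embed_coord[of "x \<otimes> y"] embed_coord[of x] embed_coord[of y] UR_mult[of "embed x" "embed y"]
      by eventually_elim simp
  qed (use x y embed_closed UR_closed in auto)
  show "embed (x \<oplus> y) = embed x \<oplus>\<^bsub>UR\<^esub> embed y"
  proof (rule UR_eqI)
    show "\<forall>\<^sub>F i in U. embed (x \<oplus> y) i = (embed x \<oplus>\<^bsub>UR\<^esub> embed y) i"
      using embed_coord[of "x \<oplus> y"] embed_coord[of x] embed_coord[of y] UR_add[of "embed x" "embed y"]
      by eventually_elim simp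
  qed (use x y embed_closed UR_closed in auto)
next
  show "embed \<one> = \<one>\<^bsub>UR\<^esub>" by (simp add: embed_def ultrapower_simps)
qed

end

locale frobenius_ultrapower = frobenius_lift + field_ultrapower
begin

definition ule :: "('c \<Rightarrow> 'a) \<Rightarrow> ('c \<Rightarrow> 'a) \<Rightarrow> bool" where
  "ule x y \<longleftrightarrow> (\<forall>\<^sub>F i in U. x i \<unlhd> y i)"

text \<open>Los's theorem for a negated relation: one direction uses that \<open>U\<close> is
  proper, the other its dichotomy.\<close>

lemma not_ule: "\<not> ule x y \<longleftrightarrow> (\<forall>\<^sub>F i in U. \<not> x i \<unlhd> y i)"
proof
  assume *: "\<forall>\<^sub>F i in U. \<not> x i \<unlhd> y i"
  show "\<not> ule x y"
  proof
    assume "ule x y"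
    then have "\<forall>\<^sub>F i in U. False" using * unfolding ule_def by eventually_elim simp
    then show False using U_proper by (simp add: trivial_limit_def)
  qed
qed (use U_ultra[of "\<lambda>i. x i \<unlhd> y i"] in \<open>auto simp: ule_def\<close>)

lemma embed_ule: "ule (embed c) (embed d) \<longleftrightarrow> c \<unlhd> d"
proof
  assume "c \<unlhd> d"
  then show "ule (embed c) (embed d)"
    unfolding ule_def using embed_coord[of c] embed_coord[of d] by (auto elim: eventually_elim2)
next
  assume "ule (embed c) (embed d)"
  then have "\<forall>\<^sub>F i in U. c \<unlhd> d"
    unfolding ule_def using embed_coord[of c] embed_coord[of d] by eventually_elim simp
  then show "c \<unlhd> d" using U_proper by simp
qed

definition usigma :: "('c \<Rightarrow> 'a) \<Rightarrow> 'c \<Rightarrow> 'a" where "usigma x = unf U (\<lambda>i. \<sigma> (x i))"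

lemma usigma_coord: "\<forall>\<^sub>F i in U. usigma x i = \<sigma> (x i)"
  unfolding usigma_def by (rule unf_eventually)

lemma sigma_closed: "x \<in> carrier R \<Longrightarrow> \<sigma> x \<in> carrier R"
  using sigma_hom by (rule ring_hom_closed)

lemma usigma_closed: "x \<in> carrier UR \<Longrightarrow> usigma x \<in> carrier UR"
  unfolding usigma_def by (rule unf_closed) (use UR_coord[of x] sigma_closed in \<open>auto elim: eventually_mono\<close>)

lemma embed_sigma: "embed (\<sigma> c) = usigma (embed c)"
  unfolding usigma_def unfolding embed_def
  by (rule unf_cong) (use embed_coord[of c, unfolded embed_def] in \<open>auto elim: eventually_mono\<close>)

text \<open>The axioms hold at almost all indices; totality and strict comparisons are transported
  by \<open>not_ule\<close>.\<close>

lemma frobenius_lift_ultrapower: "frobenius_lift UR ule usigma p"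
proof -
  interpret V: valuation_preorder UR ule
  proof unfold_locales
    fix x y assume x: "x \<in> carrier UR" and y: "y \<in> carrier UR"
    show "ule x y \<or> ule y x"
    proof (rule disjCI)
      assume "\<not> ule y x"
      then have "\<forall>\<^sub>F i in U. \<not> y i \<unlhd> x i" by (simp add: not_ule)
      then show "ule x y" unfolding ule_def using UR_coord[OF x] UR_coord[OF y]
        by eventually_elim (use le_total in blast)
    qed
    fix z assume z: "z \<in> carrier UR"
    show "ule x z" if "ule x y" "ule y z"
      using that UR_coord[OF x] UR_coord[OF y] UR_coord[OF z] unfolding ule_def
      by eventually_elim (use le_trans in blast)
    show "ule x (y \<oplus>\<^bsub>UR\<^esub> z)" if "ule x y" "ule x z"
      using that UR_coord[OF x] UR_coord[OF y] UR_coord[OF z] UR_add[of y z] unfolding ule_def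
      by eventually_elim (simp add: le_add)
    show "ule (z \<otimes>\<^bsub>UR\<^esub> x) (z \<otimes>\<^bsub>UR\<^esub> y)" if "ule x y"
      using that UR_coord[OF x] UR_coord[OF y] UR_coord[OF z] UR_mult[of z x] UR_mult[of z y] unfolding ule_def
      by eventually_elim (simp add: le_mult_mono)
  next
    have "\<forall>\<^sub>F i in U. \<not> \<zero>\<^bsub>UR\<^esub> i \<unlhd> \<one>\<^bsub>UR\<^esub> i"
      using UR_zero UR_one by eventually_elim (simp add: not_zero_le_one)
    then show "\<not> ule \<zero>\<^bsub>UR\<^esub> \<one>\<^bsub>UR\<^esub>" by (simp add: not_ule)
  qed
  have pc: "add_pow UR p \<one>\<^bsub>UR\<^esub> \<in> carrier UR" by simp
  show ?thesis
  proof unfold_locales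
    show "usigma \<in> ring_hom UR UR"
    proof (rule ring_hom_memI)
      fix x y assume x: "x \<in> carrier UR" and y: "y \<in> carrier UR"
      show "usigma x \<in> carrier UR" using usigma_closed[OF x] .
      show "usigma (x \<otimes>\<^bsub>UR\<^esub> y) = usigma x \<otimes>\<^bsub>UR\<^esub> usigma y"
      proof (rule UR_eqI)
        show "\<forall>\<^sub>F i in U. usigma (x \<otimes>\<^bsub>UR\<^esub> y) i = (usigma x \<otimes>\<^bsub>UR\<^esub> usigma y) i"
          using usigma_coord[of "x \<otimes>\<^bsub>UR\<^esub> y"] usigma_coord[of x] usigma_coord[of y] UR_mult[of x y]
            UR_mult[of "usigma x" "usigma y"] UR_coord[OF x] UR_coord[OF y]
          by eventually_elim (simp add: ring_hom_mult[OF sigma_hom])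
      qed (use x y usigma_closed in auto)
      show "usigma (x \<oplus>\<^bsub>UR\<^esub> y) = usigma x \<oplus>\<^bsub>UR\<^esub> usigma y"
      proof (rule UR_eqI)
        show "\<forall>\<^sub>F i in U. usigma (x \<oplus>\<^bsub>UR\<^esub> y) i = (usigma x \<oplus>\<^bsub>UR\<^esub> usigma y) i"
          using usigma_coord[of "x \<oplus>\<^bsub>UR\<^esub> y"] usigma_coord[of x] usigma_coord[of y] UR_add[of x y]
            UR_add[of "usigma x" "usigma y"] UR_coord[OF x] UR_coord[OF y]
          by eventually_elim (simp add: ring_hom_add[OF sigma_hom])
      qed (use x y usigma_closed in auto)
    next
      show "usigma \<one>\<^bsub>UR\<^esub> = \<one>\<^bsub>UR\<^esub>"
      proof (rule UR_eqI)
        show "\<forall>\<^sub>F i in U. usigma \<one>\<^bsub>UR\<^esub> i = \<one>\<^bsub>UR\<^esub> i"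
          using usigma_coord[of "\<one>\<^bsub>UR\<^esub>"] UR_one by eventually_elim (simp add: ring_hom_one[OF sigma_hom])
      qed (use usigma_closed in auto)
    qed
  next
    fix x assume x: "x \<in> carrier UR"
    show "V.veq (usigma x) x"
      unfolding V.veq_def ule_def
    proof
      show "\<forall>\<^sub>F i in U. usigma x i \<unlhd> x i" using UR_coord[OF x] usigma_coord[of x]
        by eventually_elim (use sigma_veq in \<open>simp add: veq_def\<close>)
      show "\<forall>\<^sub>F i in U. x i \<unlhd> usigma x i" using UR_coord[OF x] usigma_coord[of x]
        by eventually_elim (use sigma_veq in \<open>simp add: veq_def\<close>)
    qed
    show "ule (add_pow UR p \<one>\<^bsub>UR\<^esub>) x" if "\<not> ule x \<one>\<^bsub>UR\<^esub>"
      using that UR_one UR_add_pow_one[of p] UR_coord[OF x] unfolding not_ule unfolding ule_def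
      by eventually_elim (simp add: p_least)
    show "ule (add_pow UR p \<one>\<^bsub>UR\<^esub>) (usigma x \<ominus>\<^bsub>UR\<^esub> x [^]\<^bsub>UR\<^esub> p)" if "ule \<one>\<^bsub>UR\<^esub> x"
      using that UR_one UR_add_pow_one[of p] UR_coord[OF x] usigma_coord[of x] UR_pow[of x p]
        UR_minus[OF usigma_closed[OF x] UR.nat_pow_closed[OF x, of p]]
      unfolding ule_def by eventually_elim (simp add: sigma_frobenius)
  next
    show "add_pow UR p \<one>\<^bsub>UR\<^esub> \<noteq> \<zero>\<^bsub>UR\<^esub>"
    proof
      assume *: "add_pow UR p \<one>\<^bsub>UR\<^esub> = \<zero>\<^bsub>UR\<^esub>"
      have "\<forall>\<^sub>F i in U. False"
        using UR_zero UR_add_pow_one[of p] unfolding * by eventually_elim (use p_nonzero in simp)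
      then show False using U_proper by (simp add: trivial_limit_def)
    qed
    show "\<not> ule (add_pow UR p \<one>\<^bsub>UR\<^esub>) \<one>\<^bsub>UR\<^esub>"
      unfolding not_ule using UR_one UR_add_pow_one[of p] by eventually_elim (use p_less in simp)
  qed
qed

end

section \<open>Equivalent pc-sequences\<close>

text \<open>Defined by negation so that \<open>vless\<close> in the definitions of pc-sequences and
  pseudolimits turns into a negated \<open>vle\<close> by unfolding alone; \<open>vle_iff\<close>
  shows that it is the intended order with v(0) infinite.\<close>

definition vle :: "('a, 'g, 'k, 'z) vfield_scheme \<Rightarrow> 'a \<Rightarrow> 'a \<Rightarrow> bool" where
  "vle K a b \<longleftrightarrow> \<not> vless K b a"

context valued_field begin

interpretation F: field "Fld K" by (rule Fld_field)
interpretation G: ordered_abelian_group "VGrp K" by (rule VGrp_ordered)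
interpretation R: field "RFld K" by (rule RFld_field)

lemma vle_iff:
  assumes "a \<in> carrier (Fld K)" "b \<in> carrier (Fld K)"
  shows "vle K a b \<longleftrightarrow> b = \<zero>\<^bsub>Fld K\<^esub> \<or> (a \<noteq> \<zero>\<^bsub>Fld K\<^esub> \<and> vmap K a \<preceq>\<^bsub>VGrp K\<^esub> vmap K b)"
proof (cases "a \<in> nonzeros K \<and> b \<in> nonzeros K")
  case True
  then have "vmap K a \<in> carrier (VGrp K)" "vmap K b \<in> carrier (VGrp K)" using vmap_closed by auto
  then show ?thesis
    using True G.ole_total[of "vmap K a" "vmap K b"] G.ole_antisym[of "vmap K a" "vmap K b"] G.ole_refl[of "vmap K a"]
    by (auto simp: vle_def vless_def olt_def nonzeros_def)
next
  case False
  then show ?thesis using assms by (auto simp: vle_def vless_def nonzeros_def)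
qed

lemma valuation_preorder_vle: "valuation_preorder (Fld K) (vle K)"
proof unfold_locales
  fix x y assume x: "x \<in> carrier (Fld K)" and y: "y \<in> carrier (Fld K)"
  have v: "z \<in> carrier (Fld K) \<Longrightarrow> z \<noteq> \<zero>\<^bsub>Fld K\<^esub> \<Longrightarrow> vmap K z \<in> carrier (VGrp K)" for z
    using vmap_closed by (simp add: nonzeros_def)
  show "vle K x y \<or> vle K y x"
    using G.ole_total[OF v v, of x y] x y by (auto simp: vle_iff)
  fix z assume z: "z \<in> carrier (Fld K)"
  show "vle K x z" if "vle K x y" "vle K y z"
    using that G.ole_trans[OF v[OF x] v[OF y] v[OF z]] x y z by (auto simp: vle_iff)
  show "vle K x (y \<oplus>\<^bsub>Fld K\<^esub> z)" if xy: "vle K x y" and xz: "vle K x z"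
  proof (cases "y = \<zero>\<^bsub>Fld K\<^esub> \<or> z = \<zero>\<^bsub>Fld K\<^esub> \<or> y \<oplus>\<^bsub>Fld K\<^esub> z = \<zero>\<^bsub>Fld K\<^esub>")
    case True
    then show ?thesis using xy xz x y z by (auto simp: vle_iff)
  next
    case False
    then have nz: "y \<in> nonzeros K" "z \<in> nonzeros K" "y \<oplus>\<^bsub>Fld K\<^esub> z \<in> nonzeros K"
      using y z by (auto simp: nonzeros_def)
    have "x \<noteq> \<zero>\<^bsub>Fld K\<^esub>" "vmap K x \<preceq>\<^bsub>VGrp K\<^esub> vmap K y" "vmap K x \<preceq>\<^bsub>VGrp K\<^esub> vmap K z"
      using xy xz x y z False by (auto simp: vle_iff)
    then have "vmap K x \<preceq>\<^bsub>VGrp K\<^esub> vmap K (y \<oplus>\<^bsub>Fld K\<^esub> z)" using vmap_add[OF nz v[OF x]] by blast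
    then show ?thesis using \<open>x \<noteq> \<zero>\<^bsub>Fld K\<^esub>\<close> x y z by (simp add: vle_iff)
  qed
  show "vle K (z \<otimes>\<^bsub>Fld K\<^esub> x) (z \<otimes>\<^bsub>Fld K\<^esub> y)" if xy: "vle K x y"
  proof (cases "z = \<zero>\<^bsub>Fld K\<^esub> \<or> y = \<zero>\<^bsub>Fld K\<^esub>")
    case True
    then show ?thesis using x y z by (auto simp: vle_iff)
  next
    case False
    then have x0: "x \<noteq> \<zero>\<^bsub>Fld K\<^esub>" "vmap K x \<preceq>\<^bsub>VGrp K\<^esub> vmap K y" using xy x y by (auto simp: vle_iff)
    have nz: "x \<in> nonzeros K" "y \<in> nonzeros K" "z \<in> nonzeros K" using x y z False x0 by (auto simp: nonzeros_def)
    have "vmap K (z \<otimes>\<^bsub>Fld K\<^esub> x) \<preceq>\<^bsub>VGrp K\<^esub> vmap K (z \<otimes>\<^bsub>Fld K\<^esub> y)"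
      using G.ole_mult_mono[OF vmap_closed vmap_closed vmap_closed x0(2), of z] nz by (simp add: vmap_mult)
    moreover have "z \<otimes>\<^bsub>Fld K\<^esub> x \<noteq> \<zero>\<^bsub>Fld K\<^esub>" using nonzeros_mult[OF nz(3,1)] by (simp add: nonzeros_def)
    ultimately show ?thesis using x y z by (simp add: vle_iff)
  qed
next
  show "\<not> vle K \<zero>\<^bsub>Fld K\<^esub> \<one>\<^bsub>Fld K\<^esub>" by (simp add: vle_iff)
qed

lemma valring_iff: "a \<in> carrier (Fld K) \<Longrightarrow> a \<in> valring K \<longleftrightarrow> vle K \<one>\<^bsub>Fld K\<^esub> a"
  by (simp add: valring_def vle_iff vmap_one)

lemma maxideal_iff:
  assumes a: "a \<in> carrier (Fld K)" shows "a \<in> maxideal K \<longleftrightarrow> \<not> vle K a \<one>\<^bsub>Fld K\<^esub>"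
proof (cases "a = \<zero>\<^bsub>Fld K\<^esub>")
  case True
  then show ?thesis by (simp add: maxideal_def vle_iff)
next
  case False
  then have "vmap K a \<in> carrier (VGrp K)" using a vmap_closed by (simp add: nonzeros_def)
  then show ?thesis
    using False a G.ole_total[of "vmap K a" "\<one>\<^bsub>VGrp K\<^esub>"] G.ole_antisym[of "vmap K a" "\<one>\<^bsub>VGrp K\<^esub>"] G.ole_refl[of "vmap K a"]
    by (auto simp: maxideal_def vle_iff vmap_one olt_def)
qed

lemma rmap_nat_pow:
  assumes "x \<in> valring K" shows "rmap K (x [^]\<^bsub>Fld K\<^esub> (n::nat)) = rmap K x [^]\<^bsub>RFld K\<^esub> n"
proof -
  have "x [^]\<^bsub>Fld K\<^esub> n \<in> valring K \<and> rmap K (x [^]\<^bsub>Fld K\<^esub> n) = rmap K x [^]\<^bsub>RFld K\<^esub> n"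
  proof (induction n)
    case 0
    then show ?case using ring_hom_one[OF rmap_hom] subringE(3)[OF valring_subring] by simp
  next
    case (Suc n)
    then show ?case
      using ring_hom_mult[OF rmap_hom, of "x [^]\<^bsub>Fld K\<^esub> n" x] subringE(6)[OF valring_subring] assms by simp
  qed
  then show ?thesis by blast
qed

end

text \<open>The condition on the residue automorphism says that \<sigma>(x) and x^p have the same
  residue, so their difference lies in the maximal ideal. By minimality of v(p), all elements of
  that ideal have value at least v(p).\<close>

lemma (in valued_difference_field) frobenius_lift_vle:
  assumes witt: "witt_case p K"
  shows "frobenius_lift (Fld K) (vle K) (aut K) p"
proof -
  interpret V: valuation_preorder "Fld K" "vle K" by (rule valuation_preorder_vle)
  have hom: "aut K \<in> ring_hom (Fld K) (Fld K)" using aut_iso by (simp add: ring_iso_def)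
  have p: "0 < p" "\<And>n::nat. 0 < n \<Longrightarrow> add_pow (Fld K) n \<one>\<^bsub>Fld K\<^esub> \<noteq> \<zero>\<^bsub>Fld K\<^esub>"
  proof -
    show "0 < p" using witt by (simp add: witt_case_def prime_gt_0_nat)
    fix n :: nat assume n: "0 < n"
    show "add_pow (Fld K) n \<one>\<^bsub>Fld K\<^esub> \<noteq> \<zero>\<^bsub>Fld K\<^esub>"
    proof
      assume z: "add_pow (Fld K) n \<one>\<^bsub>Fld K\<^esub> = \<zero>\<^bsub>Fld K\<^esub>"
      let ?P = "\<lambda>n::nat. 0 < n \<and> add_pow (Fld K) n \<one>\<^bsub>Fld K\<^esub> = \<zero>\<^bsub>Fld K\<^esub>"
      have "ring_char (Fld K) = (LEAST n. ?P n)" unfolding ring_char_def by (rule if_P) (use n z in blast)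
      moreover have "?P (LEAST n. ?P n)" by (rule LeastI[of ?P n]) (use n z in simp)
      ultimately show False using witt by (simp add: witt_case_def)
    qed
  qed
  have p_least: "vle K (add_pow (Fld K) p \<one>\<^bsub>Fld K\<^esub>) x" if x: "x \<in> maxideal K" for x
  proof (cases "x = \<zero>\<^bsub>Fld K\<^esub>")
    case True
    then show ?thesis by (simp add: vle_iff)
  next
    case False
    then have "x \<in> carrier (Fld K)" "\<one>\<^bsub>VGrp K\<^esub> \<prec>\<^bsub>VGrp K\<^esub> vmap K x" using x by (auto simp: maxideal_def)
    moreover from this have "vmap K x \<in> carrier (VGrp K)" using vmap_closed False by (simp add: nonzeros_def)
    ultimately show ?thesis using witt p by (simp add: vle_iff witt_case_def)
  qed
  show ?thesis
  proof unfold_locales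
    show "aut K \<in> ring_hom (Fld K) (Fld K)" by (rule hom)
    show "add_pow (Fld K) p \<one>\<^bsub>Fld K\<^esub> \<noteq> \<zero>\<^bsub>Fld K\<^esub>" using p by blast
    have "\<one>\<^bsub>VGrp K\<^esub> \<prec>\<^bsub>VGrp K\<^esub> vmap K (add_pow (Fld K) p \<one>\<^bsub>Fld K\<^esub>)" using witt by (simp add: witt_case_def)
    then have "add_pow (Fld K) p \<one>\<^bsub>Fld K\<^esub> \<in> maxideal K" by (simp add: maxideal_def)
    then show "\<not> vle K (add_pow (Fld K) p \<one>\<^bsub>Fld K\<^esub>) \<one>\<^bsub>Fld K\<^esub>" by (simp add: maxideal_iff)
  next
    fix x assume x: "x \<in> carrier (Fld K)"
    show "vle K (add_pow (Fld K) p \<one>\<^bsub>Fld K\<^esub>) x" if "\<not> vle K x \<one>\<^bsub>Fld K\<^esub>"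
      using p_least[of x] maxideal_iff[OF x] that by simp
    have ax: "aut K x \<in> carrier (Fld K)" using ring_hom_closed[OF hom x] .
    show "V.veq (aut K x) x"
    proof (cases "x = \<zero>\<^bsub>Fld K\<^esub>")
      case True
      then have "aut K x = x" using ring_hom_zero[OF hom V.ring_axioms V.ring_axioms] by simp
      then show ?thesis using V.le_refl[OF x] by (simp add: V.veq_def)
    next
      case False
      then have nz: "x \<in> nonzeros K" using x by (simp add: nonzeros_def)
      \<comment> \<open>\<open>vmap\<close> is unspecified at zero, so comparing values presupposes
        that the image is nonzero.\<close>
      have "aut K x \<noteq> \<zero>\<^bsub>Fld K\<^esub>"
      proof
        assume "aut K x = \<zero>\<^bsub>Fld K\<^esub>"
        then have "aut K x = aut K \<zero>\<^bsub>Fld K\<^esub>" using ring_hom_zero[OF hom V.ring_axioms V.ring_axioms] by simp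
        moreover have "inj_on (aut K) (carrier (Fld K))" using aut_iso by (simp add: ring_iso_def bij_betw_def)
        ultimately show False using False x by (auto dest: inj_onD)
      qed
      then show ?thesis
        using aut_vmap[OF nz] False x ax ordered_abelian_group.ole_refl[OF VGrp_ordered vmap_closed[OF nz]]
        by (simp add: V.veq_def vle_iff)
    qed
    show "vle K (add_pow (Fld K) p \<one>\<^bsub>Fld K\<^esub>) (aut K x \<ominus>\<^bsub>Fld K\<^esub> x [^]\<^bsub>Fld K\<^esub> p)" if "vle K \<one>\<^bsub>Fld K\<^esub> x"
    proof (rule p_least)
      interpret R: field "RFld K" by (rule RFld_field)
      have xv: "x \<in> valring K" using valring_iff[OF x] that by simp
      have xp: "x [^]\<^bsub>Fld K\<^esub> p \<in> valring K" by (induction p) (use xv subringE(3,6)[OF valring_subring] in auto)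
      have av: "aut K x \<in> valring K" using aut_valring xv by blast
      have rc: "rmap K x \<in> carrier (RFld K)" using rmap_surj xv by blast
      have "rmap K (aut K x) = rmap K x [^]\<^bsub>RFld K\<^esub> p"
        using res_aut_rmap[OF xv] witt rc by (simp add: witt_case_def)
      then have "rmap K (aut K x \<ominus>\<^bsub>Fld K\<^esub> x [^]\<^bsub>Fld K\<^esub> p) = \<zero>\<^bsub>RFld K\<^esub>"
        using rmap_minus[OF av xp] rmap_nat_pow[OF xv] rc by (simp add: R.r_right_minus_eq)
      moreover have "aut K x \<ominus>\<^bsub>Fld K\<^esub> x [^]\<^bsub>Fld K\<^esub> p \<in> valring K"
        using av xp subringE(5,7)[OF valring_subring] by (simp add: a_minus_def)
      ultimately show "aut K x \<ominus>\<^bsub>Fld K\<^esub> x [^]\<^bsub>Fld K\<^esub> p \<in> maxideal K" using rmap_kernel by blast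
    qed
  qed
qed

text \<open>With x a pseudolimit and z a later term than y, the distance from y to x has the value
  of an increment of the sequence. In this way distances in an extension are measured inside the
  small field.\<close>

lemma (in valuation_preorder) veq_increment:
  assumes "x \<in> carrier R" "y \<in> carrier R" "z \<in> carrier R" "\<not> x \<ominus> z \<unlhd> x \<ominus> y"
  shows "z \<ominus> y \<asymp> x \<ominus> y"
proof -
  have "(x \<ominus> y) \<ominus> (x \<ominus> z) = z \<ominus> y"
    by (rule minus_eqI) (use assms in \<open>simp_all add: diff_add_diff a_comm[of "z \<ominus> y"]\<close>)
  then show ?thesis using veq_diff_strict[of "x \<ominus> y" "x \<ominus> z"] assms by simp
qed

text \<open>Both sequences have increments of value v(\<theta>), and they differ by at least
  v(\<theta>). This forces the distances of x from either sequence to have exactly the values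
  v(\<theta>), which increase strictly.\<close>

lemma (in valuation_preorder) pseudolimit_transfer:
  fixes a b \<theta> :: "'i::{wellorder,no_top} \<Rightarrow> 'a"
  assumes x: "x \<in> carrier R"
    and cl: "\<And>\<rho>. a \<rho> \<in> carrier R \<and> b \<rho> \<in> carrier R"
    and \<theta>: "\<And>\<rho>. \<rho>\<^sub>0 \<le> \<rho> \<Longrightarrow> \<theta> \<rho> \<in> carrier R \<and> \<theta> \<rho> \<unlhd> a \<rho> \<ominus> b \<rho>"
      "\<And>\<rho> \<rho>'. \<lbrakk>\<rho>\<^sub>0 \<le> \<rho>; \<rho> < \<rho>'\<rbrakk> \<Longrightarrow> \<not> \<theta> \<rho>' \<unlhd> \<theta> \<rho> \<and> a \<rho>' \<ominus> a \<rho> \<asymp> \<theta> \<rho> \<and> b \<rho>' \<ominus> b \<rho> \<asymp> \<theta> \<rho>"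
    and lim: "\<And>\<rho> \<rho>'. \<lbrakk>\<rho>\<^sub>1 \<le> \<rho>; \<rho> < \<rho>'\<rbrakk> \<Longrightarrow> \<not> x \<ominus> a \<rho>' \<unlhd> x \<ominus> a \<rho>"
  shows "\<exists>\<rho>\<^sub>1. \<forall>\<rho> \<rho>'. \<rho>\<^sub>1 \<le> \<rho> \<and> \<rho> < \<rho>' \<longrightarrow> \<not> x \<ominus> b \<rho>' \<unlhd> x \<ominus> b \<rho>"
proof -
  let ?m = "max \<rho>\<^sub>0 \<rho>\<^sub>1"
  have xa: "x \<ominus> a \<rho> \<asymp> \<theta> \<rho>" if "?m \<le> \<rho>" for \<rho>
  proof -
    obtain \<rho>' where \<rho>': "\<rho> < \<rho>'" using gt_ex by blast
    have "a \<rho>' \<ominus> a \<rho> \<asymp> x \<ominus> a \<rho>" using veq_increment[of x "a \<rho>" "a \<rho>'"] lim[of \<rho> \<rho>'] cl x that \<rho>' by simp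
    moreover have "a \<rho>' \<ominus> a \<rho> \<asymp> \<theta> \<rho>" using \<theta>(2)[of \<rho> \<rho>'] that \<rho>' by simp
    ultimately show ?thesis
      using veq_trans[of "x \<ominus> a \<rho>" "a \<rho>' \<ominus> a \<rho>" "\<theta> \<rho>"] veq_sym[of "a \<rho>' \<ominus> a \<rho>" "x \<ominus> a \<rho>"] cl x \<theta>(1)[of \<rho>] that by simp
  qed
  have xb: "x \<ominus> b \<rho> \<asymp> \<theta> \<rho>" if m: "?m \<le> \<rho>" for \<rho>
  proof -
    obtain \<rho>' where \<rho>': "\<rho> < \<rho>'" using gt_ex by blast
    have m': "?m \<le> \<rho>'" using order_trans[OF m less_imp_le[OF \<rho>']] .
    \<comment> \<open>At \<rho> itself the difference of a and b is only known to be at least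
      v(\<open>\<theta> \<rho>\<close>), which leaves room for cancellation. At a later index it is
      strictly larger, and the increment of b then determines the value.\<close>
    define w where "w = (x \<ominus> a \<rho>') \<oplus> (a \<rho>' \<ominus> b \<rho>')"
    have t: "\<theta> \<rho> \<in> carrier R" "\<theta> \<rho>' \<in> carrier R" "\<theta> \<rho>' \<unlhd> a \<rho>' \<ominus> b \<rho>'" using \<theta>(1) m m' by auto
    have inc: "\<not> \<theta> \<rho>' \<unlhd> \<theta> \<rho>" "b \<rho>' \<ominus> b \<rho> \<asymp> \<theta> \<rho>" using \<theta>(2)[of \<rho> \<rho>'] m \<rho>' by auto
    have wc: "w \<in> carrier R" using x cl by (simp add: w_def)
    have "\<theta> \<rho>' \<unlhd> w"
      unfolding w_def by (rule le_add) (use xa[OF m'] t x cl in \<open>simp_all add: veq_def\<close>)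
    then have "\<not> w \<unlhd> \<theta> \<rho>" using inc(1) le_trans[of "\<theta> \<rho>'" w "\<theta> \<rho>"] t wc by blast
    then have "\<not> w \<unlhd> b \<rho>' \<ominus> b \<rho>" using le_trans[of w "b \<rho>' \<ominus> b \<rho>" "\<theta> \<rho>"] inc(2) t wc cl by (auto simp: veq_def)
    then have "(b \<rho>' \<ominus> b \<rho>) \<oplus> w \<asymp> b \<rho>' \<ominus> b \<rho>"
      using strict_le_add[of "b \<rho>' \<ominus> b \<rho>" w] cl wc by (simp add: veq_def)
    moreover have "(b \<rho>' \<ominus> b \<rho>) \<oplus> w = x \<ominus> b \<rho>"
      using cl x by (simp add: w_def diff_add_diff a_comm[of "b \<rho>' \<ominus> b \<rho>"])
    ultimately show ?thesis using veq_trans[of "x \<ominus> b \<rho>" "b \<rho>' \<ominus> b \<rho>" "\<theta> \<rho>"] inc(2) cl x t by simp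
  qed
  show ?thesis
  proof (intro exI[of _ ?m] allI impI)
    fix \<rho> \<rho>' assume "?m \<le> \<rho> \<and> \<rho> < \<rho>'"
    then have \<rho>: "?m \<le> \<rho>" "?m \<le> \<rho>'" "\<rho>\<^sub>0 \<le> \<rho>" "\<rho>\<^sub>0 \<le> \<rho>'" "\<rho> < \<rho>'" by auto
    have "\<theta> \<rho> \<in> carrier R" "\<theta> \<rho>' \<in> carrier R" using \<theta>(1) \<rho>(3,4) by blast+
    then show "\<not> x \<ominus> b \<rho>' \<unlhd> x \<ominus> b \<rho>"
      using veq_le_iff[of "x \<ominus> b \<rho>'" "\<theta> \<rho>'" "x \<ominus> b \<rho>" "\<theta> \<rho>"] xb[OF \<rho>(1)] xb[OF \<rho>(2)] \<theta>(2)[OF \<rho>(3,5)] x cl by simp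
  qed
qed

lemma (in vf_extension) emb_vle_iff:
  "\<lbrakk>a \<in> carrier (Fld K); b \<in> carrier (Fld K)\<rbrakk> \<Longrightarrow> vle L (f a) (f b) \<longleftrightarrow> vle K a b"
  by (simp add: vle_def emb_vless_iff)

text \<open>The hypotheses concern K alone and are preserved by every embedding, so
  \<open>pseudolimit_transfer\<close> applies in each extension. Up to a sign they are symmetric in
  a and b, which gives both directions.\<close>

lemma (in valued_field) pc_equivI:
  fixes a b \<theta> :: "'i::{wellorder,no_top} \<Rightarrow> 'a"
  assumes cl: "\<And>\<rho>. a \<rho> \<in> carrier (Fld K)" "\<And>\<rho>. b \<rho> \<in> carrier (Fld K)"
    and \<theta>: "\<And>\<rho>. \<rho>\<^sub>0 \<le> \<rho> \<Longrightarrow> \<theta> \<rho> \<in> carrier (Fld K) \<and> vle K (\<theta> \<rho>) (a \<rho> \<ominus>\<^bsub>Fld K\<^esub> b \<rho>)"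
      "\<And>\<rho> \<rho>'. \<lbrakk>\<rho>\<^sub>0 \<le> \<rho>; \<rho> < \<rho>'\<rbrakk> \<Longrightarrow> \<not> vle K (\<theta> \<rho>') (\<theta> \<rho>) \<and>
         valuation_preorder.veq (vle K) (a \<rho>' \<ominus>\<^bsub>Fld K\<^esub> a \<rho>) (\<theta> \<rho>) \<and>
         valuation_preorder.veq (vle K) (b \<rho>' \<ominus>\<^bsub>Fld K\<^esub> b \<rho>) (\<theta> \<rho>)"
  shows "pc_equiv K a b"
  unfolding pc_equiv_def
proof (intro allI impI ballI, elim conjE)
  fix E :: "('a ext_univ, 'a ext_univ, 'a ext_univ) vfield" and f x
  assume E: "valued_field E" and f: "vf_embedding K E f" and x: "x \<in> carrier (Fld E)"
  interpret X: vf_extension K E f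
    by (intro vf_extension.intro vf_extension_axioms.intro valued_field_axioms E f)
  interpret V: valuation_preorder "Fld K" "vle K" by (rule valuation_preorder_vle)
  interpret W: valuation_preorder "Fld E" "vle E" by (rule X.L.valuation_preorder_vle)
  have veq: "W.veq (f c) (f d) \<longleftrightarrow> V.veq c d" if "c \<in> carrier (Fld K)" "d \<in> carrier (Fld K)" for c d
    using that by (simp add: W.veq_def V.veq_def X.emb_vle_iff)
  have fc: "f (a \<rho>) \<in> carrier (Fld E)" "f (b \<rho>) \<in> carrier (Fld E)" for \<rho> using cl X.emb_closed by auto
  have t1: "f (\<theta> \<rho>) \<in> carrier (Fld E) \<and> vle E (f (\<theta> \<rho>)) (f (a \<rho>) \<ominus>\<^bsub>Fld E\<^esub> f (b \<rho>))" if "\<rho>\<^sub>0 \<le> \<rho>" for \<rho>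
    using \<theta>(1)[OF that] cl X.emb_closed X.emb_vle_iff[of "\<theta> \<rho>" "a \<rho> \<ominus>\<^bsub>Fld K\<^esub> b \<rho>"] by (simp add: X.emb_minus)
  have t1': "f (\<theta> \<rho>) \<in> carrier (Fld E) \<and> vle E (f (\<theta> \<rho>)) (f (b \<rho>) \<ominus>\<^bsub>Fld E\<^esub> f (a \<rho>))" if "\<rho>\<^sub>0 \<le> \<rho>" for \<rho>
    using t1[OF that] W.le_minus_commute[of "f (\<theta> \<rho>)" "f (a \<rho>)" "f (b \<rho>)"] fc by simp
  have t2: "\<not> vle E (f (\<theta> \<rho>')) (f (\<theta> \<rho>)) \<and> W.veq (f (a \<rho>') \<ominus>\<^bsub>Fld E\<^esub> f (a \<rho>)) (f (\<theta> \<rho>)) \<and>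
      W.veq (f (b \<rho>') \<ominus>\<^bsub>Fld E\<^esub> f (b \<rho>)) (f (\<theta> \<rho>))" if "\<rho>\<^sub>0 \<le> \<rho>" "\<rho> < \<rho>'" for \<rho> \<rho>'
  proof -
    have "\<theta> \<rho> \<in> carrier (Fld K)" "\<theta> \<rho>' \<in> carrier (Fld K)" using \<theta>(1)[of \<rho>] \<theta>(1)[of \<rho>'] that by auto
    then show ?thesis
      using \<theta>(2)[OF that] cl X.emb_vle_iff[of "\<theta> \<rho>'" "\<theta> \<rho>"] veq[of "a \<rho>' \<ominus>\<^bsub>Fld K\<^esub> a \<rho>" "\<theta> \<rho>"]
        veq[of "b \<rho>' \<ominus>\<^bsub>Fld K\<^esub> b \<rho>" "\<theta> \<rho>"] by (simp add: X.emb_minus)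
  qed
  have lim: "pseudolimit E (f \<circ> c) x \<longleftrightarrow> (\<exists>\<rho>\<^sub>1. \<forall>\<rho> \<rho>'. \<rho>\<^sub>1 \<le> \<rho> \<and> \<rho> < \<rho>' \<longrightarrow>
      \<not> vle E (x \<ominus>\<^bsub>Fld E\<^esub> f (c \<rho>')) (x \<ominus>\<^bsub>Fld E\<^esub> f (c \<rho>)))" for c :: "'i \<Rightarrow> 'a"
    by (simp add: pseudolimit_def vle_def)
  show "pseudolimit E (f \<circ> a) x \<longleftrightarrow> pseudolimit E (f \<circ> b) x"
  proof
    assume "pseudolimit E (f \<circ> a) x"
    then obtain \<rho>\<^sub>1 where "\<And>\<rho> \<rho>'. \<lbrakk>\<rho>\<^sub>1 \<le> \<rho>; \<rho> < \<rho>'\<rbrakk> \<Longrightarrow> \<not> vle E (x \<ominus>\<^bsub>Fld E\<^esub> f (a \<rho>')) (x \<ominus>\<^bsub>Fld E\<^esub> f (a \<rho>))"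
      unfolding lim by blast
    then show "pseudolimit E (f \<circ> b) x" unfolding lim
      using W.pseudolimit_transfer[of x "\<lambda>\<rho>. f (a \<rho>)" "\<lambda>\<rho>. f (b \<rho>)" \<rho>\<^sub>0 "\<lambda>\<rho>. f (\<theta> \<rho>)" \<rho>\<^sub>1] x fc t1 t2 by blast
  next
    assume "pseudolimit E (f \<circ> b) x"
    then obtain \<rho>\<^sub>1 where "\<And>\<rho> \<rho>'. \<lbrakk>\<rho>\<^sub>1 \<le> \<rho>; \<rho> < \<rho>'\<rbrakk> \<Longrightarrow> \<not> vle E (x \<ominus>\<^bsub>Fld E\<^esub> f (b \<rho>')) (x \<ominus>\<^bsub>Fld E\<^esub> f (b \<rho>))"
      unfolding lim by blast
    then show "pseudolimit E (f \<circ> a) x" unfolding lim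
      using W.pseudolimit_transfer[of x "\<lambda>\<rho>. f (b \<rho>)" "\<lambda>\<rho>. f (a \<rho>)" \<rho>\<^sub>0 "\<lambda>\<rho>. f (\<theta> \<rho>)" \<rho>\<^sub>1] x fc t1' t2 by blast
  qed
qed

section \<open>\<sigma>-polynomials as finitely supported functions, and their behaviour under
  embeddings\<close>

lemma sigma_polysD:
  assumes "ring (Fld K)" "G \<in> sigma_polys K"
  shows "finite {m. G m \<noteq> \<zero>\<^bsub>Fld K\<^esub>} \<and> (\<forall>m. G m \<in> carrier (Fld K))"
proof -
  interpret F: ring "Fld K" by fact
  from assms(2)[unfolded sigma_polys_def] show ?thesis
  proof (induction rule: F.indexed_pset.induct)
    case (indexed_const k)
    have "{m. F.indexed_const k m \<noteq> \<zero>\<^bsub>Fld K\<^esub>} \<subseteq> {{#}}" by (auto simp: F.indexed_const_def)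
    then show ?case using indexed_const finite_subset by (auto simp: F.indexed_const_def)
  next
    case (indexed_padd P Q)
    have "{m. F.indexed_padd P Q m \<noteq> \<zero>\<^bsub>Fld K\<^esub>} \<subseteq> {m. P m \<noteq> \<zero>\<^bsub>Fld K\<^esub>} \<union> {m. Q m \<noteq> \<zero>\<^bsub>Fld K\<^esub>}"
      by (auto simp: F.indexed_padd_def)
    then show ?case using indexed_padd.IH finite_subset[OF _ finite_UnI] by (auto simp: F.indexed_padd_def)
  next
    case (indexed_pmult P i)
    have "{m. F.indexed_pmult P i m \<noteq> \<zero>\<^bsub>Fld K\<^esub>} \<subseteq> add_mset i ` {m. P m \<noteq> \<zero>\<^bsub>Fld K\<^esub>}"
    proof
      fix m assume "m \<in> {m. F.indexed_pmult P i m \<noteq> \<zero>\<^bsub>Fld K\<^esub>}"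
      then have "i \<in># m" "P (m - {#i#}) \<noteq> \<zero>\<^bsub>Fld K\<^esub>" by (auto simp: F.indexed_pmult_def split: if_splits)
      then show "m \<in> add_mset i ` {m. P m \<noteq> \<zero>\<^bsub>Fld K\<^esub>}" by (intro image_eqI[of _ _ "m - {#i#}"]) auto
    qed
    then have "finite {m. F.indexed_pmult P i m \<noteq> \<zero>\<^bsub>Fld K\<^esub>}"
      using indexed_pmult.IH by (blast intro: finite_subset)
    moreover have "\<forall>m. F.indexed_pmult P i m \<in> carrier (Fld K)"
      using indexed_pmult.IH by (simp add: F.indexed_pmult_def)
    ultimately show ?case by blast
  qed
qed

lemma nonconstantD:
  assumes "ring (Fld K)" "G \<in> sigma_polys K" "nonconstant K G"
  shows "\<exists>m. m \<noteq> {#} \<and> G m \<noteq> \<zero>\<^bsub>Fld K\<^esub>"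
proof (rule ccontr)
  interpret F: ring "Fld K" by fact
  assume "\<not> ?thesis"
  then have "G = F.indexed_const (G {#})" by (intro ext) (auto simp: F.indexed_const_def)
  moreover have "G {#} \<in> carrier (Fld K)" using sigma_polysD[OF assms(1,2)] by blast
  ultimately show False using assms(3) unfolding nonconstant_def by blast
qed

lemma sigma_eval_eq_poly_eval: "sigma_eval K G x = poly_eval (Fld K) G (\<lambda>i. (aut K ^^ i) x)"
  by (simp add: sigma_eval_def poly_eval_def mono_eval_def)

text \<open>The kernel condition makes g and its image have the same support, over which
  \<open>poly_eval\<close> sums.\<close>

lemma ring_hom_poly_eval:
  assumes "cring R" "cring S" "f \<in> ring_hom R S"
    and inj: "\<And>c. c \<in> carrier R \<Longrightarrow> f c = \<zero>\<^bsub>S\<^esub> \<Longrightarrow> c = \<zero>\<^bsub>R\<^esub>"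
    and g: "\<And>m. g m \<in> carrier R" and u: "\<And>i. u i \<in> carrier R"
  shows "f (poly_eval R g u) = poly_eval S (f \<circ> g) (f \<circ> u)"
proof -
  interpret f: ring_hom_cring R S f
    using assms by (simp add: ring_hom_cring_def ring_hom_cring_axioms_def)
  have "ring_hom_ring R S f"
    using assms(1-3) by (intro ring_hom_ringI2) (auto simp: cring_def)
  note pow = ring_hom_ring.hom_nat_pow[OF this]
  have mono: "f (mono_eval R u m) = mono_eval S (f \<circ> u) m" for m
    unfolding mono_eval_def using u
    by (subst f.hom_finprod) (auto simp: pow comp_def)
  have mc: "mono_eval R u m \<in> carrier R" for m using f.R.mono_eval_closed u by blast
  have "f (g m) \<noteq> \<zero>\<^bsub>S\<^esub> \<longleftrightarrow> g m \<noteq> \<zero>\<^bsub>R\<^esub>" for m using inj[OF g] by auto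
  then have supp: "{m. (f \<circ> g) m \<noteq> \<zero>\<^bsub>S\<^esub>} = {m. g m \<noteq> \<zero>\<^bsub>R\<^esub>}" by simp
  show ?thesis
    unfolding poly_eval_def supp using g mc
    by (subst f.hom_finsum) (auto simp: comp_def mono)
qed

text \<open>Common form of the two situations: f embeds K into a Frobenius lift that is either the
  field of an extension L or an ultrapower of the field of K.\<close>

locale witt_extension = K: valued_difference_field K + R: frobenius_lift R le \<sigma> p
  for K :: "('a, 'g, 'k, 'z) vdfield_scheme" and R :: "('b, 'm) ring_scheme" (structure)
    and le (infix \<open>\<unlhd>\<close> 50) and \<sigma> and p +
  fixes f :: "'a \<Rightarrow> 'b"
  assumes axiom2: "axiom2 K" and witt: "witt_case p K" and residues: "infinite (carrier (RFld K))"
    and f_hom: "f \<in> ring_hom (Fld K) R"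
    and f_le: "\<lbrakk>c \<in> carrier (Fld K); d \<in> carrier (Fld K)\<rbrakk> \<Longrightarrow> f c \<unlhd> f d \<longleftrightarrow> vle K c d"
    and f_aut: "c \<in> carrier (Fld K) \<Longrightarrow> f (aut K c) = \<sigma> (f c)"
begin

interpretation F: field "Fld K" by (rule K.Fld_field)
interpretation V: frobenius_lift "Fld K" "vle K" "aut K" p by (rule K.frobenius_lift_vle[OF witt])
interpretation f: ring_hom_cring "Fld K" R f
  using f_hom F.cring_axioms R.cring_axioms by (simp add: ring_hom_cring_def ring_hom_cring_axioms_def)

lemma f_pow: "c \<in> carrier (Fld K) \<Longrightarrow> f (c [^]\<^bsub>Fld K\<^esub> (n::nat)) = f c [^] n"
  by (rule ring_hom_ring.hom_nat_pow[OF ring_hom_ringI2[OF F.ring_axioms R.ring_axioms f_hom]])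

lemma f_minus: "\<lbrakk>c \<in> carrier (Fld K); d \<in> carrier (Fld K)\<rbrakk> \<Longrightarrow> f (c \<ominus>\<^bsub>Fld K\<^esub> d) = f c \<ominus> f d"
  by (simp add: a_minus_def)

lemma f_zero_iff: "\<lbrakk>c \<in> carrier (Fld K); f c = \<zero>\<rbrakk> \<Longrightarrow> c = \<zero>\<^bsub>Fld K\<^esub>"
  using f_le[of "\<zero>\<^bsub>Fld K\<^esub>" c] R.le_refl[of \<zero>] V.zero_le[of c] by simp

lemma f_add_pow_one: "f (add_pow (Fld K) (n::nat) \<one>\<^bsub>Fld K\<^esub>) = add_pow R n \<one>"
  by (induction n) simp_all

lemma f_inj: "inj_on f (carrier (Fld K))"
proof (rule inj_onI)
  fix c d assume cd: "c \<in> carrier (Fld K)" "d \<in> carrier (Fld K)" "f c = f d"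
  then have "f (c \<ominus>\<^bsub>Fld K\<^esub> d) = \<zero>" by (simp add: f_minus R.r_right_minus_eq)
  then show "c = d" using f_zero_iff[of "c \<ominus>\<^bsub>Fld K\<^esub> d"] cd by (simp add: F.r_right_minus_eq)
qed

lemma f_veq:
  "\<lbrakk>c \<in> carrier (Fld K); d \<in> carrier (Fld K)\<rbrakk> \<Longrightarrow> R.veq (f c) (f d) \<longleftrightarrow> V.veq c d"
  by (simp add: R.veq_def V.veq_def f_le)

lemma witt_difference_image: "witt_difference R le \<sigma> p (f ` valring K)"
proof (intro witt_difference.intro witt_difference_axioms.intro R.frobenius_lift_axioms)
  note sr = K.valring_subring
  have vc: "c \<in> carrier (Fld K)" if "c \<in> valring K" for c using that by (simp add: valring_def)
  show "x \<in> carrier R \<and> \<one> \<unlhd> x" if xf: "x \<in> f ` valring K" for x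
  proof -
    obtain c where c: "c \<in> valring K" "x = f c" using xf by blast
    then show ?thesis using f_le[of "\<one>\<^bsub>Fld K\<^esub>" c] K.valring_iff[of c] vc[of c] by simp
  qed
  show "\<zero> \<in> f ` valring K" using subringE(2)[OF sr] by (intro image_eqI[of _ _ "\<zero>\<^bsub>Fld K\<^esub>"]) simp_all
  show "x \<oplus> add_pow R p \<one> [^] (i::nat) \<otimes> y \<in> f ` valring K" if xy: "x \<in> f ` valring K" "y \<in> f ` valring K" for x y i
  proof -
    obtain c d where c: "c \<in> valring K" "x = f c" "d \<in> valring K" "y = f d" using xy by blast
    let ?q = "add_pow (Fld K) p \<one>\<^bsub>Fld K\<^esub> [^]\<^bsub>Fld K\<^esub> i"
    have "vle K \<one>\<^bsub>Fld K\<^esub> ?q" by (intro V.one_le_pow V.one_le_add_pow) simp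
    then have "?q \<in> valring K" by (simp add: K.valring_iff)
    then have "c \<oplus>\<^bsub>Fld K\<^esub> ?q \<otimes>\<^bsub>Fld K\<^esub> d \<in> valring K" using c subringE(6,7)[OF sr] by blast
    moreover have "f (c \<oplus>\<^bsub>Fld K\<^esub> ?q \<otimes>\<^bsub>Fld K\<^esub> d) = x \<oplus> add_pow R p \<one> [^] i \<otimes> y"
      using c vc by (simp add: f_pow f_add_pow_one)
    ultimately show ?thesis by (intro image_eqI[of _ _ "c \<oplus>\<^bsub>Fld K\<^esub> ?q \<otimes>\<^bsub>Fld K\<^esub> d"]) simp_all
  qed
  \<comment> \<open>One representative for each residue class. Different ones have different
    residues, so their difference is not divisible by p; this is where the residue field of K has to
    be infinite.\<close>
  obtain Z where Z: "Z \<subseteq> valring K" "inj_on (rmap K) Z" "carrier (RFld K) = rmap K ` Z"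
    using subset_image_inj[of "carrier (RFld K)" "rmap K" "valring K"] K.rmap_surj by auto
  have infZ: "infinite Z" using residues Z(3) by auto
  have dist: "\<not> vle K (add_pow (Fld K) p \<one>\<^bsub>Fld K\<^esub>) (c \<ominus>\<^bsub>Fld K\<^esub> d)"
    if cd: "c \<in> Z" "d \<in> Z" "c \<noteq> d" for c d
  proof
    assume le: "vle K (add_pow (Fld K) p \<one>\<^bsub>Fld K\<^esub>) (c \<ominus>\<^bsub>Fld K\<^esub> d)"
    have c: "c \<in> valring K" "d \<in> valring K" "c \<in> carrier (Fld K)" "d \<in> carrier (Fld K)" using cd Z vc by auto
    have "\<not> vle K (c \<ominus>\<^bsub>Fld K\<^esub> d) \<one>\<^bsub>Fld K\<^esub>"
      using V.le_trans[OF _ _ _ le, of "\<one>\<^bsub>Fld K\<^esub>"] V.p_less c by auto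
    then have "c \<ominus>\<^bsub>Fld K\<^esub> d \<in> maxideal K" using K.maxideal_iff c by simp
    then have "rmap K (c \<ominus>\<^bsub>Fld K\<^esub> d) = \<zero>\<^bsub>RFld K\<^esub>" using K.rmap_kernel by blast
    interpret RK: field "RFld K" by (rule K.RFld_field)
    have "rmap K c \<in> carrier (RFld K)" "rmap K d \<in> carrier (RFld K)" using K.rmap_surj c by blast+
    moreover have "rmap K c \<ominus>\<^bsub>RFld K\<^esub> rmap K d = \<zero>\<^bsub>RFld K\<^esub>"
      using K.rmap_minus[OF c(1,2)] \<open>rmap K (c \<ominus>\<^bsub>Fld K\<^esub> d) = \<zero>\<^bsub>RFld K\<^esub>\<close> by simp
    ultimately have "rmap K c = rmap K d" by (simp add: RK.r_right_minus_eq)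
    then show False using Z(2) cd by (auto dest: inj_onD)
  qed
  show "\<exists>Z\<subseteq>f ` valring K. infinite Z \<and> (\<forall>x\<in>Z. \<forall>y\<in>Z. x \<noteq> y \<longrightarrow> \<not> add_pow R p \<one> \<unlhd> x \<ominus> y)"
  proof (intro exI[of _ "f ` Z"] conjI ballI impI)
    show "f ` Z \<subseteq> f ` valring K" using Z by blast
    have "inj_on f Z" using f_inj Z(1) vc by (meson inj_on_subset subset_iff)
    then show "infinite (f ` Z)" using infZ finite_imageD by blast
    fix x y assume "x \<in> f ` Z" "y \<in> f ` Z" "x \<noteq> y"
    then obtain c d where cd: "c \<in> Z" "x = f c" "d \<in> Z" "y = f d" "c \<noteq> d" by blast
    have c: "c \<in> carrier (Fld K)" "d \<in> carrier (Fld K)" using cd Z vc by auto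
    then show "\<not> add_pow R p \<one> \<unlhd> x \<ominus> y"
      using dist[OF cd(1,3,5)] f_le[of "add_pow (Fld K) p \<one>\<^bsub>Fld K\<^esub>" "c \<ominus>\<^bsub>Fld K\<^esub> d"] cd
      by (simp add: f_minus f_add_pow_one)
  qed
qed

lemma f_orbit: "c \<in> carrier (Fld K) \<Longrightarrow> f ((aut K ^^ i) c) = (\<sigma> ^^ i) (f c) \<and> (aut K ^^ i) c \<in> carrier (Fld K)"
  by (induction i) (use f_aut ring_hom_closed[OF V.sigma_hom] in auto)

lemma f_sigma_eval:
  assumes "G \<in> sigma_polys K" "c \<in> carrier (Fld K)"
  shows "f (sigma_eval K G c) = poly_eval R (f \<circ> G) (\<lambda>i. (\<sigma> ^^ i) (f c))"
    and "sigma_eval K G c \<in> carrier (Fld K)"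
proof -
  have G: "\<And>m. G m \<in> carrier (Fld K)" using sigma_polysD[OF F.ring_axioms assms(1)] by blast
  have o: "(aut K ^^ i) c \<in> carrier (Fld K)" for i using f_orbit[OF assms(2)] by blast
  have "f (sigma_eval K G c) = poly_eval R (f \<circ> G) (f \<circ> (\<lambda>i. (aut K ^^ i) c))"
    unfolding sigma_eval_eq_poly_eval
    by (rule ring_hom_poly_eval[OF F.cring_axioms R.cring_axioms f_hom f_zero_iff G o])
  then show "f (sigma_eval K G c) = poly_eval R (f \<circ> G) (\<lambda>i. (\<sigma> ^^ i) (f c))"
    using f_orbit[OF assms(2)] by (simp add: comp_def)
  show "sigma_eval K G c \<in> carrier (Fld K)"
    unfolding sigma_eval_eq_poly_eval poly_eval_def using G o
    by (intro F.finsum_closed) (auto intro!: F.m_closed F.mono_eval_closed)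
qed

text \<open>Axiom 2 gives fixed \<theta> with the values of x - a, and
  \<open>exists_generic_shift\<close> gives the \<mu> and the growth of G. Equivalence follows from
  \<open>pc_equivI\<close>, since b - a = \<theta> \<mu> with \<mu> integral.\<close>

theorem exists_equivalent_pc_sequence:
  fixes a :: "'i::{wellorder,no_top} \<Rightarrow> 'a"
  assumes a: "\<And>\<rho>. a \<rho> \<in> carrier (Fld K)" and x: "x \<in> carrier R"
    and lim: "\<And>\<rho> \<rho>'. \<lbrakk>\<rho>\<^sub>0 \<le> \<rho>; \<rho> < \<rho>'\<rbrakk> \<Longrightarrow> \<not> x \<ominus> f (a \<rho>') \<unlhd> x \<ominus> f (a \<rho>)"
    and S: "finite S" "S \<subseteq> sigma_polys K"
  shows "\<exists>b. pc_sequence K b \<and> pc_equiv K a b \<and> (\<forall>G\<in>S. nonconstant K G \<longrightarrow>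
    (\<exists>\<rho>\<^sub>1. \<forall>\<rho> \<rho>'. \<rho>\<^sub>1 \<le> \<rho> \<and> \<rho> < \<rho>' \<longrightarrow>
      \<not> poly_eval R (f \<circ> G) (\<lambda>i. (\<sigma> ^^ i) x) \<ominus> f (sigma_eval K G (b \<rho>')) \<unlhd>
        poly_eval R (f \<circ> G) (\<lambda>i. (\<sigma> ^^ i) x) \<ominus> f (sigma_eval K G (b \<rho>))))"
proof -
  interpret D: witt_difference R le \<sigma> p "f ` valring K" by (rule witt_difference_image)
  have fa: "f (a \<rho>) \<in> carrier R" for \<rho> using a by simp
  have "\<exists>t. \<rho>\<^sub>0 \<le> \<rho> \<longrightarrow> t \<in> nonzeros K \<and> aut K t = t \<and> R.veq (f t) (x \<ominus> f (a \<rho>))" for \<rho>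
  proof (cases "\<rho>\<^sub>0 \<le> \<rho>")
    case True
    obtain \<rho>' where \<rho>': "\<rho> < \<rho>'" using gt_ex by blast
    \<comment> \<open>Axiom 2 applies to values of elements of K, but x -
      \<open>f (a \<rho>)\<close> lies in the extension. It has the value of the increment w, which
      lies in K.\<close>
    define w where "w = a \<rho>' \<ominus>\<^bsub>Fld K\<^esub> a \<rho>"
    have w: "w \<in> carrier (Fld K)" "f w = f (a \<rho>') \<ominus> f (a \<rho>)" using a by (simp_all add: w_def f_minus)
    have wx: "R.veq (f w) (x \<ominus> f (a \<rho>))" using R.veq_increment[OF x fa fa lim[OF True \<rho>']] w by simp
    \<comment> \<open>Otherwise x would equal \<open>f (a \<rho>)\<close>, and no later distance
      could have a value above v(0).\<close>
    have "w \<noteq> \<zero>\<^bsub>Fld K\<^esub>"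
    proof
      assume "w = \<zero>\<^bsub>Fld K\<^esub>"
      then have "\<zero> \<unlhd> x \<ominus> f (a \<rho>)" using wx by (simp add: R.veq_def)
      then have z: "x \<ominus> f (a \<rho>) = \<zero>" using R.zero_le[of "x \<ominus> f (a \<rho>)"] x fa by blast
      show False using lim[OF True \<rho>'] R.le_zero[of "x \<ominus> f (a \<rho>')"] x fa unfolding z by simp
    qed
    then have wn: "w \<in> nonzeros K" using w by (simp add: nonzeros_def)
    then obtain t where t: "t \<in> nonzeros K" "aut K t = t" "vmap K t = vmap K w"
      using axiom2 K.vmap_closed[OF wn] unfolding axiom2_def by blast
    have tc: "t \<in> carrier (Fld K)" "t \<noteq> \<zero>\<^bsub>Fld K\<^esub>" using t by (auto simp: nonzeros_def)
    have "V.veq t w"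
      using t(3) tc w(1) \<open>w \<noteq> \<zero>\<^bsub>Fld K\<^esub>\<close> ordered_abelian_group.ole_refl[OF K.VGrp_ordered K.vmap_closed[OF wn]]
      by (simp add: V.veq_def K.vle_iff)
    then have "R.veq (f t) (f w)" using f_veq[OF tc(1) w(1)] by simp
    then have "R.veq (f t) (x \<ominus> f (a \<rho>))"
      using R.veq_trans[of "f t" "f w" "x \<ominus> f (a \<rho>)"] wx tc(1) w(1) x fa by simp
    then show ?thesis using t by blast
  qed blast
  then have "\<forall>\<rho>. \<exists>t. \<rho>\<^sub>0 \<le> \<rho> \<longrightarrow> t \<in> nonzeros K \<and> aut K t = t \<and> R.veq (f t) (x \<ominus> f (a \<rho>))" by blast
  from choice[OF this] obtain \<theta> where \<theta>: "\<And>\<rho>. \<rho>\<^sub>0 \<le> \<rho> \<Longrightarrow> \<theta> \<rho> \<in> nonzeros K \<and> aut K (\<theta> \<rho>) = \<theta> \<rho> \<and>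
      R.veq (f (\<theta> \<rho>)) (x \<ominus> f (a \<rho>))" by blast
  have \<theta>c: "\<theta> \<rho> \<in> carrier (Fld K)" "\<theta> \<rho> \<noteq> \<zero>\<^bsub>Fld K\<^esub>" "f (\<theta> \<rho>) \<in> carrier R" if "\<rho>\<^sub>0 \<le> \<rho>" for \<rho>
    using \<theta>[OF that] by (auto simp: nonzeros_def)
  have \<theta>_less: "\<not> f (\<theta> \<rho>') \<unlhd> f (\<theta> \<rho>)" if "\<rho>\<^sub>0 \<le> \<rho>" "\<rho> < \<rho>'" for \<rho> \<rho>'
  proof -
    have \<rho>': "\<rho>\<^sub>0 \<le> \<rho>'" using that by simp
    show ?thesis
      using R.veq_le_iff[of "f (\<theta> \<rho>')" "x \<ominus> f (a \<rho>')" "f (\<theta> \<rho>)" "x \<ominus> f (a \<rho>)"]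
        lim[OF that] \<theta>[OF that(1)] \<theta>[OF \<rho>'] \<theta>c(3)[OF that(1)] \<theta>c(3)[OF \<rho>'] x fa by simp
  qed
  define T where "T = (\<lambda>G. f \<circ> G) ` {G \<in> S. nonconstant K G}"
  have T: "finite T" "\<forall>g\<in>T. D.nonconst_poly g"
  proof -
    show "finite T" using S(1) by (simp add: T_def)
    show "\<forall>g\<in>T. D.nonconst_poly g"
    proof
      fix g assume "g \<in> T"
      then obtain G where G: "g = f \<circ> G" "G \<in> sigma_polys K" "nonconstant K G" using S(2) by (auto simp: T_def)
      note GD = sigma_polysD[OF F.ring_axioms G(2)]
      have nz: "g m \<noteq> \<zero> \<longleftrightarrow> G m \<noteq> \<zero>\<^bsub>Fld K\<^esub>" for m using f_zero_iff[of "G m"] GD by (auto simp: G(1))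
      then show "D.nonconst_poly g"
        using GD nonconstantD[OF F.ring_axioms G(2,3)] unfolding D.nonconst_poly_def nz by (simp add: G(1))
    qed
  qed
  have "\<exists>\<mu>. (\<forall>\<rho>\<ge>\<rho>\<^sub>0. \<mu> \<rho> \<in> f ` valring K \<and> R.veq ((f (a \<rho>) \<oplus> f (\<theta> \<rho>) \<otimes> \<mu> \<rho>) \<ominus> x) (f (\<theta> \<rho>))) \<and>
    (\<forall>g\<in>T. \<exists>\<rho>\<^sub>1. \<forall>\<rho> \<rho>'. \<rho>\<^sub>1 \<le> \<rho> \<and> \<rho> < \<rho>' \<longrightarrow>
      \<not> poly_eval R g (\<lambda>i. (\<sigma> ^^ i) x) \<ominus> poly_eval R g (\<lambda>i. (\<sigma> ^^ i) (f (a \<rho>') \<oplus> f (\<theta> \<rho>') \<otimes> \<mu> \<rho>')) \<unlhd>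
        poly_eval R g (\<lambda>i. (\<sigma> ^^ i) x) \<ominus> poly_eval R g (\<lambda>i. (\<sigma> ^^ i) (f (a \<rho>) \<oplus> f (\<theta> \<rho>) \<otimes> \<mu> \<rho>)))"
  proof (rule D.exists_generic_shift[OF x T])
    fix \<rho> assume \<rho>: "\<rho>\<^sub>0 \<le> \<rho>"
    have "R.veq (f (a \<rho>) \<ominus> x) (x \<ominus> f (a \<rho>))" using R.veq_minus_commute fa x by blast
    then have "R.veq (f (a \<rho>) \<ominus> x) (f (\<theta> \<rho>))"
      using R.veq_trans[of "f (a \<rho>) \<ominus> x" "x \<ominus> f (a \<rho>)" "f (\<theta> \<rho>)"] R.veq_sym[of "f (\<theta> \<rho>)" "x \<ominus> f (a \<rho>)"] \<theta>[OF \<rho>] \<theta>c(3)[OF \<rho>] fa x by simp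
    then show "f (\<theta> \<rho>) \<in> D.fixed \<and> f (\<theta> \<rho>) \<noteq> \<zero> \<and> f (a \<rho>) \<in> carrier R \<and> R.veq (f (a \<rho>) \<ominus> x) (f (\<theta> \<rho>))"
      using \<theta>[OF \<rho>] \<theta>c[OF \<rho>] f_aut[of "\<theta> \<rho>"] f_zero_iff[of "\<theta> \<rho>"] fa unfolding D.fixed_def by auto
  qed (rule \<theta>_less)
  then obtain \<mu>' where \<mu>': "\<And>\<rho>. \<rho>\<^sub>0 \<le> \<rho> \<Longrightarrow> \<mu>' \<rho> \<in> f ` valring K \<and> R.veq ((f (a \<rho>) \<oplus> f (\<theta> \<rho>) \<otimes> \<mu>' \<rho>) \<ominus> x) (f (\<theta> \<rho>))"
    "\<And>g. g \<in> T \<Longrightarrow> \<exists>\<rho>\<^sub>1. \<forall>\<rho> \<rho>'. \<rho>\<^sub>1 \<le> \<rho> \<and> \<rho> < \<rho>' \<longrightarrow>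
      \<not> poly_eval R g (\<lambda>i. (\<sigma> ^^ i) x) \<ominus> poly_eval R g (\<lambda>i. (\<sigma> ^^ i) (f (a \<rho>') \<oplus> f (\<theta> \<rho>') \<otimes> \<mu>' \<rho>')) \<unlhd>
        poly_eval R g (\<lambda>i. (\<sigma> ^^ i) x) \<ominus> poly_eval R g (\<lambda>i. (\<sigma> ^^ i) (f (a \<rho>) \<oplus> f (\<theta> \<rho>) \<otimes> \<mu>' \<rho>))"
    by blast
  define \<mu> where "\<mu> \<rho> = inv_into (valring K) f (\<mu>' \<rho>)" for \<rho>
  have \<mu>: "\<mu> \<rho> \<in> valring K" "f (\<mu> \<rho>) = \<mu>' \<rho>" "\<mu> \<rho> \<in> carrier (Fld K)" if "\<rho>\<^sub>0 \<le> \<rho>" for \<rho>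
    using \<mu>'(1)[OF that] inv_into_into[of "\<mu>' \<rho>" f "valring K"] f_inv_into_f[of "\<mu>' \<rho>" f "valring K"]
    by (auto simp: \<mu>_def valring_def)
  \<comment> \<open>Below \<open>\<rho>\<^sub>0\<close> nothing is known about \<theta> and \<mu>,
    so b agrees with a there; this only has to give elements of K.\<close>
  define b where "b \<rho> = (if \<rho>\<^sub>0 \<le> \<rho> then a \<rho> \<oplus>\<^bsub>Fld K\<^esub> \<theta> \<rho> \<otimes>\<^bsub>Fld K\<^esub> \<mu> \<rho> else a \<rho>)" for \<rho>
  have b: "b \<rho> \<in> carrier (Fld K)" for \<rho> using a \<theta>c \<mu> by (simp add: b_def)
  have fb: "f (b \<rho>) = f (a \<rho>) \<oplus> f (\<theta> \<rho>) \<otimes> \<mu>' \<rho>" if "\<rho>\<^sub>0 \<le> \<rho>" for \<rho>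
    using a \<theta>c[OF that] \<mu>[OF that] that by (simp add: b_def)
  have fbc: "f (b \<rho>) \<in> carrier R" for \<rho> using b by simp
  have bx: "R.veq (x \<ominus> f (b \<rho>)) (f (\<theta> \<rho>))" if "\<rho>\<^sub>0 \<le> \<rho>" for \<rho>
  proof -
    have "R.veq (f (b \<rho>) \<ominus> x) (f (\<theta> \<rho>))" using \<mu>'(1)[OF that] unfolding fb[OF that] by blast
    then show ?thesis
      using R.veq_trans[OF _ _ _ R.veq_minus_commute[OF x fbc]] fbc x \<theta>c(3)[OF that] by blast
  qed
  have b_less: "\<not> x \<ominus> f (b \<rho>') \<unlhd> x \<ominus> f (b \<rho>)" if "\<rho>\<^sub>0 \<le> \<rho>" "\<rho> < \<rho>'" for \<rho> \<rho>'
  proof -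
    have \<rho>': "\<rho>\<^sub>0 \<le> \<rho>'" using that by simp
    show ?thesis
      using R.veq_le_iff[of "x \<ominus> f (b \<rho>')" "f (\<theta> \<rho>')" "x \<ominus> f (b \<rho>)" "f (\<theta> \<rho>)"]
        \<theta>_less[OF that] bx[OF that(1)] bx[OF \<rho>'] \<theta>c(3)[OF that(1)] \<theta>c(3)[OF \<rho>'] x fbc by simp
  qed
  \<comment> \<open>Stated for any sequence c at distance v(\<theta>) from x, so that it serves for
    a, by the choice of \<theta>, and for b, by that of \<mu>.\<close>
  have increments: "V.veq (c \<rho>' \<ominus>\<^bsub>Fld K\<^esub> c \<rho>) (\<theta> \<rho>)"
    if c: "\<And>\<rho>. c \<rho> \<in> carrier (Fld K)" "R.veq (x \<ominus> f (c \<rho>)) (f (\<theta> \<rho>))" "\<not> x \<ominus> f (c \<rho>') \<unlhd> x \<ominus> f (c \<rho>)"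
      and \<rho>: "\<rho>\<^sub>0 \<le> \<rho>" for c \<rho> \<rho>'
  proof -
    have "R.veq (f (c \<rho>') \<ominus> f (c \<rho>)) (x \<ominus> f (c \<rho>))" using R.veq_increment[OF x _ _ c(3)] c(1) by simp
    then have "R.veq (f (c \<rho>') \<ominus> f (c \<rho>)) (f (\<theta> \<rho>))"
      using R.veq_trans[of "f (c \<rho>') \<ominus> f (c \<rho>)" "x \<ominus> f (c \<rho>)" "f (\<theta> \<rho>)"] c(1,2) x \<theta>c(3)[OF \<rho>] by simp
    then show ?thesis using f_veq[of "c \<rho>' \<ominus>\<^bsub>Fld K\<^esub> c \<rho>" "\<theta> \<rho>"] c(1) \<theta>c(1)[OF \<rho>] by (simp add: f_minus)
  qed
  have incb: "V.veq (b \<rho>' \<ominus>\<^bsub>Fld K\<^esub> b \<rho>) (\<theta> \<rho>)" if "\<rho>\<^sub>0 \<le> \<rho>" "\<rho> < \<rho>'" for \<rho> \<rho>'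
    using increments[of b \<rho> \<rho>'] b bx[OF that(1)] b_less[OF that] that by blast
  have inca: "V.veq (a \<rho>' \<ominus>\<^bsub>Fld K\<^esub> a \<rho>) (\<theta> \<rho>)" if "\<rho>\<^sub>0 \<le> \<rho>" "\<rho> < \<rho>'" for \<rho> \<rho>'
    using increments[of a \<rho> \<rho>'] a \<theta>[OF that(1)] lim[OF that] that R.veq_sym by blast
  have \<theta>K: "\<not> vle K (\<theta> \<rho>') (\<theta> \<rho>)" if "\<rho>\<^sub>0 \<le> \<rho>" "\<rho> < \<rho>'" for \<rho> \<rho>'
    using \<theta>_less[OF that] f_le[of "\<theta> \<rho>'" "\<theta> \<rho>"] \<theta>c(1)[of \<rho>] \<theta>c(1)[of \<rho>'] that by simp
  have "pc_sequence K b"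
    unfolding pc_sequence_def
  proof (intro conjI allI exI[of _ \<rho>\<^sub>0] impI)
    fix \<rho> \<rho>' \<rho>'' assume "\<rho>\<^sub>0 \<le> \<rho> \<and> \<rho> < \<rho>' \<and> \<rho>' < \<rho>''"
    then have \<rho>: "\<rho>\<^sub>0 \<le> \<rho>" "\<rho> < \<rho>'" "\<rho>\<^sub>0 \<le> \<rho>'" "\<rho>' < \<rho>''" by auto
    have "\<not> vle K (b \<rho>'' \<ominus>\<^bsub>Fld K\<^esub> b \<rho>') (b \<rho>' \<ominus>\<^bsub>Fld K\<^esub> b \<rho>)"
      using V.veq_le_iff[of "b \<rho>'' \<ominus>\<^bsub>Fld K\<^esub> b \<rho>'" "\<theta> \<rho>'" "b \<rho>' \<ominus>\<^bsub>Fld K\<^esub> b \<rho>" "\<theta> \<rho>"]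
        incb[OF \<rho>(1,2)] incb[OF \<rho>(3,4)] \<theta>K[OF \<rho>(1,2)] b \<theta>c(1)[OF \<rho>(1)] \<theta>c(1)[OF \<rho>(3)] by simp
    then show "vless K (b \<rho>' \<ominus>\<^bsub>Fld K\<^esub> b \<rho>) (b \<rho>'' \<ominus>\<^bsub>Fld K\<^esub> b \<rho>')" by (simp add: vle_def)
  qed (rule b)
  moreover have "pc_equiv K a b"
  proof (rule K.pc_equivI)
    fix \<rho> assume \<rho>: "\<rho>\<^sub>0 \<le> \<rho>"
    have "a \<rho> \<ominus>\<^bsub>Fld K\<^esub> b \<rho> = \<theta> \<rho> \<otimes>\<^bsub>Fld K\<^esub> (\<ominus>\<^bsub>Fld K\<^esub> \<mu> \<rho>)"
      by (rule F.minus_eqI) (use a \<theta>c[OF \<rho>] \<mu>[OF \<rho>] b \<rho> in \<open>simp_all add: b_def F.r_minus F.a_lcomm F.l_neg\<close>)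
    moreover have "vle K (\<theta> \<rho>) (\<theta> \<rho> \<otimes>\<^bsub>Fld K\<^esub> (\<ominus>\<^bsub>Fld K\<^esub> \<mu> \<rho>))"
      by (rule V.le_mult_right)
        (use \<theta>c[OF \<rho>] \<mu>[OF \<rho>] K.valring_iff V.le_uminus V.le_refl in simp_all)
    ultimately show "\<theta> \<rho> \<in> carrier (Fld K) \<and> vle K (\<theta> \<rho>) (a \<rho> \<ominus>\<^bsub>Fld K\<^esub> b \<rho>)" using \<theta>c[OF \<rho>] by simp
  qed (use a b inca incb \<theta>K in auto)
  moreover have "\<exists>\<rho>\<^sub>1. \<forall>\<rho> \<rho>'. \<rho>\<^sub>1 \<le> \<rho> \<and> \<rho> < \<rho>' \<longrightarrow>
      \<not> poly_eval R (f \<circ> G) (\<lambda>i. (\<sigma> ^^ i) x) \<ominus> f (sigma_eval K G (b \<rho>')) \<unlhd>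
        poly_eval R (f \<circ> G) (\<lambda>i. (\<sigma> ^^ i) x) \<ominus> f (sigma_eval K G (b \<rho>))" if G: "G \<in> S" "nonconstant K G" for G
  proof -
    have Gp: "G \<in> sigma_polys K" using S(2) G(1) by blast
    have "f \<circ> G \<in> T" using G by (auto simp: T_def)
    then obtain \<rho>\<^sub>1 where \<rho>1: "\<And>\<rho> \<rho>'. \<lbrakk>\<rho>\<^sub>1 \<le> \<rho>; \<rho> < \<rho>'\<rbrakk> \<Longrightarrow>
      \<not> poly_eval R (f \<circ> G) (\<lambda>i. (\<sigma> ^^ i) x) \<ominus> poly_eval R (f \<circ> G) (\<lambda>i. (\<sigma> ^^ i) (f (a \<rho>') \<oplus> f (\<theta> \<rho>') \<otimes> \<mu>' \<rho>')) \<unlhd>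
        poly_eval R (f \<circ> G) (\<lambda>i. (\<sigma> ^^ i) x) \<ominus> poly_eval R (f \<circ> G) (\<lambda>i. (\<sigma> ^^ i) (f (a \<rho>) \<oplus> f (\<theta> \<rho>) \<otimes> \<mu>' \<rho>))"
      using \<mu>'(2) by blast
    show ?thesis
    proof (intro exI[of _ "max \<rho>\<^sub>0 \<rho>\<^sub>1"] allI impI)
      fix \<rho> \<rho>' assume "max \<rho>\<^sub>0 \<rho>\<^sub>1 \<le> \<rho> \<and> \<rho> < \<rho>'"
      then have \<rho>: "\<rho>\<^sub>0 \<le> \<rho>" "\<rho>\<^sub>0 \<le> \<rho>'" "\<rho>\<^sub>1 \<le> \<rho>" "\<rho> < \<rho>'" by auto
      show "\<not> poly_eval R (f \<circ> G) (\<lambda>i. (\<sigma> ^^ i) x) \<ominus> f (sigma_eval K G (b \<rho>')) \<unlhd>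
        poly_eval R (f \<circ> G) (\<lambda>i. (\<sigma> ^^ i) x) \<ominus> f (sigma_eval K G (b \<rho>))"
        using \<rho>1[OF \<rho>(3,4)] unfolding f_sigma_eval(1)[OF Gp b] fb[OF \<rho>(1)] fb[OF \<rho>(2)] .
    qed
  qed
  ultimately show ?thesis by (intro exI[of _ b]) blast
qed

end

section \<open>The two statements: refinement with and without a given pseudolimit\<close>

lemma at_top_neq_bot: "(at_top :: 'i::{wellorder,no_top} filter) \<noteq> bot"
  by (auto simp: trivial_limit_def eventually_at_top_linorder)

lemma witt_extension_vdf_embedding:
  assumes K: "valued_difference_field K" "axiom2 K" "witt_case p K" "infinite (carrier (RFld K))"
    and L: "valued_difference_field L" "witt_case p L" and f: "vdf_embedding K L f"
  shows "witt_extension K (Fld L) (vle L) (aut L) p f"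
proof -
  interpret K: valued_difference_field K by fact
  interpret L: valued_difference_field L by fact
  interpret X: vf_extension K L f
    using f by (intro vf_extension.intro vf_extension_axioms.intro K.valued_field_axioms L.valued_field_axioms)
      (simp add: vdf_embedding_def)
  show ?thesis
  proof (intro witt_extension.intro witt_extension_axioms.intro K L.frobenius_lift_vle[OF L(2)])
    show "f \<in> ring_hom (Fld K) (Fld L)" by (rule X.emb_hom)
    show "vle L (f c) (f d) \<longleftrightarrow> vle K c d" if "c \<in> carrier (Fld K)" "d \<in> carrier (Fld K)" for c d
      using X.emb_vle_iff[OF that] .
    show "f (aut K c) = aut L (f c)" if "c \<in> carrier (Fld K)" for c
      using f that by (simp add: vdf_embedding_def)
  qed
qed

lemma pseudolimit_refinement:
  fixes K :: "('a, 'g, 'k, 'z) vdfield_scheme" and L :: "('b, 'h, 'l, 'y) vdfield_scheme"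
    and a :: "'i::{wellorder,no_top} \<Rightarrow> 'a"
  assumes K: "valued_difference_field K" "axiom2 K" "witt_case p K" "infinite (carrier (RFld K))"
    and L: "valued_difference_field L" "witt_case p L" "vdf_embedding K L f"
    and a: "pc_sequence K a" "x \<in> carrier (Fld L)" "pseudolimit L (f \<circ> a) x"
    and S: "finite S" "S \<subseteq> sigma_polys K"
  shows "\<exists>b. pc_sequence K b \<and> pc_equiv K a b \<and> (\<forall>G \<in> S. nonconstant K G \<longrightarrow>
     pseudolimit L (\<lambda>\<rho>. f (sigma_eval K G (b \<rho>))) (sigma_eval L (f \<circ> G) x))"
proof -
  interpret W: witt_extension K "Fld L" "vle L" "aut L" p f
    by (rule witt_extension_vdf_embedding[OF K L])
  obtain \<rho>\<^sub>0 where lim: "\<And>\<rho> \<rho>'. \<lbrakk>\<rho>\<^sub>0 \<le> \<rho>; \<rho> < \<rho>'\<rbrakk> \<Longrightarrow> \<not> vle L (x \<ominus>\<^bsub>Fld L\<^esub> f (a \<rho>')) (x \<ominus>\<^bsub>Fld L\<^esub> f (a \<rho>))"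
    using a(3) unfolding pseudolimit_def vle_def by auto
  have "a \<rho> \<in> carrier (Fld K)" for \<rho> using a(1) by (simp add: pc_sequence_def)
  from W.exists_equivalent_pc_sequence[where a = a and \<rho>\<^sub>0 = \<rho>\<^sub>0, OF this a(2) lim S] show ?thesis
    unfolding pseudolimit_def vle_def sigma_eval_eq_poly_eval[of L] not_not .
qed

text \<open>Without a given pseudolimit, the class of the sequence itself in an ultrapower of the field
  serves as one.\<close>

lemma pc_sequence_refinement:
  fixes K :: "('a, 'g, 'k, 'z) vdfield_scheme" and a :: "'i::{wellorder,no_top} \<Rightarrow> 'a"
  assumes K: "valued_difference_field K" "axiom2 K" "witt_case p K" "infinite (carrier (RFld K))"
    and a: "pc_sequence K a" and S: "finite S" "S \<subseteq> sigma_polys K"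
  shows "\<exists>b. pc_sequence K b \<and> pc_equiv K a b \<and>
     (\<forall>G \<in> S. nonconstant K G \<longrightarrow> pc_sequence K (\<lambda>\<rho>. sigma_eval K G (b \<rho>)))"
proof -
  interpret K: valued_difference_field K by (rule K)
  interpret V: frobenius_lift "Fld K" "vle K" "aut K" p by (rule K.frobenius_lift_vle[OF K(3)])
  \<comment> \<open>\<open>U\<close> refines the filter of final segments, so whatever holds at all
    large indices holds almost everywhere.\<close>
  obtain U :: "'i filter" where U: "U \<le> at_top" "U \<noteq> bot" "\<And>P. eventually P U \<or> eventually (\<lambda>i. \<not> P i) U"
    using ultrafilter_exists[OF at_top_neq_bot] by blast
  interpret P: frobenius_ultrapower "Fld K" "vle K" "aut K" p U
    by (intro frobenius_ultrapower.intro field_ultrapower.intro field_ultrapower_axioms.intro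
        V.frobenius_lift_axioms V.field_axioms U)
  interpret W: witt_extension K P.UR P.ule P.usigma p P.embed
    by (intro witt_extension.intro witt_extension_axioms.intro K P.frobenius_lift_ultrapower
        P.embed_hom P.embed_ule P.embed_sigma)
  have ac: "a \<rho> \<in> carrier (Fld K)" for \<rho> using a by (simp add: pc_sequence_def)
  obtain \<rho>\<^sub>0 where \<rho>0: "\<And>\<rho> \<rho>' \<rho>''. \<lbrakk>\<rho>\<^sub>0 \<le> \<rho>; \<rho> < \<rho>'; \<rho>' < \<rho>''\<rbrakk> \<Longrightarrow>
      \<not> vle K (a \<rho>'' \<ominus>\<^bsub>Fld K\<^esub> a \<rho>') (a \<rho>' \<ominus>\<^bsub>Fld K\<^esub> a \<rho>)"
    using a unfolding pc_sequence_def vle_def not_not by blast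
  define x where "x = unf U a"
  have x: "x \<in> carrier P.UR" unfolding x_def by (rule P.unf_closed) (simp add: ac)
  have diff: "\<forall>\<^sub>F i in U. (x \<ominus>\<^bsub>P.UR\<^esub> P.embed (a \<rho>)) i = a i \<ominus>\<^bsub>Fld K\<^esub> a \<rho>" for \<rho>
    using P.UR_minus[OF x P.embed_closed[OF ac[of \<rho>]]] P.embed_coord[of "a \<rho>"] unf_eventually[of U a, folded x_def]
    by eventually_elim simp
  have lim: "\<not> P.ule (x \<ominus>\<^bsub>P.UR\<^esub> P.embed (a \<rho>')) (x \<ominus>\<^bsub>P.UR\<^esub> P.embed (a \<rho>))"
    if \<rho>: "\<rho>\<^sub>0 \<le> \<rho>" "\<rho> < \<rho>'" for \<rho> \<rho>'
  proof -
    obtain \<tau> where \<tau>: "\<rho>' < \<tau>" using gt_ex by blast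
    have "\<forall>\<^sub>F i in at_top. \<tau> \<le> i" by (auto simp: eventually_at_top_linorder)
    then have "\<forall>\<^sub>F i in U. \<tau> \<le> i" using U(1) by (auto simp: le_filter_def)
    then have "\<forall>\<^sub>F i in U. \<not> vle K (a i \<ominus>\<^bsub>Fld K\<^esub> a \<rho>') (a i \<ominus>\<^bsub>Fld K\<^esub> a \<rho>)"
    proof eventually_elim
      case (elim i)
      then have i: "\<rho>' < i" using \<tau> by simp
      \<comment> \<open>The later increment has the larger value, so the difference between
        \<open>a i\<close> and \<open>a \<rho>\<close> has the value of the increment from \<rho> to
        \<rho>'.\<close>
      have "(a i \<ominus>\<^bsub>Fld K\<^esub> a \<rho>') \<oplus>\<^bsub>Fld K\<^esub> (a \<rho>' \<ominus>\<^bsub>Fld K\<^esub> a \<rho>) = a i \<ominus>\<^bsub>Fld K\<^esub> a \<rho>"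
        using V.diff_add_diff ac by blast
      then have "vle K (a i \<ominus>\<^bsub>Fld K\<^esub> a \<rho>) (a \<rho>' \<ominus>\<^bsub>Fld K\<^esub> a \<rho>)"
        using V.strict_le_add(2)[OF _ _ \<rho>0[OF \<rho> i]] ac
        by (simp add: V.a_comm[of "a i \<ominus>\<^bsub>Fld K\<^esub> a \<rho>'"])
      then show ?case
        using V.le_trans[of "a i \<ominus>\<^bsub>Fld K\<^esub> a \<rho>'" "a i \<ominus>\<^bsub>Fld K\<^esub> a \<rho>" "a \<rho>' \<ominus>\<^bsub>Fld K\<^esub> a \<rho>"] \<rho>0[OF \<rho> i] ac by auto
    qed
    then show ?thesis unfolding P.not_ule using diff[of \<rho>] diff[of \<rho>'] by eventually_elim simp
  qed
  let ?grows = "\<lambda>G b. \<exists>\<rho>\<^sub>1. \<forall>\<rho> \<rho>'. \<rho>\<^sub>1 \<le> \<rho> \<and> \<rho> < \<rho>' \<longrightarrow>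
      \<not> P.ule (poly_eval P.UR (P.embed \<circ> G) (\<lambda>i. (P.usigma ^^ i) x) \<ominus>\<^bsub>P.UR\<^esub> P.embed (sigma_eval K G (b \<rho>')))
        (poly_eval P.UR (P.embed \<circ> G) (\<lambda>i. (P.usigma ^^ i) x) \<ominus>\<^bsub>P.UR\<^esub> P.embed (sigma_eval K G (b \<rho>)))"
  have "\<exists>b. pc_sequence K b \<and> pc_equiv K a b \<and> (\<forall>G\<in>S. nonconstant K G \<longrightarrow> ?grows G b)"
    by (rule W.exists_equivalent_pc_sequence[OF ac x lim S])
  then obtain b where b: "pc_sequence K b" "pc_equiv K a b"
    and growth: "\<forall>G\<in>S. nonconstant K G \<longrightarrow> ?grows G b"
    by (elim exE conjE) (rule that)
  have bc: "b \<rho> \<in> carrier (Fld K)" for \<rho> using b(1) by (simp add: pc_sequence_def)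
  have "pc_sequence K (\<lambda>\<rho>. sigma_eval K G (b \<rho>))" if G: "G \<in> S" "nonconstant K G" for G
  proof -
    have Gp: "G \<in> sigma_polys K" using S(2) G(1) by blast
    define c where "c \<rho> = sigma_eval K G (b \<rho>)" for \<rho>
    define y where "y = poly_eval P.UR (P.embed \<circ> G) (\<lambda>i. (P.usigma ^^ i) x)"
    have c: "c \<rho> \<in> carrier (Fld K)" for \<rho> unfolding c_def by (rule W.f_sigma_eval(2)[OF Gp bc])
    note ec = P.embed_closed[OF c]
    have y: "y \<in> carrier P.UR"
    proof -
      have "(P.usigma ^^ i) x \<in> carrier P.UR" for i by (induction i) (use x P.usigma_closed in auto)
      moreover have "(P.embed \<circ> G) m \<in> carrier P.UR" for m
        using sigma_polysD[OF V.ring_axioms Gp] P.embed_closed by simp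
      ultimately show ?thesis unfolding y_def poly_eval_def
        by (intro P.UR.finsum_closed) (auto intro!: P.UR.m_closed P.UR.mono_eval_closed)
    qed
    obtain \<rho>\<^sub>1 where \<rho>1: "\<And>\<rho> \<rho>'. \<lbrakk>\<rho>\<^sub>1 \<le> \<rho>; \<rho> < \<rho>'\<rbrakk> \<Longrightarrow>
        \<not> P.ule (y \<ominus>\<^bsub>P.UR\<^esub> P.embed (c \<rho>')) (y \<ominus>\<^bsub>P.UR\<^esub> P.embed (c \<rho>))"
      using bspec[OF growth G(1)] G(2) unfolding y_def c_def by blast
    have "pc_sequence K c"
      unfolding pc_sequence_def
    proof (intro conjI allI exI[of _ \<rho>\<^sub>1] impI)
      fix \<rho> \<rho>' \<rho>'' assume "\<rho>\<^sub>1 \<le> \<rho> \<and> \<rho> < \<rho>' \<and> \<rho>' < \<rho>''"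
      then have \<rho>: "\<rho>\<^sub>1 \<le> \<rho>" "\<rho> < \<rho>'" "\<rho>\<^sub>1 \<le> \<rho>'" "\<rho>' < \<rho>''" by auto
      \<comment> \<open>By \<open>veq_increment\<close> the increments of c have the values of its
        distances from y, which grow strictly; the embedding then carries the comparison back to
        K.\<close>
      have "\<not> P.ule (P.embed (c \<rho>'') \<ominus>\<^bsub>P.UR\<^esub> P.embed (c \<rho>')) (P.embed (c \<rho>') \<ominus>\<^bsub>P.UR\<^esub> P.embed (c \<rho>))"
        using W.R.veq_le_iff[OF _ _ _ _ W.R.veq_increment[OF y ec ec \<rho>1[OF \<rho>(3,4)]] W.R.veq_increment[OF y ec ec \<rho>1[OF \<rho>(1,2)]]]
          \<rho>1[OF \<rho>(1,2)] y ec by simp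
      then have "\<not> vle K (c \<rho>'' \<ominus>\<^bsub>Fld K\<^esub> c \<rho>') (c \<rho>' \<ominus>\<^bsub>Fld K\<^esub> c \<rho>)"
        using P.embed_ule by (simp add: c flip: W.f_minus)
      then show "vless K (c \<rho>' \<ominus>\<^bsub>Fld K\<^esub> c \<rho>) (c \<rho>'' \<ominus>\<^bsub>Fld K\<^esub> c \<rho>')" by (simp add: vle_def)
    qed (rule c)
    then show ?thesis unfolding c_def .
  qed
  then show ?thesis using b by blast
qed

theorem theorem4p4:
  fixes K :: "('a, 'g, 'k) vdfield" and p :: nat
  assumes "valued_difference_field K" and "axiom2 K" and "witt_case p K"
    and "infinite (carrier (RFld K))"
  shows
    "(\<forall>(a :: 'i::{wellorder,no_top} \<Rightarrow> 'a) (L :: ('b, 'h, 'l) vdfield) f x S.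
        pc_sequence K a \<and>
        valued_difference_field L \<and> witt_case p L \<and> vdf_embedding K L f \<and>
        x \<in> carrier (Fld L) \<and> pseudolimit L (f \<circ> a) x \<and>
        finite S \<and> S \<subseteq> sigma_polys K \<longrightarrow>
        (\<exists>b. pc_sequence K b \<and> pc_equiv K a b \<and>
           (\<forall>G \<in> S. nonconstant K G \<longrightarrow>
              pseudolimit L (\<lambda>\<rho>. f (sigma_eval K G (b \<rho>))) (sigma_eval L (f \<circ> G) x)))) \<and>
     (\<forall>(a :: 'i \<Rightarrow> 'a) S.
        pc_sequence K a \<and> finite S \<and> S \<subseteq> sigma_polys K \<longrightarrow>
        (\<exists>b. pc_sequence K b \<and> pc_equiv K a b \<and>
           (\<forall>G \<in> S. nonconstant K G \<longrightarrow> pc_sequence K (\<lambda>\<rho>. sigma_eval K G (b \<rho>)))))"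
proof (intro conjI allI impI; elim conjE)
  fix a :: "'i \<Rightarrow> 'a" and L :: "('b, 'h, 'l) vdfield" and f x S
  assume "pc_sequence K a" "valued_difference_field L" "witt_case p L" "vdf_embedding K L f"
    "x \<in> carrier (Fld L)" "pseudolimit L (f \<circ> a) x" "finite S" "S \<subseteq> sigma_polys K"
  with assms show "\<exists>b. pc_sequence K b \<and> pc_equiv K a b \<and> (\<forall>G \<in> S. nonconstant K G \<longrightarrow>
      pseudolimit L (\<lambda>\<rho>. f (sigma_eval K G (b \<rho>))) (sigma_eval L (f \<circ> G) x))"
    by (intro pseudolimit_refinement)
next
  fix a :: "'i \<Rightarrow> 'a" and S
  assume "pc_sequence K a" "finite S" "S \<subseteq> sigma_polys K"
  with assms show "\<exists>b. pc_sequence K b \<and> pc_equiv K a b \<and>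
      (\<forall>G \<in> S. nonconstant K G \<longrightarrow> pc_sequence K (\<lambda>\<rho>. sigma_eval K G (b \<rho>)))"
    by (intro pc_sequence_refinement)
qed

end
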